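(* Let $\Lambda^\vee$ be a lattice (free abelian group of finite rank), $I$ an even symmetric bilinear form on $\Lambda^\vee$, and $J$ an integral bilinear form on $\Lambda^\vee$ with $I(m,n)=J(m,n)+J(n,m)$. Let $r_{bas}^{an}$ be the analytic basic representation of the crossed module $\Theta'_{\mathbb C}$, let $C(r_{bas}^{an})$ be its centraliser crossed module, and let $E$ be the crossed module $\eta:\Lambda^\vee\times\mathbb C^\times\to\widetilde{\Lambda^\vee}$ (all defined in the context). Then there is an equivalence of crossed modules $$F: E\longrightarrow C(r_{bas}^{an}),$$ i.e. a strict homomorphism of crossed modules inducing isomorphisms on $\pi_0$ and $\pi_1$.
   Context: **Crossed modules.** A crossed module $\Psi$ is a group homomorphism $\psi:G_1\to G_0$, written $\alpha\mapsto\underline\alpha$, with a right action $(\alpha,x)\mapsto\alpha^x$ of $G_0$ on $G_1$ such that $\underline{\alpha^x}=x^{-1}\underline\alpha x$ and $\beta^{\underline\alpha}=\alpha^{-1}\beta\alpha$. Put $\pi_0=\operatorname{coker}\psi$, $\pi_1=\ker\psi$. A (strict) homomorphism $f=(f_0,f_1)$ from $\psi:G_1\to G_0$ to $\phi:H_1\to H_0$ is a pair of group homomorphisms $f_i:G_i\to H_i$ with $\phi f_1=f_0\psi$ and $f_1(\alpha^x)=f_1(\alpha)^{f_0(x)}$. **Centraliser.** For such $f$, let $C_0(f)$ be the group of pairs $(h,\chi)$, $h\in H_0$, $\chi:G_0\to H_1$, with $\underline{\chi(s)}=f_0(s^{-1})h^{-1}f_0(s)h$, $\chi(\underline\alpha)=f_1(\alpha^{-1})f_1(\alpha)^h$,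 $\chi(st)=\chi(s)^{f_0(t)}\chi(t)$, with multiplication $(h,\chi)(k,\sigma)=(hk,\,s\mapsto\sigma(s)\chi(s)^k)$. The centraliser $C(f)$ is the crossed module $\gamma:H_1\to C_0(f)$, $\zeta\mapsto(\underline\zeta,\ s\mapsto(\zeta^{f_0(s)})^{-1}\zeta)$, with action $\zeta^{(h,\chi)}=\zeta^h$. In the Lie setting $\chi$ is required to be analytic; for $f=r_{bas}^{an}$ below this means that $(x,t)\mapsto\chi(x,\epsilon)(t)$ is holomorphic on $\mathfrak h\times T_{\mathbb C}$ for each $\epsilon\in\{\pm1\}$. **The crossed module $\Theta'_{\mathbb C}$.** Let $\mathfrak h=\Lambda^\vee\otimes\mathbb C$, $T_{\mathbb C}=\Lambda^\vee\otimes\mathbb C^\times$, $\exp:\mathfrak h\to T_{\mathbb C}$ the map $\Lambda^\vee\otimes e^{2\pi i(-)}$; extend $J$ bilinearly to $\mathfrak h$. $\Theta'_{\mathbb C}$ is $\theta'_{\mathbb C}:\Lambda^\vee\times\mathbb C^\times\to\mathfrak h\rtimes\{\pm1\}$, $(m,z)\mapsto(m,1)$, where $(x,\epsilon)(y,\delta)=(x+\epsilon y,\epsilon\delta)$ and the action is $(m,z)^{(x,\epsilon)}=(\epsilon m,\ z e^{2\pi iJ(m,x)})$. **Analytic basic representation.** Let $(\Gamma\mathcal O^{an}_{T_{\mathbb C}})^\times$ be the group of nowhere vanishing holomorphic functions on $T_{\mathbb C}$ and $Aut^{an}_{var}(T_{\mathbb C})$ the group of holomorphic automorphisms of the complex analytic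 variety $T_{\mathbb C}$, acting on functions from the right by precomposition. View $(\Gamma\mathcal O^{an}_{T_{\mathbb C}})^\times$ as a crossed module over $Aut^{an}_{var}(T_{\mathbb C})$ via the trivial map. For $\lambda\in\Lambda=\operatorname{Hom}(\Lambda^\vee,\mathbb Z)$ let $e^{2\pi i\lambda}$ be the corresponding character of $T_{\mathbb C}$, and let $J^\sharp(m)=J(m,-)\in\Lambda$. Then $r_{bas}^{an}$ is the strict crossed module homomorphism from $\Theta'_{\mathbb C}$ to this crossed module given in degree $1$ by $(m,z)\mapsto z\,e^{2\pi iJ^\sharp(m)}$ and in degree $0$ by sending $(x,1)$ to translation (multiplication) by $\exp(x)$ and $(x,-1)$ to $t\mapsto \exp(x)t^{-1}$. **The crossed module $E$.** Let $\widetilde{\Lambda^\vee}$ be the central extension of $\Lambda^\vee$ by $\mathbb Z/2\mathbb Z$ (written additively) defined by the $2$-cocycle $(m,n)\mapsto[J(n,m)]\in\mathbb Z/2\mathbb Z$, so elements are pairs $(n,\iota)$ with $(n,\iota)(n',\iota')=(n+n',\iota+\iota'+[J(n',n)])$. $E$ is the crossed module $\eta:\Lambda^\vee\times\mathbb C^\times\to\widetilde{\Lambda^\vee}$, $(m,z)\mapsto(2m,0)$, with action $(m,z)^{(n,\iota)}=(m,(-1)^{J(n,m)}z)$. *)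

theory Defs
  imports Complex_Main "HOL-Algebra.Free_Abelian_Groups" "HOL-Algebra.Generated_Groups"
    "HOL-Algebra.Bij"
begin

section \<open>Crossed modules\<close>

record ('a, 'b) xmod =
  Top :: "'a monoid"
  Base :: "'b monoid"
  bnd :: "'a \<Rightarrow> 'b"
  act :: "'a \<Rightarrow> 'b \<Rightarrow> 'a"

text \<open>The action is a right action by group automorphisms.\<close>

definition crossed_module :: "('a, 'b) xmod \<Rightarrow> bool" where
  "crossed_module X \<longleftrightarrow>
     group (Top X) \<and> group (Base X) \<and> bnd X \<in> hom (Top X) (Base X) \<and>
     (\<forall>x\<in>carrier (Base X). (\<lambda>a. act X a x) \<in> hom (Top X) (Top X)) \<and>
     (\<forall>a\<in>carrier (Top X). act X a \<one>\<^bsub>Base X\<^esub> = a) \<and>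
     (\<forall>a\<in>carrier (Top X). \<forall>x\<in>carrier (Base X). \<forall>y\<in>carrier (Base X).
        act X a (x \<otimes>\<^bsub>Base X\<^esub> y) = act X (act X a x) y) \<and>
     (\<forall>a\<in>carrier (Top X). \<forall>x\<in>carrier (Base X).
        bnd X (act X a x) = inv\<^bsub>Base X\<^esub> x \<otimes>\<^bsub>Base X\<^esub> bnd X a \<otimes>\<^bsub>Base X\<^esub> x) \<and>
     (\<forall>a\<in>carrier (Top X). \<forall>b\<in>carrier (Top X).
        act X b (bnd X a) = inv\<^bsub>Top X\<^esub> a \<otimes>\<^bsub>Top X\<^esub> b \<otimes>\<^bsub>Top X\<^esub> a)"

definition xmod_hom ::
  "('a, 'b) xmod \<Rightarrow> ('c, 'd) xmod \<Rightarrow> ('a \<Rightarrow> 'c) \<Rightarrow> ('b \<Rightarrow> 'd) \<Rightarrow> bool" where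
  "xmod_hom X Y f1 f0 \<longleftrightarrow>
     crossed_module X \<and> crossed_module Y \<and>
     f1 \<in> hom (Top X) (Top Y) \<and> f0 \<in> hom (Base X) (Base Y) \<and>
     (\<forall>a\<in>carrier (Top X). bnd Y (f1 a) = f0 (bnd X a)) \<and>
     (\<forall>a\<in>carrier (Top X). \<forall>x\<in>carrier (Base X). f1 (act X a x) = act Y (f1 a) (f0 x))"

definition pi0 :: "('a, 'b) xmod \<Rightarrow> 'b set monoid" where
  "pi0 X = Base X Mod (bnd X ` carrier (Top X))"

definition pi1 :: "('a, 'b) xmod \<Rightarrow> 'a monoid" where
  "pi1 X = (Top X)\<lparr>carrier := kernel (Top X) (Base X) (bnd X)\<rparr>"

text \<open>
  The map induced on cokernels by \<open>f0\<close> sends the coset of \<open>x\<close> to the coset of \<open>f0 x\<close>; since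
  \<open>f0\<close> maps image into image, the latter coset is the product of the image of \<open>bnd Y\<close> with the
  direct image of the former.
\<close>

definition pi0_map :: "('c, 'd) xmod \<Rightarrow> ('b \<Rightarrow> 'd) \<Rightarrow> 'b set \<Rightarrow> 'd set" where
  "pi0_map Y f0 = (\<lambda>C. (bnd Y ` carrier (Top Y)) <#>\<^bsub>Base Y\<^esub> (f0 ` C))"

definition xmod_equivalence ::
  "('a, 'b) xmod \<Rightarrow> ('c, 'd) xmod \<Rightarrow> ('a \<Rightarrow> 'c) \<Rightarrow> ('b \<Rightarrow> 'd) \<Rightarrow> bool" where
  "xmod_equivalence X Y f1 f0 \<longleftrightarrow>
     xmod_hom X Y f1 f0 \<and> pi0_map Y f0 \<in> iso (pi0 X) (pi0 Y) \<and> f1 \<in> iso (pi1 X) (pi1 Y)"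

text \<open>
  The centraliser of \<open>(f1, f0)\<close>. The predicate \<open>reg\<close> is the regularity imposed on \<open>\<chi>\<close>
  (analyticity in the Lie setting). The maps \<open>\<chi>\<close> are extensional, so that equality of elements
  is equality of functions on the group \<open>Base X\<close>.
\<close>

definition centraliser0 ::
  "(('b \<Rightarrow> 'c) \<Rightarrow> bool) \<Rightarrow> ('a, 'b) xmod \<Rightarrow> ('c, 'd) xmod \<Rightarrow> ('a \<Rightarrow> 'c) \<Rightarrow> ('b \<Rightarrow> 'd)
     \<Rightarrow> ('d \<times> ('b \<Rightarrow> 'c)) monoid" where
  "centraliser0 reg X Y f1 f0 =
     \<lparr>carrier = {(h, \<chi>).
        h \<in> carrier (Base Y) \<and> \<chi> \<in> carrier (Base X) \<rightarrow>\<^sub>E carrier (Top Y) \<and> reg \<chi> \<and>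
        (\<forall>s\<in>carrier (Base X).
           bnd Y (\<chi> s) = f0 (inv\<^bsub>Base X\<^esub> s) \<otimes>\<^bsub>Base Y\<^esub> inv\<^bsub>Base Y\<^esub> h \<otimes>\<^bsub>Base Y\<^esub> f0 s \<otimes>\<^bsub>Base Y\<^esub> h) \<and>
        (\<forall>a\<in>carrier (Top X).
           \<chi> (bnd X a) = f1 (inv\<^bsub>Top X\<^esub> a) \<otimes>\<^bsub>Top Y\<^esub> act Y (f1 a) h) \<and>
        (\<forall>s\<in>carrier (Base X). \<forall>t\<in>carrier (Base X).
           \<chi> (s \<otimes>\<^bsub>Base X\<^esub> t) = act Y (\<chi> s) (f0 t) \<otimes>\<^bsub>Top Y\<^esub> \<chi> t)},
      mult = (\<lambda>(h, \<chi>) (k, \<sigma>).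
        (h \<otimes>\<^bsub>Base Y\<^esub> k, \<lambda>s\<in>carrier (Base X). \<sigma> s \<otimes>\<^bsub>Top Y\<^esub> act Y (\<chi> s) k)),
      one = (\<one>\<^bsub>Base Y\<^esub>, \<lambda>s\<in>carrier (Base X). \<one>\<^bsub>Top Y\<^esub>)\<rparr>"

definition centraliser ::
  "(('b \<Rightarrow> 'c) \<Rightarrow> bool) \<Rightarrow> ('a, 'b) xmod \<Rightarrow> ('c, 'd) xmod \<Rightarrow> ('a \<Rightarrow> 'c) \<Rightarrow> ('b \<Rightarrow> 'd)
     \<Rightarrow> ('c, 'd \<times> ('b \<Rightarrow> 'c)) xmod" where
  "centraliser reg X Y f1 f0 =
     \<lparr>Top = Top Y,
      Base = centraliser0 reg X Y f1 f0,
      bnd = (\<lambda>\<zeta>. (bnd Y \<zeta>,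
        \<lambda>s\<in>carrier (Base X). inv\<^bsub>Top Y\<^esub> (act Y \<zeta> (f0 s)) \<otimes>\<^bsub>Top Y\<^esub> \<zeta>)),
      act = (\<lambda>\<zeta> (h, \<chi>). act Y \<zeta> h)\<rparr>"


section \<open>Lattices and tensor products\<close>

text \<open>Abelian groups, the lattice included, are written multiplicatively, as in HOL-Algebra.\<close>

definition int_basis :: "'l monoid \<Rightarrow> 'l set \<Rightarrow> bool" where
  "int_basis L B \<longleftrightarrow> finite B \<and> B \<subseteq> carrier L \<and>
     bij_betw (\<lambda>c. finprod L (\<lambda>b. b [^]\<^bsub>L\<^esub> (c b :: int)) B) (B \<rightarrow>\<^sub>E UNIV) (carrier L)"

definition int_bilinear :: "'l monoid \<Rightarrow> ('l \<Rightarrow> 'l \<Rightarrow> int) \<Rightarrow> bool" where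
  "int_bilinear L \<beta> \<longleftrightarrow>
     (\<forall>m\<in>carrier L. \<beta> m \<in> hom L integer_group \<and> (\<lambda>n. \<beta> n m) \<in> hom L integer_group)"

definition Cadd :: "complex monoid" where
  "Cadd = \<lparr>carrier = UNIV, mult = (+), one = 0\<rparr>"

definition Cmult :: "complex monoid" where
  "Cmult = \<lparr>carrier = UNIV - {0}, mult = (*), one = 1\<rparr>"

definition tensor_relations ::
  "'l monoid \<Rightarrow> 'a monoid \<Rightarrow> (('l \<times> 'a) \<Rightarrow>\<^sub>0 int) set" where
  "tensor_relations L A =
     {frag_of (m \<otimes>\<^bsub>L\<^esub> n, a) - frag_of (m, a) - frag_of (n, a) | m n a.
        m \<in> carrier L \<and> n \<in> carrier L \<and> a \<in> carrier A} \<union>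
     {frag_of (m, a \<otimes>\<^bsub>A\<^esub> b) - frag_of (m, a) - frag_of (m, b) | m a b.
        m \<in> carrier L \<and> a \<in> carrier A \<and> b \<in> carrier A}"

definition tensor_kernel ::
  "'l monoid \<Rightarrow> 'a monoid \<Rightarrow> (('l \<times> 'a) \<Rightarrow>\<^sub>0 int) set" where
  "tensor_kernel L A =
     generate (free_Abelian_group (carrier L \<times> carrier A)) (tensor_relations L A)"

definition tensor ::
  "'l monoid \<Rightarrow> 'a monoid \<Rightarrow> (('l \<times> 'a) \<Rightarrow>\<^sub>0 int) set monoid" where
  "tensor L A = free_Abelian_group (carrier L \<times> carrier A) Mod tensor_kernel L A"

definition pure_tensor ::
  "'l monoid \<Rightarrow> 'a monoid \<Rightarrow> 'l \<Rightarrow> 'a \<Rightarrow> (('l \<times> 'a) \<Rightarrow>\<^sub>0 int) set" where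
  "pure_tensor L A m a =
     tensor_kernel L A #>\<^bsub>free_Abelian_group (carrier L \<times> carrier A)\<^esub> frag_of (m, a)"

text \<open>The homomorphism out of the tensor product determined by a bilinear map \<open>\<beta>\<close>.\<close>

definition tensor_lift ::
  "'l monoid \<Rightarrow> 'a monoid \<Rightarrow> 'g monoid \<Rightarrow> ('l \<Rightarrow> 'a \<Rightarrow> 'g)
     \<Rightarrow> (('l \<times> 'a) \<Rightarrow>\<^sub>0 int) set \<Rightarrow> 'g" where
  "tensor_lift L A G \<beta> =
     (THE f. f \<in> hom (tensor L A) G \<and> f \<in> extensional (carrier (tensor L A)) \<and>
        (\<forall>m\<in>carrier L. \<forall>a\<in>carrier A. f (pure_tensor L A m a) = \<beta> m a))"

type_synonym 'l ctensor = "(('l \<times> complex) \<Rightarrow>\<^sub>0 int) set"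

definition hh :: "'l monoid \<Rightarrow> 'l ctensor monoid" where
  "hh L = tensor L Cadd"

definition TC :: "'l monoid \<Rightarrow> 'l ctensor monoid" where
  "TC L = tensor L Cmult"

definition exp_T :: "'l monoid \<Rightarrow> 'l ctensor \<Rightarrow> 'l ctensor" where
  "exp_T L = tensor_lift L Cadd (TC L)
     (\<lambda>m c. pure_tensor L Cmult m (exp (2 * of_real pi * \<i> * c)))"

text \<open>For \<open>\<mu>\<close> in the dual lattice, \<open>extend_h L \<mu>\<close> is its complex linear extension to
  \<open>hh L\<close> and \<open>character L \<mu>\<close> the character \<open>n \<otimes> z \<mapsto> z ^ \<mu>(n)\<close> of \<open>TC L\<close>.\<close>

definition extend_h :: "'l monoid \<Rightarrow> ('l \<Rightarrow> int) \<Rightarrow> 'l ctensor \<Rightarrow> complex" where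
  "extend_h L \<mu> = tensor_lift L Cadd Cadd (\<lambda>n c. of_int (\<mu> n) * c)"

definition character :: "'l monoid \<Rightarrow> ('l \<Rightarrow> int) \<Rightarrow> 'l ctensor \<Rightarrow> complex" where
  "character L \<mu> = tensor_lift L Cmult Cmult (\<lambda>n z. z powi \<mu> n)"


section \<open>Complex structure\<close>

text \<open>
  Complex (Frechet) differentiability, at every point of an open set \<open>S\<close>, of a function of the
  variables \<open>z i\<close> with \<open>i\<close> in the finite set \<open>I\<close>. The numbers \<open>a i\<close> are the partial derivatives.
  An explicit index set is used because the rank of the lattice, hence the dimension, may be any
  natural number, including zero.
\<close>

definition holomorphic_vars ::
  "'i set \<Rightarrow> ('i \<Rightarrow> complex) set \<Rightarrow> (('i \<Rightarrow> complex) \<Rightarrow> complex) \<Rightarrow> bool" where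
  "holomorphic_vars I S F \<longleftrightarrow>
     (\<forall>z\<in>S. \<exists>a. \<forall>e>0. \<exists>d>0. \<forall>w\<in>S. (\<forall>i\<in>I. cmod (w i - z i) < d) \<longrightarrow>
        cmod (F w - F z - (\<Sum>i\<in>I. a i * (w i - z i))) \<le> e * (\<Sum>i\<in>I. cmod (w i - z i)))"

text \<open>
  A basis \<open>B\<close> of the lattice gives the global chart \<open>z \<mapsto> \<Sum>b. b \<otimes> z b\<close> from \<open>A ^ B\<close> to
  \<open>L \<otimes> A\<close>, where \<open>A\<close> is the additive or the multiplicative group of the complex numbers. The
  complex structure so defined does not depend on \<open>B\<close>.
\<close>

definition chart ::
  "'l monoid \<Rightarrow> complex monoid \<Rightarrow> 'l set \<Rightarrow> ('l \<Rightarrow> complex) \<Rightarrow> 'l ctensor" where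
  "chart L A B z = finprod (tensor L A) (\<lambda>b. pure_tensor L A b (z b)) B"

definition coords ::
  "'l monoid \<Rightarrow> complex monoid \<Rightarrow> 'l set \<Rightarrow> 'l ctensor \<Rightarrow> ('l \<Rightarrow> complex)" where
  "coords L A B = the_inv_into (B \<rightarrow>\<^sub>E carrier A) (chart L A B)"

definition holomorphic_fun_T :: "'l monoid \<Rightarrow> 'l set \<Rightarrow> ('l ctensor \<Rightarrow> complex) \<Rightarrow> bool" where
  "holomorphic_fun_T L B f \<longleftrightarrow>
     holomorphic_vars B (B \<rightarrow>\<^sub>E UNIV - {0}) (\<lambda>z. f (chart L Cmult B z))"

definition holomorphic_map_T ::
  "'l monoid \<Rightarrow> 'l set \<Rightarrow> ('l ctensor \<Rightarrow> 'l ctensor) \<Rightarrow> bool" where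
  "holomorphic_map_T L B \<phi> \<longleftrightarrow>
     (\<forall>b\<in>B. holomorphic_fun_T L B (\<lambda>t. coords L Cmult B (\<phi> t) b))"

definition holomorphic_fun_hT ::
  "'l monoid \<Rightarrow> 'l set \<Rightarrow> ('l ctensor \<Rightarrow> 'l ctensor \<Rightarrow> complex) \<Rightarrow> bool" where
  "holomorphic_fun_hT L B f \<longleftrightarrow>
     holomorphic_vars (B <+> B) (Pi\<^sub>E (B <+> B) (case_sum (\<lambda>_. UNIV) (\<lambda>_. UNIV - {0})))
       (\<lambda>w. f (chart L Cadd B (w \<circ> Inl)) (chart L Cmult B (w \<circ> Inr)))"


section \<open>The analytic basic representation and its centraliser\<close>

definition Theta_base :: "'l monoid \<Rightarrow> ('l ctensor \<times> int) monoid" where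
  "Theta_base L =
     \<lparr>carrier = carrier (hh L) \<times> {1, -1},
      mult = (\<lambda>(x, \<epsilon>) (y, \<delta>). (x \<otimes>\<^bsub>hh L\<^esub> (y [^]\<^bsub>hh L\<^esub> \<epsilon>), \<epsilon> * \<delta>)),
      one = (\<one>\<^bsub>hh L\<^esub>, 1)\<rparr>"

text \<open>The lattice is mapped to \<open>hh L\<close> by \<open>m \<mapsto> m \<otimes> 1\<close>.\<close>

definition Theta ::
  "'l monoid \<Rightarrow> ('l \<Rightarrow> 'l \<Rightarrow> int) \<Rightarrow> ('l \<times> complex, 'l ctensor \<times> int) xmod" where
  "Theta L J =
     \<lparr>Top = L \<times>\<times> Cmult,
      Base = Theta_base L,
      bnd = (\<lambda>(m, z). (pure_tensor L Cadd m 1, 1)),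
      act = (\<lambda>(m, z) (x, \<epsilon>).
        (m [^]\<^bsub>L\<^esub> \<epsilon>, z * exp (2 * of_real pi * \<i> * extend_h L (J m) x)))\<rparr>"

definition units_OT :: "'l monoid \<Rightarrow> 'l set \<Rightarrow> ('l ctensor \<Rightarrow> complex) monoid" where
  "units_OT L B =
     \<lparr>carrier = {f \<in> carrier (TC L) \<rightarrow>\<^sub>E UNIV - {0}. holomorphic_fun_T L B f},
      mult = (\<lambda>f g. \<lambda>t\<in>carrier (TC L). f t * g t),
      one = (\<lambda>t\<in>carrier (TC L). 1)\<rparr>"

definition Aut_T :: "'l monoid \<Rightarrow> 'l set \<Rightarrow> ('l ctensor \<Rightarrow> 'l ctensor) monoid" where
  "Aut_T L B = (BijGroup (carrier (TC L)))\<lparr>carrier :=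
     {\<phi> \<in> Bij (carrier (TC L)). holomorphic_map_T L B \<phi> \<and>
        holomorphic_map_T L B (inv_into (carrier (TC L)) \<phi>)}\<rparr>"

definition Fun_T ::
  "'l monoid \<Rightarrow> 'l set \<Rightarrow> ('l ctensor \<Rightarrow> complex, 'l ctensor \<Rightarrow> 'l ctensor) xmod" where
  "Fun_T L B =
     \<lparr>Top = units_OT L B,
      Base = Aut_T L B,
      bnd = (\<lambda>f. \<one>\<^bsub>Aut_T L B\<^esub>),
      act = (\<lambda>f \<phi>. compose (carrier (TC L)) f \<phi>)\<rparr>"

definition rbas1 ::
  "'l monoid \<Rightarrow> ('l \<Rightarrow> 'l \<Rightarrow> int) \<Rightarrow> 'l \<times> complex \<Rightarrow> 'l ctensor \<Rightarrow> complex" where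
  "rbas1 L J = (\<lambda>(m, z). \<lambda>t\<in>carrier (TC L). z * character L (J m) t)"

definition rbas0 :: "'l monoid \<Rightarrow> 'l ctensor \<times> int \<Rightarrow> 'l ctensor \<Rightarrow> 'l ctensor" where
  "rbas0 L = (\<lambda>(x, \<epsilon>). \<lambda>t\<in>carrier (TC L). exp_T L x \<otimes>\<^bsub>TC L\<^esub> (t [^]\<^bsub>TC L\<^esub> \<epsilon>))"

definition analytic_chi ::
  "'l monoid \<Rightarrow> 'l set \<Rightarrow> ('l ctensor \<times> int \<Rightarrow> 'l ctensor \<Rightarrow> complex) \<Rightarrow> bool" where
  "analytic_chi L B \<chi> \<longleftrightarrow> (\<forall>\<epsilon>\<in>{1, -1}. holomorphic_fun_hT L B (\<lambda>x t. \<chi> (x, \<epsilon>) t))"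

definition C_rbas ::
  "'l monoid \<Rightarrow> 'l set \<Rightarrow> ('l \<Rightarrow> 'l \<Rightarrow> int) \<Rightarrow>
     ('l ctensor \<Rightarrow> complex,
      ('l ctensor \<Rightarrow> 'l ctensor) \<times> ('l ctensor \<times> int \<Rightarrow> 'l ctensor \<Rightarrow> complex)) xmod" where
  "C_rbas L B J =
     centraliser (analytic_chi L B) (Theta L J) (Fun_T L B) (rbas1 L J) (rbas0 L)"


section \<open>The crossed module \<open>E\<close>\<close>

text \<open>The group of order two is represented by the residues 0 and 1.\<close>

definition central_ext :: "'l monoid \<Rightarrow> ('l \<Rightarrow> 'l \<Rightarrow> int) \<Rightarrow> ('l \<times> int) monoid" where
  "central_ext L J =
     \<lparr>carrier = carrier L \<times> {0, 1},
      mult = (\<lambda>(n, \<iota>) (n', \<iota>'). (n \<otimes>\<^bsub>L\<^esub> n', (\<iota> + \<iota>' + J n' n) mod 2)),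
      one = (\<one>\<^bsub>L\<^esub>, 0)\<rparr>"

definition E_xmod ::
  "'l monoid \<Rightarrow> ('l \<Rightarrow> 'l \<Rightarrow> int) \<Rightarrow> ('l \<times> complex, 'l \<times> int) xmod" where
  "E_xmod L J =
     \<lparr>Top = L \<times>\<times> Cmult,
      Base = central_ext L J,
      bnd = (\<lambda>(m, z). (m [^]\<^bsub>L\<^esub> (2::int), 0)),
      act = (\<lambda>(m, z) (n, \<iota>). (m, (-1) powi J n m * z))\<rparr>"

end

theory Submission
  imports Defs "HOL-Analysis.Complex_Transcendental"
begin

text \<open>
  An automorphism of the torus commuting with all translations is a translation, and commuting with
  inversion makes it a translation by a two-torsion point \<open>exp (n / 2)\<close>, which is the pure tensor
  of \<open>n\<close> with \<open>-1\<close>. For each \<open>n\<close> there is a standard cocycle, namely \<open>exp (\<pi> i J(x, n))\<close> on \<open>(x, 1)\<close>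
  and \<open>exp (\<pi> i J(x, n))\<close> times the character of \<open>- J(-, n)\<close> on \<open>(x, -1)\<close>; the sign left undetermined
  on the second component is the extra \<open>\<int>/2\<close> of the extension. An arbitrary cocycle over the same
  \<open>n\<close> differs from the standard one by a cocycle trivial on the lattice, so evaluation at the unit
  of the torus descends along the exponential map to a nowhere vanishing holomorphic function
  whose coboundary it is on translations. What remains is a constant of square one on inversion.
  No classification of the units of the torus is needed.
\<close>

section \<open>Holomorphic functions of several variables\<close>

text \<open>The standard cocycle over \<open>n\<close> is nearly forced. Over the translation given
  by \<open>n\<close>, the lattice condition prescribes the sign (-1)^J(m,n), the value of the
  character J(m,-) at a point of order two; halving the linear form 2 pi i J(-,n) extends this sign
  from the lattice to \<open>hh L\<close>. The relation (0,-1)(x,1) = (-x,1)(0,-1) then requires the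
  value at (0,-1) to be divided by exp (2 pi i J(x,n)) when its argument is translated by exp x. So
  that value is a constant times the inverse character, and the constant squares to one because
  (0,-1) is an involution. The data of \<open>E\<close> have the same source. Multiplying pairs
  evaluates the character of \<open>n\<close> at the point of order two belonging to
  \<open>n'\<close>, which yields the cocycle J(n',n). The exponent 2 pi i of a character against pi
  i in the standard cocycle makes the coboundary of a character the standard cocycle of a doubled
  lattice element, whence the boundary map of \<open>E\<close>.\<close>

definition holomorphic_at ::
  "'i set \<Rightarrow> ('i \<Rightarrow> complex) set \<Rightarrow> (('i \<Rightarrow> complex) \<Rightarrow> complex) \<Rightarrow> ('i \<Rightarrow> complex) \<Rightarrow> bool" where
  "holomorphic_at I S F z \<longleftrightarrow>
     (\<exists>a. \<forall>e>0. \<exists>d>0. \<forall>w\<in>S. (\<forall>i\<in>I. cmod (w i - z i) < d) \<longrightarrow>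
        cmod (F w - F z - (\<Sum>i\<in>I. a i * (w i - z i))) \<le> e * (\<Sum>i\<in>I. cmod (w i - z i)))"

text \<open>Differentiability at one point is isolated because descent along the exponential map
  composes with a logarithm that is differentiable only near the chosen point.\<close>

lemma holomorphic_vars_iff: "holomorphic_vars I S F \<longleftrightarrow> (\<forall>z\<in>S. holomorphic_at I S F z)"
  by (simp add: holomorphic_vars_def holomorphic_at_def)

text \<open>The epsilon-delta clause of the definition as a filter, so that the limit theorems
  apply. As there, only the coordinates in \<open>I\<close> are controlled and the points stay in
  \<open>S\<close>.\<close>

definition var_nhds :: "'i set \<Rightarrow> ('i \<Rightarrow> complex) set \<Rightarrow> ('i \<Rightarrow> complex) \<Rightarrow> ('i \<Rightarrow> complex) filter" where
  "var_nhds I S z = (INF d\<in>{0<..}. principal {w \<in> S. \<forall>i\<in>I. cmod (w i - z i) < d})"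

lemma eventually_var_nhds:
  "eventually P (var_nhds I S z) \<longleftrightarrow>
     (\<exists>d>0. \<forall>w\<in>S. (\<forall>i\<in>I. cmod (w i - z i) < d) \<longrightarrow> P w)"
proof -
  have "eventually P (var_nhds I S z) \<longleftrightarrow>
    (\<exists>d\<in>{0<..}. eventually P (principal {w \<in> S. \<forall>i\<in>I. cmod (w i - z i) < d}))"
    unfolding var_nhds_def
  proof (rule eventually_INF_base)
    fix a b :: real
    assume "a \<in> {0<..}" "b \<in> {0<..}"
    then show "\<exists>x\<in>{0<..}. principal {w \<in> S. \<forall>i\<in>I. cmod (w i - z i) < x}
        \<le> inf (principal {w \<in> S. \<forall>i\<in>I. cmod (w i - z i) < a})
              (principal {w \<in> S. \<forall>i\<in>I. cmod (w i - z i) < b})"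
      by (intro bexI[of _ "min a b"]) auto
  qed auto
  then show ?thesis
    by (simp add: eventually_principal Bex_def Ball_def imp_conjL)
qed

lemma eventually_var_nhds_mem: "eventually (\<lambda>w. w \<in> S) (var_nhds I S z)"
  by (auto simp: eventually_var_nhds intro!: exI[of _ 1])

lemma tendsto_var_nhds: "i \<in> I \<Longrightarrow> ((\<lambda>w. w i) \<longlongrightarrow> z i) (var_nhds I S z)"
  by (auto simp: tendsto_iff eventually_var_nhds dist_norm)

lemma filterlim_var_nhds:
  assumes "finite I" "\<And>i. i \<in> I \<Longrightarrow> ((\<lambda>w. G w i) \<longlongrightarrow> z i) F" "eventually (\<lambda>w. G w \<in> S) F"
  shows "filterlim G (var_nhds I S z) F"
  unfolding filterlim_iff
proof (intro allI impI)
  fix P assume "eventually P (var_nhds I S z)"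
  then obtain d where d: "d > 0" "\<And>w. w \<in> S \<Longrightarrow> (\<forall>i\<in>I. cmod (w i - z i) < d) \<Longrightarrow> P w"
    by (auto simp: eventually_var_nhds)
  have "eventually (\<lambda>w. \<forall>i\<in>I. cmod (G w i - z i) < d) F"
    using assms(1,2) d(1) by (simp add: eventually_ball_finite tendsto_iff dist_norm)
  with assms(3) show "eventually (\<lambda>w. P (G w)) F"
    by eventually_elim (use d(2) in blast)
qed

text \<open>
  Caratheodory's form of differentiability turns the rules of calculus into algebra of limits.
  Its coefficients are obtained from the error term of the definition by dividing by the
  \<open>\<ell>\<^sup>1\<close> norm and multiplying by the conjugate sign of each increment.
\<close>

lemma holomorphic_at_caratheodory:
  assumes "finite I"
  shows "holomorphic_at I S F z \<longleftrightarrow>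
    (\<exists>q l. (\<forall>w\<in>S. F w = F z + (\<Sum>i\<in>I. q i w * (w i - z i))) \<and>
           (\<forall>i\<in>I. (q i \<longlongrightarrow> l i) (var_nhds I S z)))" (is "_ \<longleftrightarrow> ?R")
proof
  assume "holomorphic_at I S F z"
  then obtain a where a: "\<And>e. e > 0 \<Longrightarrow> \<exists>d>0. \<forall>w\<in>S. (\<forall>i\<in>I. cmod (w i - z i) < d) \<longrightarrow>
        cmod (F w - F z - (\<Sum>i\<in>I. a i * (w i - z i))) \<le> e * (\<Sum>i\<in>I. cmod (w i - z i))"
    unfolding holomorphic_at_def by blast
  define r where "r w = F w - F z - (\<Sum>i\<in>I. a i * (w i - z i))" for w
  define N where "N w = (\<Sum>i\<in>I. cmod (w i - z i))" for w
  define q where "q i w = a i + r w / of_real (N w) * cnj (sgn (w i - z i))" for i w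
  have N0: "N w \<ge> 0" for w unfolding N_def by (simp add: sum_nonneg)
  have a': "\<exists>d>0. \<forall>w\<in>S. (\<forall>i\<in>I. cmod (w i - z i) < d) \<longrightarrow> cmod (r w) \<le> e * N w" if "e > 0" for e
    using a[OF that] unfolding r_def N_def .
  have cs: "cnj (sgn u) * u = of_real (cmod u)" for u :: complex
    using complex_norm_square[of u]
    by (cases "u = 0") (auto simp: sgn_div_norm scaleR_conv_of_real power2_eq_square field_simps)
  have 1: "F w = F z + (\<Sum>i\<in>I. q i w * (w i - z i))" if "w \<in> S" for w
  proof -
    have "(\<Sum>i\<in>I. q i w * (w i - z i)) = (\<Sum>i\<in>I. a i * (w i - z i)) +
       (\<Sum>i\<in>I. r w / of_real (N w) * (cnj (sgn (w i - z i)) * (w i - z i)))"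
      unfolding q_def by (simp only: distrib_right sum.distrib mult.assoc)
    also have "(\<Sum>i\<in>I. r w / of_real (N w) * (cnj (sgn (w i - z i)) * (w i - z i)))
      = r w / of_real (N w) * of_real (N w)"
      unfolding cs N_def by (simp add: sum_distrib_left)
    also have "\<dots> = r w"
    proof (cases "N w = 0")
      \<comment> \<open>Division by zero gives 0, so the error term itself has to vanish. The
        estimate with a fixed \<open>e\<close>, applied to this \<open>w\<close> with all increments
        zero, provides that.\<close>
      case True
      then have "\<forall>i\<in>I. cmod (w i - z i) = 0"
        unfolding N_def using assms by (simp add: sum_nonneg_eq_0_iff)
      then have "r w = 0" using a'[of 1] that True by fastforce
      then show ?thesis by simp
    qed simp
    finally show ?thesis by (simp add: r_def)
  qed
  have 2: "(q i \<longlongrightarrow> a i) (var_nhds I S z)" for i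
    unfolding tendsto_iff
  proof (intro allI impI)
    fix e :: real assume "e > 0"
    then obtain d where d: "d > 0"
      "\<And>w. w \<in> S \<Longrightarrow> (\<forall>i\<in>I. cmod (w i - z i) < d) \<Longrightarrow> cmod (r w) \<le> e/2 * N w"
      using a'[of "e/2"] by auto
    have "dist (q i w) (a i) < e" if "w \<in> S" "\<forall>i\<in>I. cmod (w i - z i) < d" for w
    proof -
      have "dist (q i w) (a i) = cmod (r w) / N w * cmod (sgn (w i - z i))"
        using N0[of w] by (simp add: q_def dist_norm norm_mult norm_divide)
      also have "\<dots> \<le> cmod (r w) / N w * 1"
        using N0[of w] by (intro mult_left_mono) (auto simp: norm_sgn)
      also have "\<dots> \<le> e / 2"
        using d(2)[OF that] N0[of w] \<open>e > 0\<close> by (cases "N w = 0") (auto simp: field_simps)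
      also have "\<dots> < e" using \<open>e > 0\<close> by simp
      finally show ?thesis .
    qed
    with d(1) show "eventually (\<lambda>w. dist (q i w) (a i) < e) (var_nhds I S z)"
      by (auto simp: eventually_var_nhds)
  qed
  from 1 2 show ?R by blast
next
  assume ?R
  then obtain q l where q: "\<And>w. w \<in> S \<Longrightarrow> F w = F z + (\<Sum>i\<in>I. q i w * (w i - z i))"
    "\<And>i. i \<in> I \<Longrightarrow> (q i \<longlongrightarrow> l i) (var_nhds I S z)" by blast
  have "\<exists>d>0. \<forall>w\<in>S. (\<forall>i\<in>I. cmod (w i - z i) < d) \<longrightarrow>
        cmod (F w - F z - (\<Sum>i\<in>I. l i * (w i - z i))) \<le> e * (\<Sum>i\<in>I. cmod (w i - z i))"
    if "e > 0" for e
  proof -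
    have "eventually (\<lambda>w. \<forall>i\<in>I. cmod (q i w - l i) < e) (var_nhds I S z)"
      using assms q(2) that by (simp add: eventually_ball_finite tendsto_iff dist_norm)
    then obtain d where d: "d > 0"
      "\<And>w. w \<in> S \<Longrightarrow> (\<forall>i\<in>I. cmod (w i - z i) < d) \<Longrightarrow> \<forall>i\<in>I. cmod (q i w - l i) < e"
      by (auto simp: eventually_var_nhds)
    have "cmod (F w - F z - (\<Sum>i\<in>I. l i * (w i - z i))) \<le> e * (\<Sum>i\<in>I. cmod (w i - z i))"
      if w: "w \<in> S" "\<forall>i\<in>I. cmod (w i - z i) < d" for w
    proof -
      have "F w - F z - (\<Sum>i\<in>I. l i * (w i - z i)) = (\<Sum>i\<in>I. (q i w - l i) * (w i - z i))"
        using q(1)[OF w(1)] by (simp add: left_diff_distrib sum_subtractf)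
      also have "cmod \<dots> \<le> (\<Sum>i\<in>I. cmod ((q i w - l i) * (w i - z i)))"
        by (rule norm_sum)
      also have "\<dots> \<le> (\<Sum>i\<in>I. e * cmod (w i - z i))"
        using d(2)[OF w] by (intro sum_mono) (simp add: norm_mult mult_right_mono less_imp_le)
      finally show ?thesis by (simp add: sum_distrib_left)
    qed
    with d(1) show ?thesis by blast
  qed
  then show "holomorphic_at I S F z" unfolding holomorphic_at_def by blast
qed

section \<open>Rules of differentiation\<close>

lemma holomorphic_atE:
  assumes "holomorphic_at I S F z" "finite I"
  obtains q l where "\<And>w. w \<in> S \<Longrightarrow> F w = F z + (\<Sum>i\<in>I. q i w * (w i - z i))"
    "\<And>i. i \<in> I \<Longrightarrow> (q i \<longlongrightarrow> l i) (var_nhds I S z)"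
  using assms(1) unfolding holomorphic_at_caratheodory[OF assms(2)] by blast

lemma holomorphic_at_tendsto:
  assumes "finite I" "holomorphic_at I S F z"
  shows "(F \<longlongrightarrow> F z) (var_nhds I S z)"
proof -
  obtain q l where q: "\<And>w. w \<in> S \<Longrightarrow> F w = F z + (\<Sum>i\<in>I. q i w * (w i - z i))"
    "\<And>i. i \<in> I \<Longrightarrow> (q i \<longlongrightarrow> l i) (var_nhds I S z)"
    by (rule holomorphic_atE[OF assms(2,1)]) blast
  have "((\<lambda>w. F z + (\<Sum>i\<in>I. q i w * (w i - z i))) \<longlongrightarrow> F z + (\<Sum>i\<in>I. l i * (z i - z i)))
      (var_nhds I S z)"
    by (intro tendsto_intros q(2) tendsto_var_nhds)
  then have "((\<lambda>w. F z + (\<Sum>i\<in>I. q i w * (w i - z i))) \<longlongrightarrow> F z) (var_nhds I S z)"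
    by simp
  moreover have "eventually (\<lambda>w. F z + (\<Sum>i\<in>I. q i w * (w i - z i)) = F w) (var_nhds I S z)"
    using eventually_var_nhds_mem by (rule eventually_mono) (rule q(1)[symmetric])
  ultimately show ?thesis
    by (rule Lim_transform_eventually)
qed

text \<open>In Caratheodory form the chain rule is multiplication of the two matrices of slope
  functions. Limits of the outer slopes pass through \<open>G\<close> because \<open>G\<close>,
  being differentiable at \<open>z\<close>, tends to \<open>G z\<close> inside
  \<open>S'\<close>.\<close>

lemma holomorphic_at_compose:
  assumes "finite I" "finite K"
    and G: "\<And>i. i \<in> I \<Longrightarrow> holomorphic_at K S (\<lambda>w. G w i) z"
    and S: "\<And>w. w \<in> S \<Longrightarrow> G w \<in> S'"
    and F: "holomorphic_at I S' F (G z)"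
  shows "holomorphic_at K S (\<lambda>w. F (G w)) z"
proof -
  obtain Q L where Q: "\<And>w. w \<in> S' \<Longrightarrow> F w = F (G z) + (\<Sum>i\<in>I. Q i w * (w i - G z i))"
    "\<And>i. i \<in> I \<Longrightarrow> (Q i \<longlongrightarrow> L i) (var_nhds I S' (G z))"
    by (rule holomorphic_atE[OF F assms(1)]) blast
  have "\<forall>i\<in>I. \<exists>q l. (\<forall>w\<in>S. G w i = G z i + (\<Sum>j\<in>K. q j w * (w j - z j))) \<and>
           (\<forall>j\<in>K. (q j \<longlongrightarrow> l j) (var_nhds K S z))"
    using G unfolding holomorphic_at_caratheodory[OF assms(2)] by blast
  then obtain q l where
    q: "\<And>i w. i \<in> I \<Longrightarrow> w \<in> S \<Longrightarrow> G w i = G z i + (\<Sum>j\<in>K. q i j w * (w j - z j))"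
       "\<And>i j. i \<in> I \<Longrightarrow> j \<in> K \<Longrightarrow> (q i j \<longlongrightarrow> l i j) (var_nhds K S z)"
    unfolding bchoice_iff by blast
  have lim: "filterlim G (var_nhds I S' (G z)) (var_nhds K S z)"
  proof (rule filterlim_var_nhds[OF assms(1)])
    show "((\<lambda>w. G w i) \<longlongrightarrow> G z i) (var_nhds K S z)" if "i \<in> I" for i
      using holomorphic_at_tendsto[OF assms(2) G[OF that]] .
    show "eventually (\<lambda>w. G w \<in> S') (var_nhds K S z)"
      using eventually_var_nhds_mem S by (rule eventually_mono)
  qed
  show ?thesis
    unfolding holomorphic_at_caratheodory[OF assms(2)]
  proof (intro exI conjI ballI)
    show "F (G w) = F (G z) + (\<Sum>j\<in>K. (\<Sum>i\<in>I. Q i (G w) * q i j w) * (w j - z j))"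
      if "w \<in> S" for w
    proof -
      have "F (G w) = F (G z) + (\<Sum>i\<in>I. Q i (G w) * (\<Sum>j\<in>K. q i j w * (w j - z j)))"
        using Q(1)[OF S[OF that]] q(1)[OF _ that] by simp
      also have "(\<Sum>i\<in>I. Q i (G w) * (\<Sum>j\<in>K. q i j w * (w j - z j)))
         = (\<Sum>i\<in>I. \<Sum>j\<in>K. Q i (G w) * q i j w * (w j - z j))"
        by (simp add: sum_distrib_left algebra_simps)
      also have "\<dots> = (\<Sum>j\<in>K. \<Sum>i\<in>I. Q i (G w) * q i j w * (w j - z j))"
        by (rule sum.swap)
      finally show ?thesis by (simp add: sum_distrib_right)
    qed
    show "((\<lambda>w. \<Sum>i\<in>I. Q i (G w) * q i j w) \<longlongrightarrow> (\<Sum>i\<in>I. L i * l i j)) (var_nhds K S z)"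
      if "j \<in> K" for j
      by (intro tendsto_intros q(2) that filterlim_compose[OF Q(2) lim])
  qed
qed

lemma holomorphic_at_compose_field:
  assumes "finite I" "holomorphic_at I S F z" "(g has_field_derivative g') (at (F z))"
  shows "holomorphic_at I S (\<lambda>w. g (F w)) z"
proof -
  obtain q l where q: "\<And>w. w \<in> S \<Longrightarrow> F w = F z + (\<Sum>i\<in>I. q i w * (w i - z i))"
    "\<And>i. i \<in> I \<Longrightarrow> (q i \<longlongrightarrow> l i) (var_nhds I S z)"
    by (rule holomorphic_atE[OF assms(2,1)]) blast
  obtain k where k: "\<And>u. g u - g (F z) = k u * (u - F z)" "isCont k (F z)"
    using assms(3) unfolding CARAT_DERIV by blast
  show ?thesis
    unfolding holomorphic_at_caratheodory[OF assms(1)]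
  proof (intro exI conjI ballI)
    show "g (F w) = g (F z) + (\<Sum>i\<in>I. (k (F w) * q i w) * (w i - z i))" if "w \<in> S" for w
    proof -
      have "g (F w) = g (F z) + k (F w) * (F w - F z)" using k(1)[of "F w"] by (simp add: algebra_simps)
      also have "F w - F z = (\<Sum>i\<in>I. q i w * (w i - z i))" using q(1)[OF that] by simp
      finally show ?thesis by (simp add: sum_distrib_left mult.assoc)
    qed
    show "((\<lambda>w. k (F w) * q i w) \<longlongrightarrow> k (F z) * l i) (var_nhds I S z)" if "i \<in> I" for i
      by (intro tendsto_intros q(2) that isCont_tendsto_compose[OF k(2)]
          holomorphic_at_tendsto[OF assms(1,2)])
  qed
qed

lemma holomorphic_at_const: "holomorphic_at I S (\<lambda>_. c) z"
  unfolding holomorphic_at_def by (intro exI[of _ "\<lambda>_. 0"]) (auto intro!: exI[of _ 1] sum_nonneg mult_nonneg_nonneg)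

lemma holomorphic_at_var:
  assumes "finite I" "i \<in> I"
  shows "holomorphic_at I S (\<lambda>w. w i) z"
  unfolding holomorphic_at_caratheodory[OF assms(1)]
proof (intro exI conjI ballI)
  show "w i = z i + (\<Sum>j\<in>I. (if j = i then 1 else 0) * (w j - z j))" for w
    using assms by (simp add: if_distrib[where f="\<lambda>x. x * _"] cong: if_cong)
  show "((\<lambda>w. if j = i then 1 else 0) \<longlongrightarrow> (if j = i then 1 else 0)) (var_nhds I S z)" for j
    by (rule tendsto_const)
qed

lemma holomorphic_at_mult:
  assumes "finite I" "holomorphic_at I S F z" "holomorphic_at I S G z"
  shows "holomorphic_at I S (\<lambda>w. F w * G w) z"
proof -
  obtain q l where q: "\<And>w. w \<in> S \<Longrightarrow> F w = F z + (\<Sum>i\<in>I. q i w * (w i - z i))"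
    "\<And>i. i \<in> I \<Longrightarrow> (q i \<longlongrightarrow> l i) (var_nhds I S z)"
    by (rule holomorphic_atE[OF assms(2,1)]) blast
  obtain p k where p: "\<And>w. w \<in> S \<Longrightarrow> G w = G z + (\<Sum>i\<in>I. p i w * (w i - z i))"
    "\<And>i. i \<in> I \<Longrightarrow> (p i \<longlongrightarrow> k i) (var_nhds I S z)"
    by (rule holomorphic_atE[OF assms(3,1)]) blast
  show ?thesis
    unfolding holomorphic_at_caratheodory[OF assms(1)]
  proof (intro exI conjI ballI)
    show "F w * G w = F z * G z + (\<Sum>i\<in>I. (F w * p i w + G z * q i w) * (w i - z i))"
      if "w \<in> S" for w
    proof -
      \<comment> \<open>Keeping \<open>F w\<close> rather than \<open>F z\<close> in the middle term
        leaves no product of two increments; its limit comes from the continuity of \<open>F\<close>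
        at \<open>z\<close>.\<close>
      have "F w * G w = F z * G z + F w * (G w - G z) + G z * (F w - F z)"
        by (simp add: algebra_simps)
      also have "G w - G z = (\<Sum>i\<in>I. p i w * (w i - z i))" using p(1)[OF that] by simp
      also have "F w - F z = (\<Sum>i\<in>I. q i w * (w i - z i))" using q(1)[OF that] by simp
      finally show ?thesis
        by (simp add: sum_distrib_left sum.distrib distrib_right mult.assoc add.assoc)
    qed
    show "((\<lambda>w. F w * p i w + G z * q i w) \<longlongrightarrow> F z * k i + G z * l i) (var_nhds I S z)"
      if "i \<in> I" for i
      by (intro tendsto_intros q(2) p(2) that holomorphic_at_tendsto[OF assms(1,2)])
  qed
qed

lemma holomorphic_at_cong:
  assumes "holomorphic_at I S F z" "z \<in> S" "\<And>w. w \<in> S \<Longrightarrow> F w = G w"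
  shows "holomorphic_at I S G z"
proof -
  have "\<And>w. w \<in> S \<Longrightarrow> G w = F w" "G z = F z" using assms by auto
  then show ?thesis using assms(1) by (simp add: holomorphic_at_def cong: ball_cong)
qed

lemma holomorphic_vars_cong:
  assumes "holomorphic_vars I S F" "\<And>w. w \<in> S \<Longrightarrow> F w = G w"
  shows "holomorphic_vars I S G"
  unfolding holomorphic_vars_iff
proof
  fix z assume "z \<in> S"
  with assms(1) have "holomorphic_at I S F z" by (simp add: holomorphic_vars_iff)
  then show "holomorphic_at I S G z"
    using \<open>z \<in> S\<close> assms(2) by (rule holomorphic_at_cong)
qed

lemma holomorphic_vars_compose:
  assumes "holomorphic_vars I S' F" "finite I" "finite K"
    and "\<And>i. i \<in> I \<Longrightarrow> holomorphic_vars K S (\<lambda>w. G w i)"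
    and "\<And>w. w \<in> S \<Longrightarrow> G w \<in> S'"
  shows "holomorphic_vars K S (\<lambda>w. F (G w))"
  unfolding holomorphic_vars_iff
proof
  fix z assume "z \<in> S"
  with assms show "holomorphic_at K S (\<lambda>w. F (G w)) z"
    by (intro holomorphic_at_compose[of I K S G z S' F]) (auto simp: holomorphic_vars_iff)
qed

lemma holomorphic_vars_compose_field:
  assumes "holomorphic_vars I S F" "finite I"
    and "\<And>w. w \<in> S \<Longrightarrow> g field_differentiable at (F w)"
  shows "holomorphic_vars I S (\<lambda>w. g (F w))"
  unfolding holomorphic_vars_iff
proof
  fix z assume "z \<in> S"
  with assms obtain g' where "(g has_field_derivative g') (at (F z))"
    unfolding field_differentiable_def by blast
  with assms \<open>z \<in> S\<close> show "holomorphic_at I S (\<lambda>w. g (F w)) z"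
    by (intro holomorphic_at_compose_field[of I S F z g g']) (auto simp: holomorphic_vars_iff)
qed

lemma holomorphic_vars_const: "holomorphic_vars I S (\<lambda>_. c)"
  by (simp add: holomorphic_vars_iff holomorphic_at_const)

lemma holomorphic_vars_var: "finite I \<Longrightarrow> i \<in> I \<Longrightarrow> holomorphic_vars I S (\<lambda>w. w i)"
  by (simp add: holomorphic_vars_iff holomorphic_at_var)

lemma holomorphic_vars_mult:
  "finite I \<Longrightarrow> holomorphic_vars I S F \<Longrightarrow> holomorphic_vars I S G
    \<Longrightarrow> holomorphic_vars I S (\<lambda>w. F w * G w)"
  by (simp add: holomorphic_vars_iff holomorphic_at_mult)

lemma holomorphic_vars_inverse:
  assumes "finite I" "holomorphic_vars I S F" "\<And>w. w \<in> S \<Longrightarrow> F w \<noteq> 0"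
  shows "holomorphic_vars I S (\<lambda>w. inverse (F w))"
  using assms by (intro holomorphic_vars_compose_field[of I S F inverse])
    (auto intro!: field_differentiable_inverse field_differentiable_ident)

lemma holomorphic_vars_powi:
  assumes "finite I" "holomorphic_vars I S F" "\<And>w. w \<in> S \<Longrightarrow> F w \<noteq> 0"
  shows "holomorphic_vars I S (\<lambda>w. F w powi k)"
proof (rule holomorphic_vars_compose_field[OF assms(2,1)])
  fix w assume "w \<in> S"
  then have "((\<lambda>u. u powi k) has_field_derivative (of_int k * F w powi (k - 1) * 1)) (at (F w))"
    using assms(3) by (intro DERIV_power_int DERIV_ident) auto
  then show "(\<lambda>u. u powi k) field_differentiable at (F w)"
    unfolding field_differentiable_def by blast
qed

lemma holomorphic_vars_exp:
  "finite I \<Longrightarrow> holomorphic_vars I S F \<Longrightarrow> holomorphic_vars I S (\<lambda>w. exp (F w))"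
  by (rule holomorphic_vars_compose_field[of I S F exp]) (auto simp: field_differentiable_within_exp)

lemma holomorphic_vars_prod:
  assumes "finite I" "\<And>k. k \<in> A \<Longrightarrow> holomorphic_vars I S (F k)"
  shows "holomorphic_vars I S (\<lambda>w. \<Prod>k\<in>A. F k w)"
  using assms(2)
  by (induction A rule: infinite_finite_induct)
     (auto intro!: holomorphic_vars_mult holomorphic_vars_const assms(1))

section \<open>Tensor products\<close>

lemma hom_finprod:
  assumes "comm_group G" "comm_group H" "h \<in> hom G H" "f \<in> A \<rightarrow> carrier G"
  shows "h (finprod G f A) = finprod H (\<lambda>a. h (f a)) A"
proof -
  interpret G: comm_group G by fact
  interpret H: comm_group H by fact
  interpret group_hom G H h
    using assms(3) by (simp add: group_hom_def group_hom_axioms_def)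
  from assms(4) show ?thesis
    by (induction A rule: infinite_finite_induct) (auto simp: Pi_iff)
qed

locale tensor_pair = L: comm_group L + A: comm_group A
  for L :: "'l monoid" and A :: "'a monoid"
begin

abbreviation "FA \<equiv> free_Abelian_group (carrier L \<times> carrier A)"

abbreviation pure (infixl "\<odot>" 75) where "m \<odot> a \<equiv> pure_tensor L A m a"

lemma tensor_relationsE:
  assumes "c \<in> tensor_relations L A"
  obtains (left) m n a where "m \<in> carrier L" "n \<in> carrier L" "a \<in> carrier A"
      "c = frag_of (m \<otimes>\<^bsub>L\<^esub> n, a) - frag_of (m, a) - frag_of (n, a)"
    | (right) m a b where "m \<in> carrier L" "a \<in> carrier A" "b \<in> carrier A"
      "c = frag_of (m, a \<otimes>\<^bsub>A\<^esub> b) - frag_of (m, a) - frag_of (m, b)"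
  using assms unfolding tensor_relations_def by blast

lemma frag_diff_closed:
  assumes "x \<in> S" "y \<in> S" "z \<in> S"
  shows "Poly_Mapping.keys (frag_of x - frag_of y - frag_of z) \<subseteq> S"
  using assms keys_diff[of "frag_of x - frag_of y" "frag_of z"] keys_diff[of "frag_of x" "frag_of y"]
  by auto

lemma tensor_relations_closed: "tensor_relations L A \<subseteq> carrier FA"
proof
  fix c assume "c \<in> tensor_relations L A"
  then show "c \<in> carrier FA"
    by (cases rule: tensor_relationsE) (simp_all add: frag_diff_closed)
qed

lemma subgroup_tensor_kernel: "subgroup (tensor_kernel L A) FA"
  unfolding tensor_kernel_def
  by (rule group.generate_is_subgroup) (auto simp: tensor_relations_closed simp del: carrier_free_Abelian_group_iff)

lemma normal_tensor_kernel: "tensor_kernel L A \<lhd> FA"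
  by (simp add: comm_group.normal_iff_subgroup abelian_free_Abelian_group subgroup_tensor_kernel)

lemma comm_group_tensor: "comm_group (tensor L A)"
  unfolding tensor_def
  by (rule comm_group.abelian_FactGroup[OF abelian_free_Abelian_group subgroup_tensor_kernel])

sublocale T: comm_group "tensor L A"
  by (rule comm_group_tensor)

lemma hom_coset: "(\<lambda>c. tensor_kernel L A #>\<^bsub>FA\<^esub> c) \<in> hom FA (tensor L A)"
  unfolding tensor_def by (rule normal.r_coset_hom_Mod[OF normal_tensor_kernel])

lemma coset_eq:
  assumes "c \<in> carrier FA" "d \<in> carrier FA" "c - d \<in> tensor_kernel L A"
  shows "tensor_kernel L A #>\<^bsub>FA\<^esub> c = tensor_kernel L A #>\<^bsub>FA\<^esub> d"
proof -
  have "c \<in> tensor_kernel L A #>\<^bsub>FA\<^esub> d"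
    using assms
    by (intro subgroup.rcos_module_rev[OF subgroup_tensor_kernel]) (auto simp: algebra_simps)
  then show ?thesis
    using group.repr_independence[OF group_free_Abelian_group _ assms(2) subgroup_tensor_kernel]
    by blast
qed

lemma pure_closed [simp, intro]:
  "m \<in> carrier L \<Longrightarrow> a \<in> carrier A \<Longrightarrow> m \<odot> a \<in> carrier (tensor L A)"
  unfolding pure_tensor_def by (rule hom_in_carrier[OF hom_coset]) auto

lemma coset_add:
  assumes "c \<in> carrier FA" "d \<in> carrier FA"
  shows "tensor_kernel L A #>\<^bsub>FA\<^esub> (c + d) =
    (tensor_kernel L A #>\<^bsub>FA\<^esub> c) \<otimes>\<^bsub>tensor L A\<^esub> (tensor_kernel L A #>\<^bsub>FA\<^esub> d)"
  using hom_mult[OF hom_coset assms] by simp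

lemma keys_frag_add:
  assumes "p \<in> S" "q \<in> S"
  shows "Poly_Mapping.keys (frag_of p + frag_of q) \<subseteq> S"
  using assms keys_add[of "frag_of p" "frag_of q"] by auto

lemma pure_mult_left:
  assumes "m \<in> carrier L" "n \<in> carrier L" "a \<in> carrier A"
  shows "(m \<otimes>\<^bsub>L\<^esub> n) \<odot> a = (m \<odot> a) \<otimes>\<^bsub>tensor L A\<^esub> (n \<odot> a)"
proof -
  have "frag_of (m \<otimes>\<^bsub>L\<^esub> n, a) - (frag_of (m, a) + frag_of (n, a)) \<in> tensor_kernel L A"
    unfolding tensor_kernel_def tensor_relations_def diff_diff_eq
    by (rule generate.incl) (use assms in blast)
  then have "tensor_kernel L A #>\<^bsub>FA\<^esub> frag_of (m \<otimes>\<^bsub>L\<^esub> n, a) =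
    tensor_kernel L A #>\<^bsub>FA\<^esub> (frag_of (m, a) + frag_of (n, a))"
    using assms by (intro coset_eq) (simp_all add: keys_frag_add)
  then show ?thesis
    using assms by (simp add: pure_tensor_def coset_add)
qed

lemma pure_mult_right:
  assumes "m \<in> carrier L" "a \<in> carrier A" "b \<in> carrier A"
  shows "m \<odot> (a \<otimes>\<^bsub>A\<^esub> b) = (m \<odot> a) \<otimes>\<^bsub>tensor L A\<^esub> (m \<odot> b)"
proof -
  have "frag_of (m, a \<otimes>\<^bsub>A\<^esub> b) - (frag_of (m, a) + frag_of (m, b)) \<in> tensor_kernel L A"
    unfolding tensor_kernel_def tensor_relations_def diff_diff_eq
    by (rule generate.incl) (use assms in blast)
  then have "tensor_kernel L A #>\<^bsub>FA\<^esub> frag_of (m, a \<otimes>\<^bsub>A\<^esub> b) =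
    tensor_kernel L A #>\<^bsub>FA\<^esub> (frag_of (m, a) + frag_of (m, b))"
    using assms by (intro coset_eq) (simp_all add: keys_frag_add)
  then show ?thesis
    using assms by (simp add: pure_tensor_def coset_add)
qed

lemma hom_pure_left: "a \<in> carrier A \<Longrightarrow> (\<lambda>m. m \<odot> a) \<in> hom L (tensor L A)"
  by (auto intro!: homI simp: pure_mult_left)

lemma hom_pure_right: "m \<in> carrier L \<Longrightarrow> (\<lambda>a. m \<odot> a) \<in> hom A (tensor L A)"
  by (auto intro!: homI simp: pure_mult_right)

text \<open>An element is the coset of a formal integer combination, and these are generated from
  single symbols by differences. One quotient case therefore covers products and inverses
  together.\<close>

lemma tensor_induct [consumes 1, case_names one pure div]:
  assumes "t \<in> carrier (tensor L A)"
    and one: "P \<one>\<^bsub>tensor L A\<^esub>"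
    and pure: "\<And>m a. m \<in> carrier L \<Longrightarrow> a \<in> carrier A \<Longrightarrow> P (m \<odot> a)"
    and div: "\<And>s t. s \<in> carrier (tensor L A) \<Longrightarrow> t \<in> carrier (tensor L A) \<Longrightarrow> P s \<Longrightarrow> P t
      \<Longrightarrow> P (s \<otimes>\<^bsub>tensor L A\<^esub> inv\<^bsub>tensor L A\<^esub> t)"
  shows "P t"
proof -
  interpret c: group_hom FA "tensor L A" "\<lambda>c. tensor_kernel L A #>\<^bsub>FA\<^esub> c"
    by (simp add: group_hom_def group_hom_axioms_def hom_coset T.is_group)
  obtain c where c: "c \<in> carrier FA" "t = tensor_kernel L A #>\<^bsub>FA\<^esub> c"
    using assms(1) by (auto simp: tensor_def carrier_FactGroup)
  have "Poly_Mapping.keys c \<subseteq> carrier L \<times> carrier A"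
    using c(1) by simp
  then have "P (tensor_kernel L A #>\<^bsub>FA\<^esub> c)"
  proof (induction c rule: free_Abelian_group_induct[consumes 1, case_names zero diff frag])
    case zero
    show ?case using one c.hom_one by simp
  next
    case (diff x y)
    have "tensor_kernel L A #>\<^bsub>FA\<^esub> (x - y) =
      (tensor_kernel L A #>\<^bsub>FA\<^esub> x) \<otimes>\<^bsub>tensor L A\<^esub> inv\<^bsub>tensor L A\<^esub> (tensor_kernel L A #>\<^bsub>FA\<^esub> y)"
      using diff(1,2) c.hom_mult[of x "- y"] c.hom_inv[of y] by simp
    with diff div show ?case by simp
  next
    case (frag p)
    then show ?case using pure by (auto simp: pure_tensor_def)
  qed
  with c(2) show ?thesis by simp
qed

lemma hom_tensor_eqI:
  assumes "group G" "f \<in> hom (tensor L A) G" "g \<in> hom (tensor L A) G"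
    and "\<And>m a. m \<in> carrier L \<Longrightarrow> a \<in> carrier A \<Longrightarrow> f (m \<odot> a) = g (m \<odot> a)"
    and "t \<in> carrier (tensor L A)"
  shows "f t = g t"
proof -
  interpret f: group_hom "tensor L A" G f
    using assms by (simp add: group_hom_def group_hom_axioms_def T.is_group)
  interpret g: group_hom "tensor L A" G g
    using assms by (simp add: group_hom_def group_hom_axioms_def T.is_group)
  from assms(5) show ?thesis
    by (induction t rule: tensor_induct) (auto simp: assms(4))
qed

text \<open>The homomorphism on the free group kills both families of relations, hence the subgroup
  they generate, and factors through the quotient. Restricting the factor to the carrier makes it
  extensional, which together with agreement on pure tensors gives the uniqueness that the
  description operator requires.\<close>

lemma tensor_lift:
  assumes "comm_group G"
    and cl: "\<And>m a. m \<in> carrier L \<Longrightarrow> a \<in> carrier A \<Longrightarrow> \<beta> m a \<in> carrier G"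
    and left: "\<And>m n a. m \<in> carrier L \<Longrightarrow> n \<in> carrier L \<Longrightarrow> a \<in> carrier A
      \<Longrightarrow> \<beta> (m \<otimes>\<^bsub>L\<^esub> n) a = \<beta> m a \<otimes>\<^bsub>G\<^esub> \<beta> n a"
    and right: "\<And>m a b. m \<in> carrier L \<Longrightarrow> a \<in> carrier A \<Longrightarrow> b \<in> carrier A
      \<Longrightarrow> \<beta> m (a \<otimes>\<^bsub>A\<^esub> b) = \<beta> m a \<otimes>\<^bsub>G\<^esub> \<beta> m b"
  shows hom_tensor_lift: "tensor_lift L A G \<beta> \<in> hom (tensor L A) G" (is ?hom)
    and tensor_lift_pure: "\<And>m a. m \<in> carrier L \<Longrightarrow> a \<in> carrier A
      \<Longrightarrow> tensor_lift L A G \<beta> (m \<odot> a) = \<beta> m a" (is "\<And>m a. _ \<Longrightarrow> _ \<Longrightarrow> ?pure m a")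
proof -
  interpret G: comm_group G by fact
  have "case_prod \<beta> ` (carrier L \<times> carrier A) \<subseteq> carrier G"
    using cl by auto
  from G.free_Abelian_group_universal[OF this] obtain h where h: "h \<in> hom FA G"
    "\<And>x. x \<in> carrier L \<times> carrier A \<Longrightarrow> h (frag_of x) = case_prod \<beta> x"
    by metis
  interpret h: group_hom FA G h
    using h(1) by (simp add: group_hom_def group_hom_axioms_def)
  have hdiff: "h (x - y) = h x \<otimes>\<^bsub>G\<^esub> inv\<^bsub>G\<^esub> h y"
    if "x \<in> carrier FA" "y \<in> carrier FA" for x y
    using that h.hom_mult[of x "- y"] h.hom_inv[of y] by simp
  have "tensor_relations L A \<subseteq> kernel FA G h"
  proof
    fix c assume c: "c \<in> tensor_relations L A"
    obtain x y z where xyz: "x \<in> carrier L \<times> carrier A" "y \<in> carrier L \<times> carrier A"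
      "z \<in> carrier L \<times> carrier A" "c = frag_of x - frag_of y - frag_of z"
      "case_prod \<beta> x = case_prod \<beta> y \<otimes>\<^bsub>G\<^esub> case_prod \<beta> z"
      using c
    proof (cases rule: tensor_relationsE)
      case (left m n a)
      with assms(3) show thesis
        by (intro that[of "(m \<otimes>\<^bsub>L\<^esub> n, a)" "(m, a)" "(n, a)"]) auto
    next
      case (right m a b)
      with assms(4) show thesis
        by (intro that[of "(m, a \<otimes>\<^bsub>A\<^esub> b)" "(m, a)" "(m, b)"]) auto
    qed
    have cl': "case_prod \<beta> y \<in> carrier G" "case_prod \<beta> z \<in> carrier G"
      using xyz cl by auto
    have "h c = case_prod \<beta> x \<otimes>\<^bsub>G\<^esub> inv\<^bsub>G\<^esub> (case_prod \<beta> y) \<otimes>\<^bsub>G\<^esub> inv\<^bsub>G\<^esub> (case_prod \<beta> z)"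
      unfolding xyz(4) using xyz(1-3) keys_diff[of "frag_of x" "frag_of y"]
      by (subst hdiff, force, force, subst hdiff) (auto simp: h(2))
    also have "\<dots> = \<one>\<^bsub>G\<^esub>"
      unfolding xyz(5) using cl'
      by (metis G.inv_closed G.inv_solve_right' G.m_assoc G.m_closed G.m_comm G.r_inv)
    finally show "c \<in> kernel FA G h"
      using subsetD[OF tensor_relations_closed c] by (simp add: kernel_def)
  qed
  then have "tensor_kernel L A \<subseteq> kernel FA G h"
    unfolding tensor_kernel_def
    by (rule group.generate_subgroup_incl[OF group_free_Abelian_group _ h.subgroup_kernel])
  from h.FactGroup_universal_kernel[OF normal_tensor_kernel this]
  obtain g where g: "g \<in> hom (tensor L A) G"
    "\<And>c. c \<in> carrier FA \<Longrightarrow> g (tensor_kernel L A #>\<^bsub>FA\<^esub> c) = h c"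
    unfolding tensor_def by metis
  define f where "f = restrict g (carrier (tensor L A))"
  have f: "f \<in> hom (tensor L A) G \<and> f \<in> extensional (carrier (tensor L A)) \<and>
        (\<forall>m\<in>carrier L. \<forall>a\<in>carrier A. f (m \<odot> a) = \<beta> m a)"
  proof (intro conjI ballI)
    show "f \<in> hom (tensor L A) G"
      using g(1) by (auto simp: f_def hom_def Pi_iff)
    show "f (m \<odot> a) = \<beta> m a" if "m \<in> carrier L" "a \<in> carrier A" for m a
      using that g(2)[of "frag_of (m, a)"] h(2)[of "(m, a)"]
      by (simp add: f_def) (simp add: pure_tensor_def)
  qed (simp add: f_def)
  have "tensor_lift L A G \<beta> = f"
    unfolding tensor_lift_def
  proof (rule the_equality, rule f)
    fix f' assume f': "f' \<in> hom (tensor L A) G \<and> f' \<in> extensional (carrier (tensor L A)) \<and>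
        (\<forall>m\<in>carrier L. \<forall>a\<in>carrier A. f' (m \<odot> a) = \<beta> m a)"
    show "f' = f"
    proof (rule extensionalityI[of _ "carrier (tensor L A)"])
      show "f' t = f t" if "t \<in> carrier (tensor L A)" for t
      proof (rule hom_tensor_eqI[OF G.is_group _ _ _ that])
        show "f' (m \<odot> a) = f (m \<odot> a)" if "m \<in> carrier L" "a \<in> carrier A" for m a
          using f f' that by metis
      qed (simp_all only: f f')
    qed (simp_all only: f f')
  qed
  then show ?hom "\<And>m a. m \<in> carrier L \<Longrightarrow> a \<in> carrier A \<Longrightarrow> ?pure m a"
    using f by metis+
qed

end


section \<open>Coordinates on the tensor product of a lattice\<close>

definition lattice_coord :: "'l monoid \<Rightarrow> 'l set \<Rightarrow> 'l \<Rightarrow> 'l \<Rightarrow> int" where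
  "lattice_coord L B = the_inv_into (B \<rightarrow>\<^sub>E UNIV) (\<lambda>c. finprod L (\<lambda>b. b [^]\<^bsub>L\<^esub> (c b :: int)) B)"

locale based_lattice = comm_group L for L :: "'l monoid" (structure) +
  fixes B :: "'l set"
  assumes basis: "int_basis L B"
begin

abbreviation "\<kappa> \<equiv> lattice_coord L B"

lemma finite_basis: "finite B" and basis_closed: "b \<in> B \<Longrightarrow> b \<in> carrier L"
  using basis by (auto simp: int_basis_def)

lemma inj_basis: "inj_on (\<lambda>c. finprod L (\<lambda>b. b [^] (c b :: int)) B) (B \<rightarrow>\<^sub>E UNIV)"
  using basis by (auto simp: int_basis_def bij_betw_def)

lemma lattice_coord_in: "m \<in> carrier L \<Longrightarrow> \<kappa> m \<in> B \<rightarrow>\<^sub>E UNIV"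
  unfolding lattice_coord_def
  using basis by (intro the_inv_into_into[OF inj_basis]) (auto simp: int_basis_def bij_betw_def)

lemma finprod_lattice_coord: "m \<in> carrier L \<Longrightarrow> finprod L (\<lambda>b. b [^] \<kappa> m b) B = m"
  unfolding lattice_coord_def
  using basis by (intro f_the_inv_into_f[OF inj_basis]) (auto simp: int_basis_def bij_betw_def)

lemma lattice_coord_unique:
  assumes "m = finprod L (\<lambda>b. b [^] (c b :: int)) B" "b \<in> B"
  shows "\<kappa> m b = c b"
proof -
  \<comment> \<open>The inverse map is taken on extensional coefficient functions, so the values of
    \<open>c\<close> outside \<open>B\<close> are discarded first.\<close>
  have m: "m = finprod L (\<lambda>b. b [^] (restrict c B b :: int)) B"
    unfolding assms(1) using basis_closed by (intro finprod_cong') auto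
  have "\<kappa> m = restrict c B"
    unfolding lattice_coord_def m by (rule the_inv_into_f_f[OF inj_basis]) auto
  with assms(2) show ?thesis by simp
qed

lemma lattice_coord_mult:
  assumes "m \<in> carrier L" "n \<in> carrier L" "b \<in> B"
  shows "\<kappa> (m \<otimes> n) b = \<kappa> m b + \<kappa> n b"
proof (rule lattice_coord_unique[OF _ assms(3)])
  have "m \<otimes> n = finprod L (\<lambda>b. b [^] \<kappa> m b) B \<otimes> finprod L (\<lambda>b. b [^] \<kappa> n b) B"
    by (simp add: finprod_lattice_coord assms)
  also have "\<dots> = finprod L (\<lambda>b. b [^] \<kappa> m b \<otimes> b [^] \<kappa> n b) B"
    using basis_closed by (intro finprod_multf[symmetric]) auto
  also have "\<dots> = finprod L (\<lambda>b. b [^] (\<kappa> m b + \<kappa> n b)) B"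
    using basis_closed by (intro finprod_cong') (auto simp: int_pow_mult)
  finally show "m \<otimes> n = finprod L (\<lambda>b. b [^] (\<kappa> m b + \<kappa> n b)) B" .
qed

lemma lattice_coord_basis:
  assumes "b \<in> B" "c \<in> B"
  shows "\<kappa> b c = (if c = b then 1 else 0)"
proof (rule lattice_coord_unique[OF _ assms(2)])
  have "finprod L (\<lambda>c. c [^] (if c = b then 1 else 0 :: int)) B =
    finprod L (\<lambda>c. if b = c then c else \<one>) B"
    using basis_closed by (intro finprod_cong') auto
  also have "\<dots> = b"
    using finprod_singleton[OF assms(1) finite_basis, of "\<lambda>c. c"] basis_closed by auto
  finally show "b = finprod L (\<lambda>c. c [^] (if c = b then 1 else 0 :: int)) B" ..
qed

lemma lattice_eqI:
  assumes "m \<in> carrier L" "n \<in> carrier L" "\<And>b. b \<in> B \<Longrightarrow> \<kappa> m b = \<kappa> n b"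
  shows "m = n"
proof -
  have "\<kappa> m = \<kappa> n"
    using PiE_ext[OF lattice_coord_in[OF assms(1)] lattice_coord_in[OF assms(2)]] assms(3) by simp
  with finprod_lattice_coord[OF assms(1)] show ?thesis
    by (simp only: finprod_lattice_coord[OF assms(2)])
qed

lemma lattice_coord_surj:
  obtains m where "m \<in> carrier L" "\<And>b. b \<in> B \<Longrightarrow> \<kappa> m b = c b"
proof
  show "finprod L (\<lambda>b. b [^] c b) B \<in> carrier L"
    using basis_closed by (intro finprod_closed) auto
qed (rule lattice_coord_unique[OF refl])

lemma lattice_coord_one: "b \<in> B \<Longrightarrow> \<kappa> \<one> b = 0"
  using lattice_coord_mult[of \<one> \<one> b] by simp

end

locale lattice_tensor = based_lattice L B + tensor_pair L A
  for L :: "'l monoid" and B :: "'l set" and A :: "complex monoid"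
begin

abbreviation "ch \<equiv> chart L A B"

lemma chart_closed: "z \<in> B \<rightarrow> carrier A \<Longrightarrow> ch z \<in> carrier (tensor L A)"
  unfolding chart_def using basis_closed by (intro T.finprod_closed) auto

lemma chart_cong:
  assumes "z \<in> B \<rightarrow> carrier A" "\<And>b. b \<in> B \<Longrightarrow> z b = w b"
  shows "ch z = ch w"
  unfolding chart_def using assms basis_closed by (intro T.finprod_cong') (auto simp: Pi_iff)

lemma chart_mult:
  assumes "z \<in> B \<rightarrow> carrier A" "w \<in> B \<rightarrow> carrier A"
  shows "ch z \<otimes>\<^bsub>tensor L A\<^esub> ch w = ch (\<lambda>b. z b \<otimes>\<^bsub>A\<^esub> w b)"
proof -
  have "ch z \<otimes>\<^bsub>tensor L A\<^esub> ch w
    = finprod (tensor L A) (\<lambda>b. b \<odot> z b \<otimes>\<^bsub>tensor L A\<^esub> b \<odot> w b) B"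
    unfolding chart_def using assms basis_closed by (intro T.finprod_multf[symmetric]) auto
  also have "\<dots> = ch (\<lambda>b. z b \<otimes>\<^bsub>A\<^esub> w b)"
    unfolding chart_def using assms basis_closed
    by (intro T.finprod_cong') (auto simp: pure_mult_right Pi_iff)
  finally show ?thesis .
qed

text \<open>An integer exponent passes from the lattice factor to the scalar factor by bilinearity.
  This gives pure tensors, and so the image of the lattice and the points of order two, explicit
  coordinates.\<close>

lemma chart_pure:
  assumes "m \<in> carrier L" "a \<in> carrier A"
  shows "ch (\<lambda>b. a [^]\<^bsub>A\<^esub> \<kappa> m b) = m \<odot> a"
proof -
  have "m \<odot> a = finprod L (\<lambda>b. b [^]\<^bsub>L\<^esub> \<kappa> m b) B \<odot> a"
    by (simp add: finprod_lattice_coord assms)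
  also have "\<dots> = finprod (tensor L A) (\<lambda>b. (b [^]\<^bsub>L\<^esub> \<kappa> m b) \<odot> a) B"
    using basis_closed
    by (intro hom_finprod[OF comm_group_axioms T.comm_group_axioms hom_pure_left[OF assms(2)]]) auto
  also have "\<dots> = finprod (tensor L A) (\<lambda>b. b \<odot> (a [^]\<^bsub>A\<^esub> \<kappa> m b)) B"
  proof (intro T.finprod_cong')
    fix b assume "b \<in> B"
    then have b: "b \<in> carrier L" by (rule basis_closed)
    show "(b [^]\<^bsub>L\<^esub> \<kappa> m b) \<odot> a = b \<odot> (a [^]\<^bsub>A\<^esub> \<kappa> m b)"
      using hom_int_pow[OF hom_pure_left[OF assms(2)] b is_group T.is_group]
        hom_int_pow[OF hom_pure_right[OF b] assms(2) A.is_group T.is_group]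
      by simp
  qed (use assms basis_closed in auto)
  finally show ?thesis by (simp add: chart_def)
qed

lemma hom_chart:
  assumes "comm_group G" "f \<in> hom (tensor L A) G" "z \<in> B \<rightarrow> carrier A"
  shows "f (ch z) = finprod G (\<lambda>b. f (b \<odot> z b)) B"
  unfolding chart_def using assms(3) basis_closed
  by (intro hom_finprod[OF T.comm_group_axioms assms(1,2)]) auto

lemma chart_surj:
  assumes "t \<in> carrier (tensor L A)"
  obtains z where "z \<in> B \<rightarrow>\<^sub>E carrier A" "t = ch z"
proof -
  have "\<exists>z \<in> B \<rightarrow> carrier A. t = ch z"
    using assms
  proof (induction t rule: tensor_induct)
    case one
    \<comment> \<open>The chart value of the constant vector is idempotent, and in a group this
      identifies it as the unit.\<close>
    have "ch (\<lambda>b. \<one>\<^bsub>A\<^esub>) \<otimes>\<^bsub>tensor L A\<^esub> ch (\<lambda>b. \<one>\<^bsub>A\<^esub>) = ch (\<lambda>b. \<one>\<^bsub>A\<^esub>)"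
      by (subst chart_mult) auto
    then have "ch (\<lambda>b. \<one>\<^bsub>A\<^esub>) = \<one>\<^bsub>tensor L A\<^esub>"
      by (simp add: chart_closed)
    then show ?case by force
  next
    case (pure m a)
    then show ?case by (intro bexI[of _ "\<lambda>b. a [^]\<^bsub>A\<^esub> \<kappa> m b"]) (auto simp: chart_pure)
  next
    case (div s t)
    then obtain z w where zw: "z \<in> B \<rightarrow> carrier A" "w \<in> B \<rightarrow> carrier A" "s = ch z" "t = ch w"
      by blast
    let ?u = "\<lambda>b. z b \<otimes>\<^bsub>A\<^esub> inv\<^bsub>A\<^esub> w b"
    have "ch ?u \<otimes>\<^bsub>tensor L A\<^esub> t = s"
      unfolding zw(3,4) using zw(1,2)
      by (subst chart_mult) (auto intro!: chart_cong simp: A.m_assoc Pi_iff)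
    moreover have "ch ?u \<in> carrier (tensor L A)"
      using zw by (intro chart_closed) auto
    ultimately have "s \<otimes>\<^bsub>tensor L A\<^esub> inv\<^bsub>tensor L A\<^esub> t = ch ?u"
      using div(1,2) by (simp add: T.inv_solve_right')
    then show ?case using zw by (intro bexI[of _ ?u]) (auto simp: Pi_iff)
  qed
  then obtain z where "z \<in> B \<rightarrow> carrier A" "t = ch z" by blast
  then show thesis
    by (intro that[of "restrict z B"]) (auto intro!: chart_cong)
qed

text \<open>Raising to the power \<open>\<kappa> m b\<close> is bilinear, and the homomorphism it
  induces on the tensor product returns the coordinate at \<open>b\<close>: on basis elements the
  exponent is 1 at \<open>b\<close> and 0 elsewhere.\<close>

lemma chart_inj:
  assumes "z \<in> B \<rightarrow> carrier A" "w \<in> B \<rightarrow> carrier A" "ch z = ch w" "b \<in> B"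
  shows "z b = w b"
proof -
  let ?\<beta> = "\<lambda>m a. a [^]\<^bsub>A\<^esub> \<kappa> m b"
  note lift = tensor_lift[of A ?\<beta>, OF A.comm_group_axioms]
  have hom: "tensor_lift L A A ?\<beta> \<in> hom (tensor L A) A"
    using assms(4) by (intro lift) (auto simp: lattice_coord_mult A.int_pow_mult A.int_pow_distrib)
  have pure: "tensor_lift L A A ?\<beta> (m \<odot> a) = ?\<beta> m a" if "m \<in> carrier L" "a \<in> carrier A" for m a
    using assms(4) that
    by (intro lift) (auto simp: lattice_coord_mult A.int_pow_mult A.int_pow_distrib)
  have "tensor_lift L A A ?\<beta> (ch z) = z b" if z: "z \<in> B \<rightarrow> carrier A" for z
  proof -
    have "tensor_lift L A A ?\<beta> (ch z) = finprod A (\<lambda>c. if b = c then z c else \<one>\<^bsub>A\<^esub>) B"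
      unfolding hom_chart[OF A.comm_group_axioms hom z]
      using z basis_closed assms(4)
      by (intro A.finprod_cong') (auto simp: pure lattice_coord_basis Pi_iff)
    also have "\<dots> = z b"
      using A.finprod_singleton[OF assms(4) finite_basis z] .
    finally show ?thesis .
  qed
  from this[OF assms(1)] this[OF assms(2)] assms(3) show ?thesis by simp
qed

lemma coords_chart:
  assumes "z \<in> B \<rightarrow> carrier A" "b \<in> B"
  shows "coords L A B (ch z) b = z b"
proof -
  have "inj_on ch (B \<rightarrow>\<^sub>E carrier A)"
    by (intro inj_onI PiE_ext) (auto intro: chart_inj)
  then have "coords L A B (ch (restrict z B)) = restrict z B"
    unfolding coords_def using assms by (intro the_inv_into_f_f) auto
  moreover have "ch (restrict z B) = ch z"
    using assms by (intro chart_cong) auto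
  ultimately show ?thesis using assms by simp
qed

end

section \<open>The torus and its Lie algebra\<close>

lemma Cadd_simps [simp]:
  "carrier Cadd = UNIV" "a \<otimes>\<^bsub>Cadd\<^esub> b = a + b" "\<one>\<^bsub>Cadd\<^esub> = 0"
  by (auto simp: Cadd_def)

lemma Cmult_simps [simp]:
  "carrier Cmult = UNIV - {0}" "a \<otimes>\<^bsub>Cmult\<^esub> b = a * b" "\<one>\<^bsub>Cmult\<^esub> = 1"
  by (auto simp: Cmult_def)

lemma comm_group_Cadd: "comm_group Cadd"
  by (rule comm_groupI) (auto intro: exI[of _ "- _"] simp: add_ac left_minus)

lemma comm_group_Cmult: "comm_group Cmult"
proof (rule comm_groupI)
  fix x assume "x \<in> carrier Cmult"
  then show "\<exists>y\<in>carrier Cmult. y \<otimes>\<^bsub>Cmult\<^esub> x = \<one>\<^bsub>Cmult\<^esub>"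
    by (intro bexI[of _ "inverse x"]) auto
qed auto

interpretation Cadd: comm_group Cadd by (rule comm_group_Cadd)
interpretation Cmult: comm_group Cmult by (rule comm_group_Cmult)

lemma inv_Cadd [simp]: "inv\<^bsub>Cadd\<^esub> a = - a"
  by (rule Cadd.inv_equality) auto

lemma inv_Cmult [simp]: "a \<noteq> 0 \<Longrightarrow> inv\<^bsub>Cmult\<^esub> a = inverse a"
  by (rule Cmult.inv_equality) auto

lemma int_pow_Cadd [simp]: "a [^]\<^bsub>Cadd\<^esub> (k :: int) = of_int k * a"
proof -
  have "a [^]\<^bsub>Cadd\<^esub> (n :: nat) = of_nat n * a" for n
    by (induction n) (auto simp: algebra_simps)
  then show ?thesis by (simp add: int_pow_def2)
qed

lemma int_pow_Cmult [simp]: "a \<noteq> 0 \<Longrightarrow> a [^]\<^bsub>Cmult\<^esub> (k :: int) = a powi k"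
proof -
  assume a: "a \<noteq> 0"
  have "a [^]\<^bsub>Cmult\<^esub> (n :: nat) = a ^ n" for n
    by (induction n) (auto simp: mult_ac)
  then show ?thesis using a by (simp add: int_pow_def2 power_int_def power_inverse)
qed

lemma finprod_Cadd [simp]: "finprod Cadd f A = sum f A"
  by (induction A rule: infinite_finite_induct) auto

lemma finprod_Cmult [simp]: "(\<And>a. a \<in> A \<Longrightarrow> f a \<noteq> 0) \<Longrightarrow> finprod Cmult f A = prod f A"
  by (induction A rule: infinite_finite_induct) auto

locale lattice_torus = based_lattice L B for L :: "'l monoid" (structure) and B
begin

sublocale h: lattice_tensor L B Cadd
  by (intro lattice_tensor.intro tensor_pair.intro based_lattice_axioms comm_group_axioms comm_group_Cadd)

sublocale t: lattice_tensor L B Cmult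
  by (intro lattice_tensor.intro tensor_pair.intro based_lattice_axioms comm_group_axioms comm_group_Cmult)

sublocale H: comm_group "hh L"
  unfolding hh_def by (rule h.comm_group_tensor)

sublocale T: comm_group "TC L"
  unfolding TC_def by (rule t.comm_group_tensor)

abbreviation "H \<equiv> hh L"
abbreviation "T \<equiv> TC L"
abbreviation "chH \<equiv> chart L Cadd B"
abbreviation "chT \<equiv> chart L Cmult B"

lemma chH_closed [simp]: "chH x \<in> carrier H"
  using h.chart_closed[folded hh_def] by auto

lemma chT_closed: "(\<And>b. b \<in> B \<Longrightarrow> z b \<noteq> 0) \<Longrightarrow> chT z \<in> carrier T"
  using t.chart_closed[folded TC_def] by auto

lemma chH_cong: "(\<And>b. b \<in> B \<Longrightarrow> x b = y b) \<Longrightarrow> chH x = chH y"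
  by (rule h.chart_cong) auto

lemma chT_cong: "(\<And>b. b \<in> B \<Longrightarrow> z b \<noteq> 0) \<Longrightarrow> (\<And>b. b \<in> B \<Longrightarrow> z b = w b) \<Longrightarrow> chT z = chT w"
  by (rule t.chart_cong) auto

lemma chH_mult: "chH x \<otimes>\<^bsub>H\<^esub> chH y = chH (\<lambda>b. x b + y b)"
  using h.chart_mult[folded hh_def, of x y] by simp

lemma chT_mult:
  "(\<And>b. b \<in> B \<Longrightarrow> z b \<noteq> 0) \<Longrightarrow> (\<And>b. b \<in> B \<Longrightarrow> w b \<noteq> 0) \<Longrightarrow>
    chT z \<otimes>\<^bsub>T\<^esub> chT w = chT (\<lambda>b. z b * w b)"
  using t.chart_mult[folded TC_def, of z w] by auto

lemma chH_surj:
  assumes "x \<in> carrier H" obtains z where "z \<in> B \<rightarrow>\<^sub>E UNIV" "x = chH z"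
  using h.chart_surj[folded hh_def, OF assms] by auto

lemma chT_surj:
  assumes "t \<in> carrier T" obtains z where "z \<in> B \<rightarrow>\<^sub>E UNIV - {0}" "t = chT z"
  using t.chart_surj[folded TC_def, OF assms] by auto

lemma chT_inj:
  assumes "\<And>b. b \<in> B \<Longrightarrow> z b \<noteq> 0" "\<And>b. b \<in> B \<Longrightarrow> w b \<noteq> 0" "chT z = chT w" "b \<in> B"
  shows "z b = w b"
  using t.chart_inj[of z w b] assms by auto

lemma coords_chT:
  "(\<And>b. b \<in> B \<Longrightarrow> z b \<noteq> 0) \<Longrightarrow> b \<in> B \<Longrightarrow> coords L Cmult B (chT z) b = z b"
  by (rule t.coords_chart) auto

lemma chT_one: "chT (\<lambda>b. 1) = \<one>\<^bsub>T\<^esub>"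
  using chT_mult[of "\<lambda>_. 1" "\<lambda>_. 1"] chT_closed[of "\<lambda>_. 1"] by simp

lemma chT_inv: "(\<And>b. b \<in> B \<Longrightarrow> z b \<noteq> 0) \<Longrightarrow> inv\<^bsub>T\<^esub> chT z = chT (\<lambda>b. inverse (z b))"
  by (rule T.inv_equality)
     (auto simp: chT_mult chT_closed chT_one[symmetric] intro!: chT_cong)

lemma chT_pow:
  assumes "\<And>b. b \<in> B \<Longrightarrow> z b \<noteq> 0" "\<epsilon> \<in> {1, -1 :: int}"
  shows "chT z [^]\<^bsub>T\<^esub> \<epsilon> = chT (\<lambda>b. z b powi \<epsilon>)"
  using assms by (auto simp: chT_closed T.int_pow_neg chT_inv power_int_minus)

lemma pure_H: "m \<in> carrier L \<Longrightarrow> pure_tensor L Cadd m c = chH (\<lambda>b. of_int (\<kappa> m b) * c)"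
  using h.chart_pure[of m c] by simp

lemma pure_T: "m \<in> carrier L \<Longrightarrow> c \<noteq> 0 \<Longrightarrow> pure_tensor L Cmult m c = chT (\<lambda>b. c powi \<kappa> m b)"
  using t.chart_pure[of m c] by simp

lemma pure_H_closed [simp]: "m \<in> carrier L \<Longrightarrow> pure_tensor L Cadd m c \<in> carrier H"
  by (simp add: pure_H)

lemma pure_T_closed [simp]: "m \<in> carrier L \<Longrightarrow> c \<noteq> 0 \<Longrightarrow> pure_tensor L Cmult m c \<in> carrier T"
  by (simp add: pure_T chT_closed)

text \<open>The prescription on pure tensors is bilinear, since \<open>exp\<close> turns sums of
  scalars into products; this gives the description operator in \<open>exp_T\<close> its
  meaning.\<close>

lemma hom_exp_T: "exp_T L \<in> hom H T"
  and exp_T_pure: "\<And>m c. m \<in> carrier L \<Longrightarrow>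
    exp_T L (pure_tensor L Cadd m c) = pure_tensor L Cmult m (exp (2 * of_real pi * \<i> * c))"
proof -
  let ?\<beta> = "\<lambda>m c. pure_tensor L Cmult m (exp (2 * of_real pi * \<i> * c))"
  have 1: "?\<beta> m c \<in> carrier T" if "m \<in> carrier L" for m c
    using that by simp
  have 2: "?\<beta> (m \<otimes>\<^bsub>L\<^esub> n) c = ?\<beta> m c \<otimes>\<^bsub>T\<^esub> ?\<beta> n c" if "m \<in> carrier L" "n \<in> carrier L" for m n c
    unfolding TC_def using that by (intro t.pure_mult_left) auto
  have 3: "?\<beta> m (c + d) = ?\<beta> m c \<otimes>\<^bsub>T\<^esub> ?\<beta> m d" if "m \<in> carrier L" for m c d
    unfolding TC_def using that by (subst t.pure_mult_right[symmetric]) (auto simp: ring_distribs exp_add)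
  note lift = h.tensor_lift[of T ?\<beta>, OF T.comm_group_axioms]
  show "exp_T L \<in> hom H T"
    unfolding exp_T_def hh_def by (rule lift) (simp_all add: 1 2 3)
  show "exp_T L (pure_tensor L Cadd m c) = ?\<beta> m c" if "m \<in> carrier L" for m c
    unfolding exp_T_def by (rule lift) (simp_all add: 1 2 3 that)
qed

sublocale exp: group_hom H T "exp_T L"
  by (simp add: group_hom_def group_hom_axioms_def hom_exp_T H.is_group T.is_group)

lemma exp_T_chart: "exp_T L (chH x) = chT (\<lambda>b. exp (2 * of_real pi * \<i> * x b))"
proof -
  have "exp_T L (chH x) = finprod T (\<lambda>b. exp_T L (pure_tensor L Cadd b (x b))) B"
    using h.hom_chart[folded hh_def, OF T.comm_group_axioms hom_exp_T, of x] by simp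
  also have "\<dots> = finprod T (\<lambda>b. pure_tensor L Cmult b (exp (2 * of_real pi * \<i> * x b))) B"
    using basis_closed by (intro T.finprod_cong') (auto simp: exp_T_pure)
  finally show ?thesis by (simp add: chart_def TC_def)
qed

section \<open>Linear forms and characters attached to the dual lattice\<close>

context
  fixes \<mu> :: "'l \<Rightarrow> int"
  assumes \<mu>: "\<mu> \<in> hom L integer_group"
begin

lemma dual_mult: "m \<in> carrier L \<Longrightarrow> n \<in> carrier L \<Longrightarrow> \<mu> (m \<otimes> n) = \<mu> m + \<mu> n"
  using hom_mult[OF \<mu>] by simp

lemma hom_extend_h: "extend_h L \<mu> \<in> hom H Cadd"
  and extend_h_pure: "\<And>m c. m \<in> carrier L \<Longrightarrow>
    extend_h L \<mu> (pure_tensor L Cadd m c) = of_int (\<mu> m) * c"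
proof -
  note lift = h.tensor_lift[of Cadd "\<lambda>n c. of_int (\<mu> n) * c", OF comm_group_Cadd]
  show "extend_h L \<mu> \<in> hom H Cadd"
    unfolding extend_h_def hh_def by (rule lift) (simp_all add: dual_mult ring_distribs)
  show "extend_h L \<mu> (pure_tensor L Cadd m c) = of_int (\<mu> m) * c" if "m \<in> carrier L" for m c
    unfolding extend_h_def by (rule lift) (simp_all add: dual_mult ring_distribs that)
qed

lemma hom_character: "character L \<mu> \<in> hom T Cmult"
  and character_pure: "\<And>m c. m \<in> carrier L \<Longrightarrow> c \<noteq> 0 \<Longrightarrow>
    character L \<mu> (pure_tensor L Cmult m c) = c powi \<mu> m"
proof -
  note lift = t.tensor_lift[of Cmult "\<lambda>n z. z powi \<mu> n", OF comm_group_Cmult]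
  show "character L \<mu> \<in> hom T Cmult"
    unfolding character_def TC_def
    by (rule lift) (simp_all add: dual_mult power_int_add power_int_mult_distrib)
  show "character L \<mu> (pure_tensor L Cmult m c) = c powi \<mu> m" if "m \<in> carrier L" "c \<noteq> 0" for m c
    unfolding character_def
    by (rule lift) (simp_all add: dual_mult power_int_add power_int_mult_distrib that)
qed

lemma extend_h_chart: "extend_h L \<mu> (chH x) = (\<Sum>b\<in>B. of_int (\<mu> b) * x b)"
  using h.hom_chart[folded hh_def, OF comm_group_Cadd hom_extend_h, of x] basis_closed
  by (simp add: extend_h_pure)

lemma character_chart:
  assumes "\<And>b. b \<in> B \<Longrightarrow> z b \<noteq> 0"
  shows "character L \<mu> (chT z) = (\<Prod>b\<in>B. z b powi \<mu> b)"
  using t.hom_chart[folded TC_def, OF comm_group_Cmult hom_character, of z] assms basis_closed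
  by (auto simp: character_pure Pi_iff)

lemma extend_h_mult: "x \<in> carrier H \<Longrightarrow> y \<in> carrier H \<Longrightarrow>
    extend_h L \<mu> (x \<otimes>\<^bsub>H\<^esub> y) = extend_h L \<mu> x + extend_h L \<mu> y"
  using hom_mult[OF hom_extend_h] by simp

lemma extend_h_inv: "x \<in> carrier H \<Longrightarrow> extend_h L \<mu> (inv\<^bsub>H\<^esub> x) = - extend_h L \<mu> x"
  using group_hom.hom_inv[of H Cadd "extend_h L \<mu>" x] hom_extend_h
  by (simp add: group_hom_def group_hom_axioms_def H.is_group Cadd.is_group)

lemma character_nonzero: "t \<in> carrier T \<Longrightarrow> character L \<mu> t \<noteq> 0"
  using hom_in_carrier[OF hom_character] by auto

lemma character_mult: "s \<in> carrier T \<Longrightarrow> t \<in> carrier T \<Longrightarrow>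
    character L \<mu> (s \<otimes>\<^bsub>T\<^esub> t) = character L \<mu> s * character L \<mu> t"
  using hom_mult[OF hom_character] by simp

lemma character_inv: "t \<in> carrier T \<Longrightarrow> character L \<mu> (inv\<^bsub>T\<^esub> t) = inverse (character L \<mu> t)"
  using group_hom.hom_inv[of T Cmult "character L \<mu>" t] hom_character character_nonzero
  by (simp add: group_hom_def group_hom_axioms_def T.is_group Cmult.is_group)

lemma character_exp_T:
  assumes "x \<in> carrier H"
  shows "character L \<mu> (exp_T L x) = exp (2 * of_real pi * \<i> * extend_h L \<mu> x)"
proof -
  obtain z where "x = chH z" using assms by (rule chH_surj)
  then show ?thesis
    by (simp add: exp_T_chart character_chart extend_h_chart exp_sum[OF finite_basis]
        sum_distrib_left exp_power_int mult_ac)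
qed

end

lemma extend_h_add:
  assumes "\<mu> \<in> hom L integer_group" "\<nu> \<in> hom L integer_group" "\<rho> \<in> hom L integer_group"
    and "\<And>m. m \<in> carrier L \<Longrightarrow> \<rho> m = \<mu> m + \<nu> m" "x \<in> carrier H"
  shows "extend_h L \<rho> x = extend_h L \<mu> x + extend_h L \<nu> x"
proof -
  obtain z where "x = chH z" using assms(5) by (rule chH_surj)
  then show ?thesis
    using assms basis_closed by (simp add: extend_h_chart ring_distribs sum.distrib)
qed

lemma character_add:
  assumes "\<mu> \<in> hom L integer_group" "\<nu> \<in> hom L integer_group" "\<rho> \<in> hom L integer_group"
    and "\<And>m. m \<in> carrier L \<Longrightarrow> \<rho> m = \<mu> m + \<nu> m" "t \<in> carrier T"
  shows "character L \<rho> t = character L \<mu> t * character L \<nu> t"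
proof -
  obtain z where "z \<in> B \<rightarrow>\<^sub>E UNIV - {0}" "t = chT z" using assms(5) by (rule chT_surj)
  moreover from this have "z b \<noteq> 0" if "b \<in> B" for b using that by auto
  ultimately show ?thesis
    using assms basis_closed by (simp add: character_chart power_int_add prod.distrib)
qed

section \<open>Image and kernel of the exponential map\<close>

lemma exp_T_surj:
  assumes "t \<in> carrier T"
  obtains x where "x \<in> carrier H" "t = exp_T L x"
proof -
  obtain z where z: "z \<in> B \<rightarrow>\<^sub>E UNIV - {0}" "t = chT z" using assms by (rule chT_surj)
  have "exp_T L (chH (\<lambda>b. Ln (z b) / (2 * of_real pi * \<i>))) = t"
    unfolding exp_T_chart z(2) using z(1) by (intro chT_cong) (auto simp: PiE_iff)
  then show thesis using that[OF chH_closed] by metis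
qed

lemma exp_T_lattice: "m \<in> carrier L \<Longrightarrow> exp_T L (pure_tensor L Cadd m 1) = \<one>\<^bsub>T\<^esub>"
  by (simp add: exp_T_pure exp_two_pi_i pure_T chT_one mult.commute)

text \<open>Exactness of the exponential sequence at \<open>hh L\<close>. In each coordinate the two
  logarithms differ by an integer, and a lattice element with these integers as coordinates is the
  required period.\<close>

lemma exp_T_eq:
  assumes "x \<in> carrier H" "y \<in> carrier H" "exp_T L x = exp_T L y"
  obtains m where "m \<in> carrier L" "x = y \<otimes>\<^bsub>H\<^esub> pure_tensor L Cadd m 1"
proof -
  obtain u where u: "x = chH u" using assms(1) by (rule chH_surj)
  obtain v where v: "y = chH v" using assms(2) by (rule chH_surj)
  have "\<exists>k::int. u b = v b + of_int k" if "b \<in> B" for b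
  proof -
    have "exp (2 * of_real pi * \<i> * u b) = exp (2 * of_real pi * \<i> * v b)"
      using chT_inj[OF _ _ assms(3)[unfolded u v exp_T_chart] that] by simp
    then obtain n :: int where "2 * of_real pi * \<i> * u b
        = 2 * of_real pi * \<i> * v b + of_real (of_int (2 * n) * pi) * \<i>"
      unfolding exp_eq by blast
    then have "2 * of_real pi * \<i> * u b = 2 * of_real pi * \<i> * (v b + of_int n)"
      by (simp add: ring_distribs)
    then show ?thesis by auto
  qed
  then obtain k :: "'l \<Rightarrow> int" where k: "\<And>b. b \<in> B \<Longrightarrow> u b = v b + of_int (k b)"
    by metis
  obtain m where m: "m \<in> carrier L" "\<And>b. b \<in> B \<Longrightarrow> \<kappa> m b = k b"
    using lattice_coord_surj[of k] by blast
  have "x = y \<otimes>\<^bsub>H\<^esub> pure_tensor L Cadd m 1"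
    unfolding u v pure_H[OF m(1)] chH_mult by (rule chH_cong) (simp add: m k)
  with m(1) show thesis by (rule that)
qed

section \<open>Points of order two on the torus\<close>

abbreviation two_torsion :: "'l \<Rightarrow> 'l ctensor" where
  "two_torsion n \<equiv> pure_tensor L Cmult n (-1)"

lemma two_torsion_mult:
  "m \<in> carrier L \<Longrightarrow> n \<in> carrier L \<Longrightarrow>
    two_torsion (m \<otimes> n) = two_torsion m \<otimes>\<^bsub>T\<^esub> two_torsion n"
  unfolding TC_def by (rule t.pure_mult_left) auto

lemma two_torsion_one: "two_torsion \<one> = \<one>\<^bsub>T\<^esub>"
proof -
  have "two_torsion \<one> \<otimes>\<^bsub>T\<^esub> two_torsion \<one> = two_torsion \<one>"
    using two_torsion_mult[of \<one> \<one>] by simp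
  then show ?thesis by simp
qed

text \<open>In coordinates this is the parity of the exponents of -1. The kernel found here is the
  image of doubling, hence of the lattice part of the boundary map of \<open>E\<close>.\<close>

lemma two_torsion_eq_one_iff:
  assumes "n \<in> carrier L"
  shows "two_torsion n = \<one>\<^bsub>T\<^esub> \<longleftrightarrow> (\<exists>m\<in>carrier L. n = m \<otimes> m)"
proof
  assume "two_torsion n = \<one>\<^bsub>T\<^esub>"
  then have "chT (\<lambda>b. (-1) powi \<kappa> n b) = chT (\<lambda>b. 1)"
    using assms by (simp add: pure_T chT_one)
  from chT_inj[OF _ _ this] have "(-1 :: complex) powi \<kappa> n b = 1" if "b \<in> B" for b
    using that by simp
  then have ev: "even (\<kappa> n b)" if "b \<in> B" for b
    using that[THEN \<open>\<And>b. b \<in> B \<Longrightarrow> (-1 :: complex) powi \<kappa> n b = 1\<close>]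
    by (simp add: power_int_minus_left split: if_splits)
  obtain m where m: "m \<in> carrier L" "\<And>b. b \<in> B \<Longrightarrow> \<kappa> m b = \<kappa> n b div 2"
    using lattice_coord_surj[of "\<lambda>b. \<kappa> n b div 2"] by blast
  have "n = m \<otimes> m"
    by (rule lattice_eqI) (use m assms ev in \<open>auto simp: lattice_coord_mult\<close>)
  with m(1) show "\<exists>m\<in>carrier L. n = m \<otimes> m" by blast
next
  assume "\<exists>m\<in>carrier L. n = m \<otimes> m"
  then obtain m where m: "m \<in> carrier L" "n = m \<otimes> m" by blast
  then have "two_torsion n = chT (\<lambda>b. 1)"
    unfolding m(2) by (subst pure_T) (auto intro!: chT_cong simp: lattice_coord_mult power_int_add power_int_mult_distrib[symmetric])
  then show "two_torsion n = \<one>\<^bsub>T\<^esub>" by (simp add: chT_one)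
qed

lemma two_torsion_square: "n \<in> carrier L \<Longrightarrow> two_torsion n \<otimes>\<^bsub>T\<^esub> two_torsion n = \<one>\<^bsub>T\<^esub>"
  using two_torsion_eq_one_iff[of "n \<otimes> n"] by (auto simp: two_torsion_mult[symmetric])

lemma two_torsion_exhaust:
  assumes "t \<in> carrier T" "t \<otimes>\<^bsub>T\<^esub> t = \<one>\<^bsub>T\<^esub>"
  obtains n where "n \<in> carrier L" "t = two_torsion n"
proof -
  obtain z where z: "z \<in> B \<rightarrow>\<^sub>E UNIV - {0}" "t = chT z" using assms(1) by (rule chT_surj)
  have nz: "z b \<noteq> 0" if "b \<in> B" for b using z(1) that by auto
  have "chT (\<lambda>b. z b * z b) = chT (\<lambda>b. 1)"
    using assms(2) unfolding z(2) by (simp add: chT_mult nz chT_one)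
  from chT_inj[OF _ _ this] have "z b * z b = 1" if "b \<in> B" for b
    using that nz by simp
  then have pm: "z b = 1 \<or> z b = -1" if "b \<in> B" for b
    using that by (simp add: square_eq_1_iff)
  obtain n where n: "n \<in> carrier L" "\<And>b. b \<in> B \<Longrightarrow> \<kappa> n b = (if z b = 1 then 0 else 1)"
    using lattice_coord_surj[of "\<lambda>b. if z b = 1 then 0 else 1"] by blast
  have "t = two_torsion n"
    unfolding z(2) pure_T[OF n(1), of "-1", simplified]
  proof (rule chT_cong[OF nz])
    show "z b = (-1) powi \<kappa> n b" if "b \<in> B" for b
      using pm[OF that] n(2)[OF that] by auto
  qed
  with n(1) show thesis by (rule that)
qed

text \<open>The lattice is torsion-free; this confines the kernel of the boundary map of
  \<open>E\<close> to the scalars.\<close>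

lemma square_eq_one:
  assumes "m \<in> carrier L" "m \<otimes> m = \<one>"
  shows "m = \<one>"
proof (rule lattice_eqI[OF assms(1)])
  fix b assume b: "b \<in> B"
  then have "\<kappa> m b + \<kappa> m b = 0"
    using lattice_coord_mult[OF assms(1,1) b] assms(2) lattice_coord_one[OF b] by simp
  then show "\<kappa> m b = \<kappa> \<one> b" using lattice_coord_one[OF b] by simp
qed auto

section \<open>Holomorphic functions on the torus and on its product with the Lie algebra\<close>

abbreviation "S\<^sub>T \<equiv> B \<rightarrow>\<^sub>E UNIV - {0 :: complex}"
abbreviation "S\<^sub>h\<^sub>T \<equiv> Pi\<^sub>E (B <+> B) (case_sum (\<lambda>_. UNIV) (\<lambda>_. UNIV - {0 :: complex}))"

lemma S_T_nonzero: "z \<in> S\<^sub>T \<Longrightarrow> b \<in> B \<Longrightarrow> z b \<noteq> 0"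
  by auto

lemma S_hT_nonzero: "w \<in> S\<^sub>h\<^sub>T \<Longrightarrow> b \<in> B \<Longrightarrow> w (Inr b) \<noteq> 0"
  by (drule PiE_mem[of _ _ _ "Inr b"]) auto

lemma finite_basis_Plus: "finite (B <+> B)"
  by (simp add: finite_basis)

lemma chT_S_T: "z \<in> S\<^sub>T \<Longrightarrow> chT z \<in> carrier T"
  by (rule chT_closed) auto

lemma chT_S_hT: "w \<in> S\<^sub>h\<^sub>T \<Longrightarrow> chT (w \<circ> Inr) \<in> carrier T"
  by (rule chT_closed) (simp add: S_hT_nonzero)

lemma holomorphic_fun_T_cong:
  assumes "holomorphic_fun_T L B f" "\<And>t. t \<in> carrier T \<Longrightarrow> f t = g t"
  shows "holomorphic_fun_T L B g"
  using assms(1) unfolding holomorphic_fun_T_def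
  by (rule holomorphic_vars_cong) (simp add: assms(2) chT_S_T)

lemma holomorphic_fun_hT_cong:
  assumes "holomorphic_fun_hT L B f"
    "\<And>x t. x \<in> carrier H \<Longrightarrow> t \<in> carrier T \<Longrightarrow> f x t = g x t"
  shows "holomorphic_fun_hT L B g"
  using assms(1) unfolding holomorphic_fun_hT_def
  by (rule holomorphic_vars_cong) (simp add: assms(2) chT_S_hT)

lemma holomorphic_fun_T_const: "holomorphic_fun_T L B (\<lambda>_. c)"
  unfolding holomorphic_fun_T_def by (rule holomorphic_vars_const)

lemma holomorphic_fun_T_mult:
  "holomorphic_fun_T L B f \<Longrightarrow> holomorphic_fun_T L B g \<Longrightarrow> holomorphic_fun_T L B (\<lambda>t. f t * g t)"
  unfolding holomorphic_fun_T_def by (rule holomorphic_vars_mult[OF finite_basis])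

lemma holomorphic_fun_T_inverse:
  "holomorphic_fun_T L B f \<Longrightarrow> (\<And>t. t \<in> carrier T \<Longrightarrow> f t \<noteq> 0) \<Longrightarrow>
    holomorphic_fun_T L B (\<lambda>t. inverse (f t))"
  unfolding holomorphic_fun_T_def by (rule holomorphic_vars_inverse[OF finite_basis]) (auto simp: chT_S_T)

lemma holomorphic_fun_T_character:
  assumes "\<mu> \<in> hom L integer_group"
  shows "holomorphic_fun_T L B (character L \<mu>)"
  unfolding holomorphic_fun_T_def
proof (rule holomorphic_vars_cong)
  show "holomorphic_vars B S\<^sub>T (\<lambda>z. \<Prod>b\<in>B. z b powi \<mu> b)"
    by (intro holomorphic_vars_prod holomorphic_vars_powi holomorphic_vars_var finite_basis) auto
  show "(\<Prod>b\<in>B. z b powi \<mu> b) = character L \<mu> (chT z)" if "z \<in> S\<^sub>T" for z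
    using S_T_nonzero[OF that] by (simp add: character_chart[OF assms])
qed

lemma holomorphic_fun_hT_const: "holomorphic_fun_hT L B (\<lambda>_ _. c)"
  unfolding holomorphic_fun_hT_def by (rule holomorphic_vars_const)

lemma holomorphic_fun_hT_mult:
  "holomorphic_fun_hT L B f \<Longrightarrow> holomorphic_fun_hT L B g \<Longrightarrow>
    holomorphic_fun_hT L B (\<lambda>x t. f x t * g x t)"
  unfolding holomorphic_fun_hT_def by (rule holomorphic_vars_mult[OF finite_basis_Plus])

lemma holomorphic_fun_hT_inverse:
  "holomorphic_fun_hT L B f \<Longrightarrow> (\<And>x t. x \<in> carrier H \<Longrightarrow> t \<in> carrier T \<Longrightarrow> f x t \<noteq> 0) \<Longrightarrow>
    holomorphic_fun_hT L B (\<lambda>x t. inverse (f x t))"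
  unfolding holomorphic_fun_hT_def
  by (rule holomorphic_vars_inverse[OF finite_basis_Plus]) (auto simp: chT_S_hT)

lemma holomorphic_fun_hT_exp:
  assumes "\<mu> \<in> hom L integer_group"
  shows "holomorphic_fun_hT L B (\<lambda>x t. exp (c * extend_h L \<mu> x))"
  unfolding holomorphic_fun_hT_def
proof (rule holomorphic_vars_cong)
  show "holomorphic_vars (B <+> B) S\<^sub>h\<^sub>T (\<lambda>w. \<Prod>b\<in>B. exp (c * of_int (\<mu> b) * w (Inl b)))"
    by (intro holomorphic_vars_prod holomorphic_vars_exp holomorphic_vars_mult
        holomorphic_vars_const holomorphic_vars_var finite_basis_Plus) auto
  show "(\<Prod>b\<in>B. exp (c * of_int (\<mu> b) * w (Inl b))) = exp (c * extend_h L \<mu> (chH (w \<circ> Inl)))" for w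
    by (simp add: extend_h_chart[OF assms] exp_sum[OF finite_basis] sum_distrib_left mult_ac)
qed

text \<open>In charts the action is an exponential times a power in each coordinate, hence
  holomorphic jointly in \<open>x\<close> and \<open>t\<close>. Joint holomorphy is what analyticity
  of a coboundary demands.\<close>

lemma holomorphic_fun_hT_action:
  assumes "holomorphic_fun_T L B f" "\<epsilon> \<in> {1, -1 :: int}"
  shows "holomorphic_fun_hT L B (\<lambda>x t. f (exp_T L x \<otimes>\<^bsub>T\<^esub> t [^]\<^bsub>T\<^esub> \<epsilon>))"
  unfolding holomorphic_fun_hT_def
proof (rule holomorphic_vars_cong)
  \<comment> \<open>The restriction to \<open>B\<close> makes the coordinate vector extensional, so
    that it lies in the domain \<open>S\<^sub>T\<close>.\<close>
  let ?G = "\<lambda>w. \<lambda>b\<in>B. exp (2 * of_real pi * \<i> * w (Inl b)) * w (Inr b) powi \<epsilon>"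
  show "holomorphic_vars (B <+> B) S\<^sub>h\<^sub>T (\<lambda>w. f (chT (?G w)))"
  proof (rule holomorphic_vars_compose[of B S\<^sub>T "\<lambda>z. f (chT z)"])
    show "holomorphic_vars (B <+> B) S\<^sub>h\<^sub>T (\<lambda>w. ?G w b)" if b: "b \<in> B" for b
    proof -
      have "holomorphic_vars (B <+> B) S\<^sub>h\<^sub>T
          (\<lambda>w. exp (2 * of_real pi * \<i> * w (Inl b)) * w (Inr b) powi \<epsilon>)"
        using b by (intro holomorphic_vars_mult holomorphic_vars_exp holomorphic_vars_powi
          holomorphic_vars_const holomorphic_vars_var finite_basis_Plus S_hT_nonzero) auto
      with b show ?thesis by simp
    qed
    show "?G w \<in> S\<^sub>T" if "w \<in> S\<^sub>h\<^sub>T" for w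
      using S_hT_nonzero[OF that] by auto
  qed (use assms finite_basis in \<open>auto simp: holomorphic_fun_T_def\<close>)
  show "f (chT (?G w)) = f (exp_T L (chH (w \<circ> Inl)) \<otimes>\<^bsub>T\<^esub> chT (w \<circ> Inr) [^]\<^bsub>T\<^esub> \<epsilon>)"
    if "w \<in> S\<^sub>h\<^sub>T" for w
  proof -
    have "exp_T L (chH (w \<circ> Inl)) \<otimes>\<^bsub>T\<^esub> chT (w \<circ> Inr) [^]\<^bsub>T\<^esub> \<epsilon> =
      chT (\<lambda>b. exp (2 * of_real pi * \<i> * w (Inl b)) * w (Inr b) powi \<epsilon>)"
      using S_hT_nonzero[OF that] assms(2) by (simp add: exp_T_chart chT_pow chT_mult)
    also have "\<dots> = chT (?G w)"
      using S_hT_nonzero[OF that] by (intro chT_cong) auto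
    finally show ?thesis by simp
  qed
qed

lemma holomorphic_fun_hT_snd:
  assumes "holomorphic_fun_T L B f"
  shows "holomorphic_fun_hT L B (\<lambda>x t. f t)"
  unfolding holomorphic_fun_hT_def
proof (rule holomorphic_vars_cong)
  let ?G = "\<lambda>w. \<lambda>b\<in>B. w (Inr b)"
  show "holomorphic_vars (B <+> B) S\<^sub>h\<^sub>T (\<lambda>w. f (chT (?G w)))"
  proof (rule holomorphic_vars_compose[of B S\<^sub>T "\<lambda>z. f (chT z)"])
    show "holomorphic_vars (B <+> B) S\<^sub>h\<^sub>T (\<lambda>w. ?G w b)" if b: "b \<in> B" for b
      using b by (simp add: holomorphic_vars_var[OF finite_basis_Plus InrI])
    show "?G w \<in> S\<^sub>T" if "w \<in> S\<^sub>h\<^sub>T" for w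
      using S_hT_nonzero[OF that] by auto
  qed (use assms finite_basis in \<open>auto simp: holomorphic_fun_T_def\<close>)
  show "f (chT (?G w)) = f (chT (w \<circ> Inr))" if "w \<in> S\<^sub>h\<^sub>T" for w
    using chT_cong[of "w \<circ> Inr" "?G w"] S_hT_nonzero[OF that] by simp
qed

lemma holomorphic_fun_hT_slice:
  assumes "holomorphic_fun_hT L B F" "x \<in> carrier H"
  shows "holomorphic_fun_T L B (F x)"
proof -
  obtain u where u: "x = chH u" using assms(2) by (rule chH_surj)
  show ?thesis
    unfolding holomorphic_fun_T_def
  proof (rule holomorphic_vars_cong)
    let ?G = "\<lambda>w. \<lambda>i\<in>B <+> B. case i of Inl b \<Rightarrow> u b | Inr b \<Rightarrow> w b"
    show "holomorphic_vars B S\<^sub>T (\<lambda>w. F (chH (?G w \<circ> Inl)) (chT (?G w \<circ> Inr)))"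
    proof (rule holomorphic_vars_compose[of "B <+> B" S\<^sub>h\<^sub>T "\<lambda>w. F (chH (w \<circ> Inl)) (chT (w \<circ> Inr))"])
      show "holomorphic_vars B S\<^sub>T (\<lambda>w. ?G w i)" if "i \<in> B <+> B" for i
        using that by (auto intro!: holomorphic_vars_var holomorphic_vars_const finite_basis)
    qed (use assms finite_basis in \<open>auto simp: holomorphic_fun_hT_def split: sum.splits\<close>)
    show "F (chH (?G w \<circ> Inl)) (chT (?G w \<circ> Inr)) = F x (chT w)" if "w \<in> S\<^sub>T" for w
    proof -
      have "chT (?G w \<circ> Inr) = chT w" "chH (?G w \<circ> Inl) = x"
        unfolding u using S_T_nonzero[OF that] by (auto intro!: chT_cong chH_cong split: if_splits)
      then show ?thesis by simp
    qed
  qed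
qed

lemma holomorphic_fun_hT_translate:
  assumes "holomorphic_fun_hT L B F" "c \<in> carrier T"
  shows "holomorphic_fun_hT L B (\<lambda>x t. F x (c \<otimes>\<^bsub>T\<^esub> t))"
proof -
  obtain u where u: "u \<in> S\<^sub>T" "c = chT u" using assms(2) by (rule chT_surj)
  show ?thesis
    unfolding holomorphic_fun_hT_def
  proof (rule holomorphic_vars_cong)
    let ?G = "\<lambda>w. \<lambda>i\<in>B <+> B. case i of Inl b \<Rightarrow> w (Inl b) | Inr b \<Rightarrow> u b * w (Inr b)"
    show "holomorphic_vars (B <+> B) S\<^sub>h\<^sub>T (\<lambda>w. F (chH (?G w \<circ> Inl)) (chT (?G w \<circ> Inr)))"
    proof (rule holomorphic_vars_compose[of "B <+> B" S\<^sub>h\<^sub>T "\<lambda>w. F (chH (w \<circ> Inl)) (chT (w \<circ> Inr))"])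
      show "holomorphic_vars (B <+> B) S\<^sub>h\<^sub>T (\<lambda>w. ?G w i)" if "i \<in> B <+> B" for i
        using that
        by (auto intro!: holomorphic_vars_var holomorphic_vars_mult holomorphic_vars_const
            finite_basis_Plus)
      show "?G w \<in> S\<^sub>h\<^sub>T" if "w \<in> S\<^sub>h\<^sub>T" for w
        using S_hT_nonzero[OF that] S_T_nonzero[OF u(1)] by (auto split: sum.splits)
    qed (use assms finite_basis in \<open>auto simp: holomorphic_fun_hT_def\<close>)
    show "F (chH (?G w \<circ> Inl)) (chT (?G w \<circ> Inr)) = F (chH (w \<circ> Inl)) (c \<otimes>\<^bsub>T\<^esub> chT (w \<circ> Inr))"
      if "w \<in> S\<^sub>h\<^sub>T" for w
    proof -
      have "c \<otimes>\<^bsub>T\<^esub> chT (w \<circ> Inr) = chT (?G w \<circ> Inr)"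
        unfolding u(2) using S_hT_nonzero[OF that] S_T_nonzero[OF u(1)]
        by (subst chT_mult) (auto intro!: chT_cong)
      moreover have "chH (w \<circ> Inl) = chH (?G w \<circ> Inl)"
        by (rule chH_cong) auto
      ultimately show ?thesis by simp
    qed
  qed
qed

text \<open>
  Holomorphy descends along the exponential map because near any point \<open>z\<close> a branch of the
  logarithm is holomorphic; \<open>Ln (w / z) + Ln z\<close> is such a branch and is a logarithm of \<open>w\<close>
  for every nonzero \<open>w\<close>.
\<close>

lemma holomorphic_fun_T_descend:
  assumes "holomorphic_fun_hT L B F" "\<And>x. x \<in> carrier H \<Longrightarrow> F x \<one>\<^bsub>T\<^esub> = f (exp_T L x)"
  shows "holomorphic_fun_T L B f"
  unfolding holomorphic_fun_T_def holomorphic_vars_iff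
proof
  fix z assume z: "z \<in> S\<^sub>T"
  define lg where "lg b u = (Ln (u / z b) + Ln (z b)) / (2 * of_real pi * \<i>)" for b u
  \<comment> \<open>The torus coordinates are frozen at 1, so that the second argument of
    \<open>F\<close> is the unit, where the hypothesis identifies \<open>f\<close>.\<close>
  let ?G = "\<lambda>w. \<lambda>i\<in>B <+> B. case i of Inl b \<Rightarrow> lg b (w b) | Inr b \<Rightarrow> 1"
  let ?F = "\<lambda>w. F (chH (w \<circ> Inl)) (chT (w \<circ> Inr))"
  have lg: "exp (2 * of_real pi * \<i> * lg b u) = u" if "b \<in> B" "u \<noteq> 0" for b u
    using that S_T_nonzero[OF z] by (simp add: lg_def exp_add)
  have hol: "holomorphic_at B S\<^sub>T (\<lambda>w. lg b (w b)) z" if "b \<in> B" for b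
  proof (rule holomorphic_at_compose_field[of B S\<^sub>T "\<lambda>w. w b" z "lg b"])
    show "(lg b has_field_derivative (1 / z b / (2 * of_real pi * \<i>))) (at (z b))"
      unfolding lg_def using S_T_nonzero[OF z that]
      by (auto intro!: derivative_eq_intros)
  qed (use that finite_basis in \<open>auto intro: holomorphic_at_var\<close>)
  have "holomorphic_at B S\<^sub>T (\<lambda>w. ?F (?G w)) z"
  proof (rule holomorphic_at_compose[of "B <+> B" B S\<^sub>T ?G z S\<^sub>h\<^sub>T ?F])
    show "holomorphic_at B S\<^sub>T (\<lambda>w. ?G w i) z" if "i \<in> B <+> B" for i
      using that by (auto intro!: hol holomorphic_at_const)
    show mem: "?G w \<in> S\<^sub>h\<^sub>T" for w
      by (auto split: sum.splits)
    show "holomorphic_at (B <+> B) S\<^sub>h\<^sub>T ?F (?G z)"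
      using assms(1) mem[of z] unfolding holomorphic_fun_hT_def holomorphic_vars_iff by blast
  qed (simp_all add: finite_basis)
  then show "holomorphic_at B S\<^sub>T (\<lambda>z. f (chT z)) z"
  proof (rule holomorphic_at_cong[OF _ z])
    fix w assume w: "w \<in> S\<^sub>T"
    have 1: "chT (?G w \<circ> Inr) = \<one>\<^bsub>T\<^esub>"
      unfolding chT_one[symmetric] by (rule chT_cong) auto
    have "exp_T L (chH (?G w \<circ> Inl)) = chT w"
      unfolding exp_T_chart
      using lg S_T_nonzero[OF w] by (intro chT_cong) auto
    then show "?F (?G w) = f (chT w)"
      unfolding 1 by (simp add: assms(2))
  qed
qed

lemma holomorphic_map_T_translate:
  assumes "c \<in> carrier T" "\<And>t. t \<in> carrier T \<Longrightarrow> \<phi> t = c \<otimes>\<^bsub>T\<^esub> t"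
  shows "holomorphic_map_T L B \<phi>"
  unfolding holomorphic_map_T_def holomorphic_fun_T_def
proof
  fix b assume b: "b \<in> B"
  obtain u where u: "u \<in> S\<^sub>T" "c = chT u" using assms(1) by (rule chT_surj)
  have "holomorphic_vars B S\<^sub>T (\<lambda>z. u b * z b)"
    by (intro holomorphic_vars_mult holomorphic_vars_const holomorphic_vars_var finite_basis b)
  then show "holomorphic_vars B S\<^sub>T (\<lambda>z. coords L Cmult B (\<phi> (chT z)) b)"
  proof (rule holomorphic_vars_cong)
    fix z assume z: "z \<in> S\<^sub>T"
    show "u b * z b = coords L Cmult B (\<phi> (chT z)) b"
      using S_T_nonzero[OF z] S_T_nonzero[OF u(1)] b
      by (simp add: assms(2)[OF chT_S_T[OF z]] u(2) chT_mult coords_chT)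
  qed
qed

end


section \<open>Equivalences of crossed modules\<close>

lemma iso_cong:
  assumes "f \<in> iso G H" "\<And>x. x \<in> carrier G \<Longrightarrow> f x = g x" "group G"
  shows "g \<in> iso G H"
proof -
  interpret group G by fact
  show ?thesis
    using assms(1,2) bij_betw_cong[of "carrier G" f g "carrier H"]
    by (auto simp: iso_def hom_def Pi_iff)
qed

lemma normal_bnd_image:
  assumes "crossed_module Y"
  shows "bnd Y ` carrier (Top Y) \<lhd> Base Y"
proof -
  interpret T: group "Top Y" using assms by (simp add: crossed_module_def)
  interpret G: group "Base Y" using assms by (simp add: crossed_module_def)
  interpret bnd: group_hom "Top Y" "Base Y" "bnd Y"
    using assms by (simp add: crossed_module_def group_hom_def group_hom_axioms_def)
  show ?thesis
    unfolding G.normal_inv_iff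
  proof (intro conjI ballI)
    show "subgroup (bnd Y ` carrier (Top Y)) (Base Y)"
      using bnd.img_is_subgroup .
    fix x h assume x: "x \<in> carrier (Base Y)" and "h \<in> bnd Y ` carrier (Top Y)"
    then obtain a where a: "a \<in> carrier (Top Y)" "h = bnd Y a" by blast
    \<comment> \<open>Acting by the inverse of \<open>x\<close> produces conjugation in the
      direction demanded by normality.\<close>
    have "bnd Y (act Y a (inv\<^bsub>Base Y\<^esub> x)) = x \<otimes>\<^bsub>Base Y\<^esub> h \<otimes>\<^bsub>Base Y\<^esub> inv\<^bsub>Base Y\<^esub> x"
      using assms a x unfolding crossed_module_def by simp
    moreover have "act Y a (inv\<^bsub>Base Y\<^esub> x) \<in> carrier (Top Y)"
      using assms a x unfolding crossed_module_def by (auto simp: hom_def Pi_iff)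
    ultimately show "x \<otimes>\<^bsub>Base Y\<^esub> h \<otimes>\<^bsub>Base Y\<^esub> inv\<^bsub>Base Y\<^esub> x \<in> bnd Y ` carrier (Top Y)"
      by (metis imageI)
  qed
qed

text \<open>First isomorphism theorem for \<open>f0\<close> followed by the projection to
  \<open>pi0 Y\<close>. The hypothesis \<open>surj\<close> makes this composite onto; its kernel
  contains the image of \<open>bnd X\<close> by the commuting square and is contained in it by
  \<open>inj\<close>.\<close>

lemma pi0_map_iso:
  assumes hom: "xmod_hom X Y f1 f0"
    and surj: "\<And>y. y \<in> carrier (Base Y) \<Longrightarrow>
      \<exists>x\<in>carrier (Base X). \<exists>b\<in>carrier (Top Y). y = f0 x \<otimes>\<^bsub>Base Y\<^esub> bnd Y b"
    and inj: "\<And>x. x \<in> carrier (Base X) \<Longrightarrow> f0 x \<in> bnd Y ` carrier (Top Y) \<Longrightarrow>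
      x \<in> bnd X ` carrier (Top X)"
  shows "pi0_map Y f0 \<in> iso (pi0 X) (pi0 Y)"
proof -
  have X: "crossed_module X" and Y: "crossed_module Y" and f1: "f1 \<in> hom (Top X) (Top Y)"
    and f0: "f0 \<in> hom (Base X) (Base Y)"
    and sq: "\<And>a. a \<in> carrier (Top X) \<Longrightarrow> bnd Y (f1 a) = f0 (bnd X a)"
    using hom by (auto simp: xmod_hom_def)
  interpret GX: group "Base X" using X by (simp add: crossed_module_def)
  interpret GY: group "Base Y" using Y by (simp add: crossed_module_def)
  define N where "N = bnd Y ` carrier (Top Y)"
  define q where "q x = N #>\<^bsub>Base Y\<^esub> f0 x" for x
  interpret N: normal N "Base Y" unfolding N_def by (rule normal_bnd_image[OF Y])
  have sN: "subgroup N (Base Y)" by (rule N.subgroup_axioms)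
  have f0c: "f0 x \<in> carrier (Base Y)" if "x \<in> carrier (Base X)" for x
    using hom_in_carrier[OF f0 that] .
  have "q \<in> hom (Base X) (Base Y Mod N)"
    using hom_compose[OF f0 N.r_coset_hom_Mod] by (simp add: q_def[abs_def] comp_def)
  then interpret q: group_hom "Base X" "Base Y Mod N" q
    by (simp add: group_hom_def group_hom_axioms_def GX.is_group N.factorgroup_is_group)
  have bX: "bnd X a \<in> carrier (Base X)" if "a \<in> carrier (Top X)" for a
    using X that by (auto simp: crossed_module_def hom_def)
  have N_iff: "N #>\<^bsub>Base Y\<^esub> y = N \<longleftrightarrow> y \<in> N" if "y \<in> carrier (Base Y)" for y
    using GY.rcos_self[OF that sN] GY.coset_join2[OF that sN] by auto
  have ker: "kernel (Base X) (Base Y Mod N) q = bnd X ` carrier (Top X)"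
  proof (intro equalityI subsetI)
    fix x assume "x \<in> kernel (Base X) (Base Y Mod N) q"
    then show "x \<in> bnd X ` carrier (Top X)"
      using N_iff[OF f0c, of x] inj[of x, folded N_def] by (simp add: kernel_def q_def)
  next
    fix x assume "x \<in> bnd X ` carrier (Top X)"
    then obtain a where a: "a \<in> carrier (Top X)" "x = bnd X a" by blast
    have "f0 x \<in> N"
      unfolding a(2) sq[OF a(1), symmetric] N_def using hom_in_carrier[OF f1 a(1)] by simp
    then show "x \<in> kernel (Base X) (Base Y Mod N) q"
      using N_iff[OF f0c[OF bX[OF a(1)]]] bX[OF a(1)] by (simp add: kernel_def q_def a(2))
  qed
  have "q ` carrier (Base X) = carrier (Base Y Mod N)"
  proof
    show "carrier (Base Y Mod N) \<subseteq> q ` carrier (Base X)"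
    proof
      fix C assume "C \<in> carrier (Base Y Mod N)"
      then obtain y where y: "y \<in> carrier (Base Y)" "C = N #>\<^bsub>Base Y\<^esub> y"
        by (auto simp: carrier_FactGroup)
      obtain x b where xb: "x \<in> carrier (Base X)" "b \<in> carrier (Top Y)"
        "y = f0 x \<otimes>\<^bsub>Base Y\<^esub> bnd Y b"
        using surj[OF y(1)] by blast
      \<comment> \<open>In \<open>surj\<close> the factor from the boundary stands on the right;
        normality moves it to the left, where the cosets of the quotient have it.\<close>
      have "y \<in> f0 x <#\<^bsub>Base Y\<^esub> N"
        unfolding xb(3) l_coset_def N_def using xb(2) by blast
      then have "y \<in> N #>\<^bsub>Base Y\<^esub> f0 x"
        using N.coset_eq f0c[OF xb(1)] by blast
      then have "C = q x"
        unfolding y(2) q_def using GY.repr_independence[OF _ f0c[OF xb(1)] sN] by simp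
      with xb(1) show "C \<in> q ` carrier (Base X)" by blast
    qed
  qed auto
  from q.FactGroup_iso_set[OF this]
  have iso: "(\<lambda>C. the_elem (q ` C)) \<in> iso (pi0 X) (pi0 Y)"
    unfolding ker by (simp add: pi0_def N_def)
  \<comment> \<open>The isomorphism theorem sends a coset to the one value that \<open>q\<close>
    takes on it, whereas \<open>pi0_map\<close> forms a set product; they agree because that product
    is the union of the values of \<open>q\<close>.\<close>
  show ?thesis
  proof (rule iso_cong[OF iso])
    show "group (pi0 X)"
      unfolding pi0_def by (rule normal.factorgroup_is_group[OF normal_bnd_image[OF X]])
    fix C assume "C \<in> carrier (pi0 X)"
    then obtain x where x: "x \<in> carrier (Base X)" "C = bnd X ` carrier (Top X) #>\<^bsub>Base X\<^esub> x"
      by (auto simp: pi0_def carrier_FactGroup)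
    have "q c = q x" if "c \<in> C" for c
    proof -
      have "c \<in> kernel (Base X) (Base Y Mod N) q #>\<^bsub>Base X\<^esub> x"
        using that by (simp add: x(2) ker)
      then have "\<exists>k. k \<in> kernel (Base X) (Base Y Mod N) q \<and> c = k \<otimes>\<^bsub>Base X\<^esub> x"
        unfolding r_coset_def by (simp only: UN_iff singleton_iff Bex_def)
      then obtain k where k: "k \<in> kernel (Base X) (Base Y Mod N) q" "c = k \<otimes>\<^bsub>Base X\<^esub> x"
        by (elim exE conjE)
      then have "k \<in> carrier (Base X)" "q k = \<one>\<^bsub>Base Y Mod N\<^esub>" by (simp_all add: kernel_def)
      then show ?thesis unfolding k(2) using x(1) by (simp del: one_FactGroup mult_FactGroup)
    qed
    moreover have "x \<in> C"
      unfolding x(2) by (rule GX.rcos_self[OF x(1) normal_imp_subgroup[OF normal_bnd_image[OF X]]])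
    ultimately have "q ` C = {q x}" by blast
    moreover have "pi0_map Y f0 C = \<Union> (q ` C)"
      unfolding pi0_map_def set_mult_def q_def r_coset_def N_def by blast
    ultimately show "the_elem (q ` C) = pi0_map Y f0 C" by simp
  qed
qed


text \<open>The left side has the form of the first centraliser condition when the boundary map is
  trivial.\<close>

lemma (in group) commutator_eq_one_iff:
  assumes "a \<in> carrier G" "b \<in> carrier G"
  shows "\<one> = inv a \<otimes> inv b \<otimes> a \<otimes> b \<longleftrightarrow> a \<otimes> b = b \<otimes> a"
proof -
  have "inv a \<otimes> inv b \<otimes> a \<otimes> b = inv (b \<otimes> a) \<otimes> (a \<otimes> b)"
    using assms by (simp add: inv_mult_group m_assoc)
  then show ?thesis
    using assms inv_solve_left[of \<one> "b \<otimes> a" "a \<otimes> b"] by auto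
qed

text \<open>Lets the residues 0 and 1 of the extension be treated as integer exponents of
  -1.\<close>

lemma minus_one_powi_mod: "(-1 :: complex) powi (k mod 2) = (-1) powi k"
  by (simp add: power_int_minus_left)


section \<open>The basic representation\<close>

locale basic_representation = lattice_torus L B for L :: "'l monoid" (structure) and B +
  fixes J :: "'l \<Rightarrow> 'l \<Rightarrow> int"
  assumes bilinear: "int_bilinear L J"
begin

lemma J_right: "m \<in> carrier L \<Longrightarrow> J m \<in> hom L integer_group"
  and J_left: "m \<in> carrier L \<Longrightarrow> (\<lambda>k. J k m) \<in> hom L integer_group"
  using bilinear by (auto simp: int_bilinear_def)

lemma J_mult_right:
  "m \<in> carrier L \<Longrightarrow> n \<in> carrier L \<Longrightarrow> n' \<in> carrier L \<Longrightarrow> J m (n \<otimes> n') = J m n + J m n'"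
  by (rule dual_mult[OF J_right])

lemma J_mult_left:
  "m \<in> carrier L \<Longrightarrow> n \<in> carrier L \<Longrightarrow> n' \<in> carrier L \<Longrightarrow> J (n \<otimes> n') m = J n m + J n' m"
  by (rule dual_mult[OF J_left])

lemma J_one: "m \<in> carrier L \<Longrightarrow> J m \<one> = 0" "m \<in> carrier L \<Longrightarrow> J \<one> m = 0"
  using J_mult_right[of m \<one> \<one>] J_mult_left[of m \<one> \<one>] by auto

lemma J_inv_right: "m \<in> carrier L \<Longrightarrow> n \<in> carrier L \<Longrightarrow> J m (inv n) = - J m n"
  using J_mult_right[of m n "inv n"] by (simp add: J_one)

text \<open>A square root of the pullback of \<open>cJ n\<close> along the exponential map. It need
  not descend to the torus: on the lattice its values are signs.\<close>

definition eJ :: "'l \<Rightarrow> 'l ctensor \<Rightarrow> complex" where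
  "eJ n x = exp (of_real pi * \<i> * extend_h L (\<lambda>k. J k n) x)"

text \<open>The variable is in the first slot because \<open>J\<close> may fail to be symmetric:
  translating the character J(m,-) by half of \<open>n\<close> produces a sign with exponent J(m,n),
  read as a function of \<open>m\<close>.\<close>

definition cJ :: "'l \<Rightarrow> 'l ctensor \<Rightarrow> complex" where
  "cJ n = character L (\<lambda>k. J k n)"

lemma eJ_nonzero [simp]: "eJ n x \<noteq> 0"
  by (simp add: eJ_def)

lemma eJ_mult:
  "n \<in> carrier L \<Longrightarrow> x \<in> carrier H \<Longrightarrow> y \<in> carrier H \<Longrightarrow> eJ n (x \<otimes>\<^bsub>H\<^esub> y) = eJ n x * eJ n y"
  by (simp add: eJ_def extend_h_mult[OF J_left] ring_distribs exp_add)

lemma eJ_inv: "n \<in> carrier L \<Longrightarrow> x \<in> carrier H \<Longrightarrow> eJ n (inv\<^bsub>H\<^esub> x) = inverse (eJ n x)"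
  by (simp add: eJ_def extend_h_inv[OF J_left] exp_minus)

lemma eJ_add:
  assumes "n \<in> carrier L" "n' \<in> carrier L" "x \<in> carrier H"
  shows "eJ (n \<otimes> n') x = eJ n x * eJ n' x"
proof -
  have "extend_h L (\<lambda>k. J k (n \<otimes> n')) x =
      extend_h L (\<lambda>k. J k n) x + extend_h L (\<lambda>k. J k n') x"
    by (rule extend_h_add) (auto simp: assms J_left J_mult_right)
  then show ?thesis by (simp add: eJ_def ring_distribs exp_add)
qed

lemma exp_pi_int: "exp (of_real pi * \<i> * of_int k) = (-1) powi k"
proof -
  have "exp (of_real pi * \<i> * of_int k) = exp (of_real pi * \<i>) powi k"
    unfolding exp_power_int by (simp add: mult_ac)
  then show ?thesis by simp
qed

lemma eJ_lattice: "n \<in> carrier L \<Longrightarrow> m \<in> carrier L \<Longrightarrow> eJ n (pure_tensor L Cadd m 1) = (-1) powi J m n"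
  by (simp add: eJ_def extend_h_pure[OF J_left] exp_pi_int)

lemma cJ_nonzero: "n \<in> carrier L \<Longrightarrow> t \<in> carrier T \<Longrightarrow> cJ n t \<noteq> 0"
  unfolding cJ_def by (rule character_nonzero[OF J_left])

lemma cJ_mult: "n \<in> carrier L \<Longrightarrow> s \<in> carrier T \<Longrightarrow> t \<in> carrier T \<Longrightarrow>
    cJ n (s \<otimes>\<^bsub>T\<^esub> t) = cJ n s * cJ n t"
  unfolding cJ_def by (rule character_mult[OF J_left])

lemma cJ_inv: "n \<in> carrier L \<Longrightarrow> t \<in> carrier T \<Longrightarrow> cJ n (inv\<^bsub>T\<^esub> t) = inverse (cJ n t)"
  unfolding cJ_def by (rule character_inv[OF J_left])

lemma cJ_exp: "n \<in> carrier L \<Longrightarrow> x \<in> carrier H \<Longrightarrow> cJ n (exp_T L x) = eJ n x * eJ n x"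
  unfolding cJ_def eJ_def by (simp add: character_exp_T[OF J_left] exp_add[symmetric] mult_ac)

lemma cJ_add:
  "n \<in> carrier L \<Longrightarrow> n' \<in> carrier L \<Longrightarrow> t \<in> carrier T \<Longrightarrow> cJ (n \<otimes> n') t = cJ n t * cJ n' t"
  unfolding cJ_def by (rule character_add) (auto simp: J_left J_mult_right)

lemma cJ_one:
  assumes "t \<in> carrier T"
  shows "cJ \<one> t = 1"
  using cJ_add[of \<one> \<one> t] cJ_nonzero[of \<one> t] assms by simp

text \<open>Besides the cocycle of the extension, this sign yields the action of \<open>E\<close> on
  scalars, through the character in \<open>F\<^sub>1\<close>.\<close>

lemma cJ_two_torsion:
  "n \<in> carrier L \<Longrightarrow> m \<in> carrier L \<Longrightarrow> cJ n (two_torsion m) = (-1) powi J m n"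
  unfolding cJ_def by (simp add: character_pure[OF J_left])

section \<open>The base group and its action on the torus\<close>

abbreviation "\<Theta> \<equiv> Theta_base L"

lemma Theta_simps [simp]:
  "carrier \<Theta> = carrier H \<times> {1, -1}"
  "(x, \<epsilon>) \<otimes>\<^bsub>\<Theta>\<^esub> (y, \<delta>) = (x \<otimes>\<^bsub>H\<^esub> y [^]\<^bsub>H\<^esub> \<epsilon>, \<epsilon> * \<delta>)"
  "\<one>\<^bsub>\<Theta>\<^esub> = (\<one>\<^bsub>H\<^esub>, 1)"
  by (auto simp: Theta_base_def)

lemma H_pow_minus_one [simp]: "x \<in> carrier H \<Longrightarrow> x [^]\<^bsub>H\<^esub> (- 1 :: int) = inv\<^bsub>H\<^esub> x"
  by (simp add: H.int_pow_neg)

lemma T_pow_minus_one [simp]: "t \<in> carrier T \<Longrightarrow> t [^]\<^bsub>T\<^esub> (- 1 :: int) = inv\<^bsub>T\<^esub> t"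
  by (simp add: T.int_pow_neg)

lemma group_Theta: "group \<Theta>"
proof (rule groupI)
  fix s assume "s \<in> carrier \<Theta>"
  then obtain x \<epsilon> where "s = (x, \<epsilon>)" "x \<in> carrier H" "\<epsilon> = 1 \<or> \<epsilon> = -1" by auto
  \<comment> \<open>The sign is its own inverse, so the inverse of \<open>(x, \<epsilon>)\<close>
    keeps \<open>\<epsilon>\<close> and twists the inverse of \<open>x\<close> by it.\<close>
  then show "\<exists>s'\<in>carrier \<Theta>. s' \<otimes>\<^bsub>\<Theta>\<^esub> s = \<one>\<^bsub>\<Theta>\<^esub>"
    by (intro bexI[of _ "((inv\<^bsub>H\<^esub> x) [^]\<^bsub>H\<^esub> \<epsilon>, \<epsilon>)"]) auto
qed (auto simp: H.inv_mult H.m_assoc)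

sublocale \<Theta>: group \<Theta> by (rule group_Theta)

abbreviation "R \<equiv> rbas0 L"

lemma R_apply: "t \<in> carrier T \<Longrightarrow> R (x, \<epsilon>) t = exp_T L x \<otimes>\<^bsub>T\<^esub> t [^]\<^bsub>T\<^esub> \<epsilon>"
  by (simp add: rbas0_def)

lemma R_closed [simp]: "s \<in> carrier \<Theta> \<Longrightarrow> t \<in> carrier T \<Longrightarrow> R s t \<in> carrier T"
  by (auto simp: R_apply)

lemma R_mult:
  "s \<in> carrier \<Theta> \<Longrightarrow> s' \<in> carrier \<Theta> \<Longrightarrow> t \<in> carrier T \<Longrightarrow> R (s \<otimes>\<^bsub>\<Theta>\<^esub> s') t = R s (R s' t)"
  by (auto simp: R_apply T.inv_mult T.m_assoc)

lemma R_one: "t \<in> carrier T \<Longrightarrow> R (\<one>\<^bsub>H\<^esub>, 1) t = t"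
  by (simp add: R_apply)

lemma R_lattice: "m \<in> carrier L \<Longrightarrow> t \<in> carrier T \<Longrightarrow> R (pure_tensor L Cadd m 1, 1) t = t"
  by (simp add: R_apply exp_T_lattice)

text \<open>Translations commute among themselves; inversion commutes with this one because a point
  of order two equals its own inverse.\<close>

lemma R_commute:
  assumes "n \<in> carrier L" "s \<in> carrier \<Theta>" "t \<in> carrier T"
  shows "R s (two_torsion n \<otimes>\<^bsub>T\<^esub> t) = two_torsion n \<otimes>\<^bsub>T\<^esub> R s t"
proof -
  have "inv\<^bsub>T\<^esub> two_torsion n = two_torsion n"
    using assms(1) by (intro T.inv_equality) (auto simp: two_torsion_square)
  then show ?thesis
    using assms by (auto simp: R_apply T.inv_mult T.m_ac)
qed

lemma bij_R: "s \<in> carrier \<Theta> \<Longrightarrow> R s \<in> Bij (carrier T)"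
proof -
  assume s: "s \<in> carrier \<Theta>"
  then have inv: "inv\<^bsub>\<Theta>\<^esub> s \<in> carrier \<Theta>" by (rule \<Theta>.inv_closed)
  have "R (inv\<^bsub>\<Theta>\<^esub> s) (R s t) = t" "R s (R (inv\<^bsub>\<Theta>\<^esub> s) t) = t" if "t \<in> carrier T" for t
    using R_mult[OF inv s that] R_mult[OF s inv that] s that
    by (simp_all add: \<Theta>.l_inv \<Theta>.r_inv R_one del: Theta_simps(1,2))
  then have "bij_betw (R s) (carrier T) (carrier T)"
    by (intro bij_betwI[where g="R (inv\<^bsub>\<Theta>\<^esub> s)"]) (auto simp: s inv simp del: Theta_simps(1,2))
  then show ?thesis
    by (auto simp: Bij_def rbas0_def split: prod.splits)
qed

section \<open>Automorphisms of the torus\<close>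

abbreviation "Bij_T \<equiv> BijGroup (carrier T)"

interpretation BT: group Bij_T by (rule group_BijGroup)

lemma Bij_T_simps:
  "carrier Bij_T = Bij (carrier T)"
  "\<phi> \<in> Bij (carrier T) \<Longrightarrow> \<psi> \<in> Bij (carrier T) \<Longrightarrow> \<phi> \<otimes>\<^bsub>Bij_T\<^esub> \<psi> = compose (carrier T) \<phi> \<psi>"
  "\<one>\<^bsub>Bij_T\<^esub> = (\<lambda>t\<in>carrier T. t)"
  by (auto simp: BijGroup_def)

text \<open>The target is the group of all bijections, whose group laws are then at hand for
  inverting \<open>R s\<close> and for forming commutators.\<close>

lemma hom_R: "R \<in> hom \<Theta> Bij_T"
proof (rule homI)
  fix s s' assume s: "s \<in> carrier \<Theta>" "s' \<in> carrier \<Theta>"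
  show "R (s \<otimes>\<^bsub>\<Theta>\<^esub> s') = R s \<otimes>\<^bsub>Bij_T\<^esub> R s'"
  proof (rule extensionalityI[of _ "carrier T"])
    show "R (s \<otimes>\<^bsub>\<Theta>\<^esub> s') \<in> extensional (carrier T)"
      using bij_R[OF \<Theta>.m_closed[OF s]] by (rule Bij_imp_extensional)
    show "R s \<otimes>\<^bsub>Bij_T\<^esub> R s' \<in> extensional (carrier T)"
      using s by (simp add: Bij_T_simps bij_R del: Theta_simps)
    show "R (s \<otimes>\<^bsub>\<Theta>\<^esub> s') t = (R s \<otimes>\<^bsub>Bij_T\<^esub> R s') t" if "t \<in> carrier T" for t
      using s that by (simp add: Bij_T_simps bij_R compose_eq R_mult del: Theta_simps)
  qed
qed (simp add: Bij_T_simps bij_R del: Theta_simps)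

lemma R_inv: "s \<in> carrier \<Theta> \<Longrightarrow> R (inv\<^bsub>\<Theta>\<^esub> s) = inv\<^bsub>Bij_T\<^esub> R s"
  using group_hom.hom_inv[of \<Theta> Bij_T R s] hom_R
  by (simp add: group_hom_def group_hom_axioms_def \<Theta>.is_group BT.is_group del: Theta_simps)

abbreviation "A\<^sub>T \<equiv> Aut_T L B"

lemma Aut_T_simps:
  "\<one>\<^bsub>A\<^sub>T\<^esub> = (\<lambda>t\<in>carrier T. t)" "monoid.mult A\<^sub>T = monoid.mult Bij_T"
  by (simp_all add: Aut_T_def BijGroup_def)

lemma Aut_T_Bij: "\<phi> \<in> carrier A\<^sub>T \<Longrightarrow> \<phi> \<in> Bij (carrier T)"
  by (simp add: Aut_T_def)

lemma holomorphic_map_T_cong: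
  assumes "holomorphic_map_T L B \<phi>" "\<And>t. t \<in> carrier T \<Longrightarrow> \<phi> t = \<psi> t"
  shows "holomorphic_map_T L B \<psi>"
  using assms(1) unfolding holomorphic_map_T_def
  by (auto intro: holomorphic_fun_T_cong simp: assms(2))

text \<open>Holomorphy of the inverse is built into \<open>Aut_T\<close>, so the inverse bijection
  lies there; uniqueness is inherited from the larger group.\<close>

lemma inv_Aut_T:
  assumes g: "g \<in> carrier A\<^sub>T"
  shows "inv\<^bsub>A\<^sub>T\<^esub> g = inv\<^bsub>Bij_T\<^esub> g"
proof -
  have b: "g \<in> Bij (carrier T)" using g by (rule Aut_T_Bij)
  then have bb: "bij_betw g (carrier T) (carrier T)" by (simp add: Bij_def)
  define k where "k = (\<lambda>t\<in>carrier T. inv_into (carrier T) g t)"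
  have kB: "k \<in> Bij (carrier T)" unfolding k_def using b by (rule restrict_inv_into_Bij)
  have kinv: "k = inv\<^bsub>Bij_T\<^esub> g" unfolding k_def using inv_BijGroup[OF b] by simp
  \<comment> \<open>Membership of \<open>k\<close> also asks for holomorphy of its own inverse,
    which on the torus is \<open>g\<close> again.\<close>
  have "inv_into (carrier T) k t = g t" if t: "t \<in> carrier T" for t
  proof -
    have gt: "g t \<in> carrier T" using bb t by (auto simp: bij_betw_def)
    then have "k (g t) = t" using bb t by (simp add: k_def bij_betw_def inv_into_f_f)
    moreover have "inj_on k (carrier T)" using kB by (simp add: Bij_def bij_betw_def)
    ultimately show ?thesis using inv_into_f_f[of k "carrier T" "g t"] gt by simp
  qed
  then have "k \<in> carrier A\<^sub>T"
    using g kB unfolding Aut_T_def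
    by (auto simp: k_def elim: holomorphic_map_T_cong intro: holomorphic_map_T_cong)
  then have "k \<in> carrier A\<^sub>T \<and> g \<otimes>\<^bsub>A\<^sub>T\<^esub> k = \<one>\<^bsub>A\<^sub>T\<^esub> \<and> k \<otimes>\<^bsub>A\<^sub>T\<^esub> g = \<one>\<^bsub>A\<^sub>T\<^esub>"
    using BT.r_inv[of g] BT.l_inv[of g] b by (simp add: Aut_T_simps Bij_T_simps(1,3) kinv)
  moreover have "y = k" if "y \<in> carrier A\<^sub>T \<and> g \<otimes>\<^bsub>A\<^sub>T\<^esub> y = \<one>\<^bsub>A\<^sub>T\<^esub> \<and> y \<otimes>\<^bsub>A\<^sub>T\<^esub> g = \<one>\<^bsub>A\<^sub>T\<^esub>" for y
    using BT.inv_equality[of y g] that Aut_T_Bij[of y] b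
    by (simp add: Aut_T_simps Bij_T_simps(1,3) kinv)
  ultimately have "inv\<^bsub>A\<^sub>T\<^esub> g = k"
    unfolding m_inv_def by (rule the_equality)
  then show ?thesis by (simp add: kinv)
qed

definition trans :: "'l \<Rightarrow> 'l ctensor \<Rightarrow> 'l ctensor" where
  "trans n = (\<lambda>t\<in>carrier T. two_torsion n \<otimes>\<^bsub>T\<^esub> t)"

lemma trans_apply: "t \<in> carrier T \<Longrightarrow> trans n t = two_torsion n \<otimes>\<^bsub>T\<^esub> t"
  by (simp add: trans_def)

lemma trans_trans: "n \<in> carrier L \<Longrightarrow> t \<in> carrier T \<Longrightarrow> trans n (trans n t) = t"
  by (simp add: trans_apply T.m_assoc[symmetric] two_torsion_square)

lemma trans_Bij: "n \<in> carrier L \<Longrightarrow> trans n \<in> Bij (carrier T)"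
proof -
  assume n: "n \<in> carrier L"
  have "bij_betw (trans n) (carrier T) (carrier T)"
    by (rule bij_betwI[where g="trans n"]) (auto simp: trans_trans n, auto simp: trans_def n)
  then show ?thesis by (simp add: Bij_def trans_def)
qed

text \<open>The translation is an involution, so holomorphy of its inverse comes with that of the
  map itself.\<close>

lemma trans_closed:
  assumes n: "n \<in> carrier L"
  shows "trans n \<in> carrier A\<^sub>T"
proof -
  have "inv_into (carrier T) (trans n) t = two_torsion n \<otimes>\<^bsub>T\<^esub> t" if "t \<in> carrier T" for t
  proof -
    have "trans n t \<in> carrier T" using that n by (simp add: trans_apply)
    moreover have "inj_on (trans n) (carrier T)"
      using trans_Bij[OF n] by (simp add: Bij_def bij_betw_def)
    ultimately have "inv_into (carrier T) (trans n) (trans n (trans n t)) = trans n t"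
      by (rule inv_into_f_f[rotated])
    with that n show ?thesis by (simp add: trans_trans) (simp add: trans_apply)
  qed
  then show ?thesis
    unfolding Aut_T_def using trans_Bij[OF n] n
    by (auto intro!: holomorphic_map_T_translate[of "two_torsion n"] simp: trans_apply)
qed

lemma trans_mult:
  assumes "n \<in> carrier L" "n' \<in> carrier L"
  shows "trans n \<otimes>\<^bsub>A\<^sub>T\<^esub> trans n' = trans (n \<otimes> n')"
  unfolding Aut_T_simps(2) Bij_T_simps(2)[OF trans_Bij[OF assms(1)] trans_Bij[OF assms(2)]]
  using assms
  by (intro extensionalityI[of _ "carrier T"])
     (auto simp: compose_eq trans_apply two_torsion_mult T.m_assoc trans_def)

lemma trans_one: "trans \<one> = \<one>\<^bsub>A\<^sub>T\<^esub>"
  by (auto simp: trans_def Aut_T_simps two_torsion_one intro!: restrict_ext)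

lemma trans_eq_one_iff:
  assumes "n \<in> carrier L"
  shows "trans n = \<one>\<^bsub>A\<^sub>T\<^esub> \<longleftrightarrow> two_torsion n = \<one>\<^bsub>T\<^esub>"
proof
  assume "trans n = \<one>\<^bsub>A\<^sub>T\<^esub>"
  then have "trans n \<one>\<^bsub>T\<^esub> = \<one>\<^bsub>T\<^esub>" by (simp add: Aut_T_simps)
  with assms show "two_torsion n = \<one>\<^bsub>T\<^esub>" by (simp add: trans_apply)
qed (auto simp: trans_def Aut_T_simps intro!: restrict_ext)

section \<open>Nowhere vanishing holomorphic functions on the torus\<close>

abbreviation "U \<equiv> units_OT L B"

lemma U_simps:
  "f \<in> carrier U \<longleftrightarrow> f \<in> carrier T \<rightarrow>\<^sub>E UNIV - {0} \<and> holomorphic_fun_T L B f"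
  "f \<otimes>\<^bsub>U\<^esub> g = (\<lambda>t\<in>carrier T. f t * g t)"
  "\<one>\<^bsub>U\<^esub> = (\<lambda>t\<in>carrier T. 1)"
  by (auto simp: units_OT_def)

lemma U_nonzero: "f \<in> carrier U \<Longrightarrow> t \<in> carrier T \<Longrightarrow> f t \<noteq> 0"
  by (auto simp: U_simps)

lemma U_I:
  assumes "\<And>t. t \<in> carrier T \<Longrightarrow> f t \<noteq> 0" "holomorphic_fun_T L B f"
  shows "restrict f (carrier T) \<in> carrier U"
  using assms by (auto simp: U_simps intro: holomorphic_fun_T_cong)

lemma U_eqI:
  assumes "f \<in> carrier U" "g \<in> carrier U" "\<And>t. t \<in> carrier T \<Longrightarrow> f t = g t"
  shows "f = g"
  using assms by (auto simp: U_simps intro: PiE_ext)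

lemma comm_group_U: "comm_group U"
proof (rule comm_groupI)
  fix f assume f: "f \<in> carrier U"
  show "\<exists>g\<in>carrier U. g \<otimes>\<^bsub>U\<^esub> f = \<one>\<^bsub>U\<^esub>"
    using f U_nonzero[OF f]
    by (intro bexI[of _ "\<lambda>t\<in>carrier T. inverse (f t)"] U_I)
       (auto simp: U_simps intro!: holomorphic_fun_T_inverse)
next
  fix f g assume "f \<in> carrier U" "g \<in> carrier U"
  then show "f \<otimes>\<^bsub>U\<^esub> g \<in> carrier U"
    using U_nonzero unfolding U_simps(2)
    by (intro U_I holomorphic_fun_T_mult) (auto simp: U_simps)
next
  show "\<one>\<^bsub>U\<^esub> \<in> carrier U"
    unfolding U_simps(3) by (intro U_I holomorphic_fun_T_const) auto
next
  fix f assume "f \<in> carrier U"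
  then show "\<one>\<^bsub>U\<^esub> \<otimes>\<^bsub>U\<^esub> f = f"
    by (auto simp: U_simps fun_eq_iff PiE_def extensional_def)
qed (auto simp: U_simps(2) mult_ac)

sublocale U: comm_group U by (rule comm_group_U)

lemma inv_U: "f \<in> carrier U \<Longrightarrow> inv\<^bsub>U\<^esub> f = (\<lambda>t\<in>carrier T. inverse (f t))"
  by (rule U.inv_equality)
     (auto simp: U_nonzero U_simps(2,3) intro!: U_I holomorphic_fun_T_inverse, simp add: U_simps(1))

text \<open>For fixed \<open>s\<close> this is a slice of a function that is jointly holomorphic in
  the Lie algebra and the torus.\<close>

lemma U_R:
  assumes "f \<in> carrier U" "s \<in> carrier \<Theta>"
  shows "compose (carrier T) f (R s) \<in> carrier U"
proof -
  obtain x \<epsilon> where s: "s = (x, \<epsilon>)" "x \<in> carrier H" "\<epsilon> \<in> {1, -1}" using assms(2) by auto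
  have "holomorphic_fun_T L B (\<lambda>t. f (exp_T L x \<otimes>\<^bsub>T\<^esub> t [^]\<^bsub>T\<^esub> \<epsilon>))"
    using holomorphic_fun_hT_slice[OF holomorphic_fun_hT_action[OF _ s(3)] s(2)] assms(1)
    by (simp add: U_simps)
  then have "holomorphic_fun_T L B (\<lambda>t. f (R s t))"
    by (rule holomorphic_fun_T_cong) (simp add: R_apply s(1))
  then show ?thesis
    unfolding compose_def using U_nonzero[OF assms(1)] R_closed[OF assms(2)] by (intro U_I) auto
qed

text \<open>The exponential map is onto, so translation by a point of order two is among the
  translations \<open>R (x, 1)\<close>.\<close>

lemma U_trans:
  assumes "f \<in> carrier U" "n \<in> carrier L"
  shows "compose (carrier T) f (trans n) \<in> carrier U"
proof -
  obtain x where x: "x \<in> carrier H" "two_torsion n = exp_T L x"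
    using exp_T_surj[of "two_torsion n"] assms(2) by auto
  have "compose (carrier T) f (trans n) = compose (carrier T) f (R (x, 1))"
    using x by (auto simp: compose_def trans_apply R_apply)
  with U_R[OF assms(1), of "(x, 1)"] x(1) show ?thesis by simp
qed


section \<open>The centraliser of the basic representation\<close>

abbreviation "C\<^sub>0 \<equiv>
  centraliser0 (analytic_chi L B) (Theta L J) (Fun_T L B) (rbas1 L J) (rbas0 L)"

lemma Theta_Fun_T_simps [simp]:
  "Top (Theta L J) = L \<times>\<times> Cmult" "Base (Theta L J) = \<Theta>"
  "bnd (Theta L J) (m, z) = (pure_tensor L Cadd m 1, 1)"
  "Top (Fun_T L B) = U" "Base (Fun_T L B) = A\<^sub>T" "bnd (Fun_T L B) f = \<one>\<^bsub>A\<^sub>T\<^esub>"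
  "act (Fun_T L B) f \<phi> = compose (carrier T) f \<phi>"
  by (simp_all add: Theta_def Fun_T_def)

text \<open>The centraliser conditions on the second component of a pair over
  \<open>trans n\<close>, made pointwise. The lattice condition has become a sign, which depends on
  \<open>n\<close> only modulo doubled elements, just as \<open>trans n\<close> does.\<close>

definition compatible :: "'l \<Rightarrow> ('l ctensor \<times> int \<Rightarrow> 'l ctensor \<Rightarrow> complex) \<Rightarrow> bool" where
  "compatible n \<xi> \<longleftrightarrow> \<xi> \<in> carrier \<Theta> \<rightarrow>\<^sub>E carrier U \<and> analytic_chi L B \<xi> \<and>
    (\<forall>m\<in>carrier L. \<forall>t\<in>carrier T. \<xi> (pure_tensor L Cadd m 1, 1) t = (-1) powi J m n) \<and>
    (\<forall>s\<in>carrier \<Theta>. \<forall>s'\<in>carrier \<Theta>. \<forall>t\<in>carrier T.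
       \<xi> (s \<otimes>\<^bsub>\<Theta>\<^esub> s') t = \<xi> s (R s' t) * \<xi> s' t)"

lemma compatibleD:
  assumes "compatible n \<xi>"
  shows "s \<in> carrier \<Theta> \<Longrightarrow> \<xi> s \<in> carrier U"
    and "\<epsilon> \<in> {1, -1} \<Longrightarrow> holomorphic_fun_hT L B (\<lambda>x t. \<xi> (x, \<epsilon>) t)"
    and "m \<in> carrier L \<Longrightarrow> t \<in> carrier T \<Longrightarrow> \<xi> (pure_tensor L Cadd m 1, 1) t = (-1) powi J m n"
    and "s \<in> carrier \<Theta> \<Longrightarrow> s' \<in> carrier \<Theta> \<Longrightarrow> t \<in> carrier T \<Longrightarrow>
      \<xi> (s \<otimes>\<^bsub>\<Theta>\<^esub> s') t = \<xi> s (R s' t) * \<xi> s' t"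
    and "s \<in> carrier \<Theta> \<Longrightarrow> t \<in> carrier T \<Longrightarrow> \<xi> s t \<noteq> 0"
proof -
  show U: "s \<in> carrier \<Theta> \<Longrightarrow> \<xi> s \<in> carrier U" for s
    using assms unfolding compatible_def by blast
  show "s \<in> carrier \<Theta> \<Longrightarrow> t \<in> carrier T \<Longrightarrow> \<xi> s t \<noteq> 0"
    by (rule U_nonzero[OF U])
qed (use assms in \<open>unfold compatible_def analytic_chi_def, blast+\<close>)

text \<open>Holomorphy of each single value is a slice of the joint holomorphy in
  \<open>hol\<close>, so nonvanishing is all that membership in the units still asks for.\<close>

lemma compatible_restrictI:
  assumes nz: "\<And>s t. s \<in> carrier \<Theta> \<Longrightarrow> t \<in> carrier T \<Longrightarrow> \<phi> s t \<noteq> 0"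
    and hol: "\<And>\<epsilon>. \<epsilon> \<in> {1, -1} \<Longrightarrow> holomorphic_fun_hT L B (\<lambda>x t. \<phi> (x, \<epsilon>) t)"
    and lat: "\<And>m t. m \<in> carrier L \<Longrightarrow> t \<in> carrier T \<Longrightarrow>
      \<phi> (pure_tensor L Cadd m 1, 1) t = (-1) powi J m n"
    and coc: "\<And>s s' t. s \<in> carrier \<Theta> \<Longrightarrow> s' \<in> carrier \<Theta> \<Longrightarrow> t \<in> carrier T \<Longrightarrow>
      \<phi> (s \<otimes>\<^bsub>\<Theta>\<^esub> s') t = \<phi> s (R s' t) * \<phi> s' t"
  shows "compatible n (\<lambda>s\<in>carrier \<Theta>. \<lambda>t\<in>carrier T. \<phi> s t)"
proof -
  have "(\<lambda>t\<in>carrier T. \<phi> s t) \<in> carrier U" if s: "s \<in> carrier \<Theta>" for s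
  proof -
    obtain x \<epsilon> where "s = (x, \<epsilon>)" "x \<in> carrier H" "\<epsilon> \<in> {1, -1}" using s by auto
    then have "holomorphic_fun_T L B (\<phi> s)" using holomorphic_fun_hT_slice[OF hol] by auto
    then show ?thesis using nz[OF s] by (intro U_I) auto
  qed
  moreover have "analytic_chi L B (\<lambda>s\<in>carrier \<Theta>. \<lambda>t\<in>carrier T. \<phi> s t)"
    unfolding analytic_chi_def
  proof
    fix \<epsilon> :: int assume e: "\<epsilon> \<in> {1, -1}"
    show "holomorphic_fun_hT L B (\<lambda>x t. (\<lambda>s\<in>carrier \<Theta>. \<lambda>t\<in>carrier T. \<phi> s t) (x, \<epsilon>) t)"
      by (rule holomorphic_fun_hT_cong[OF hol[OF e]]) (use e in auto)
  qed
  ultimately show ?thesis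
    unfolding compatible_def
    using lat coc R_closed \<Theta>.m_closed by (auto simp del: Theta_simps(2))
qed

lemma compatible_eqI:
  assumes "compatible n \<xi>" "compatible n' \<sigma>"
    and "\<And>s t. s \<in> carrier \<Theta> \<Longrightarrow> t \<in> carrier T \<Longrightarrow> \<xi> s t = \<sigma> s t"
  shows "\<xi> = \<sigma>"
proof (rule PiE_ext)
  show "\<xi> \<in> carrier \<Theta> \<rightarrow>\<^sub>E carrier U" "\<sigma> \<in> carrier \<Theta> \<rightarrow>\<^sub>E carrier U"
    using assms(1,2) unfolding compatible_def by blast+
  show "\<xi> s = \<sigma> s" if "s \<in> carrier \<Theta>" for s
    using compatibleD(1)[OF assms(1) that] compatibleD(1)[OF assms(2) that] assms(3)[OF that]
    by (rule U_eqI)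
qed

text \<open>The boundary map of \<open>Fun_T\<close> is trivial, so the first centraliser condition
  equates a commutator with the identity. Multiplication in \<open>Aut_T\<close> is that of all
  bijections, and the commutator is evaluated in their group.\<close>

lemma commutator_R_iff:
  assumes s: "s \<in> carrier \<Theta>" and g: "g \<in> carrier A\<^sub>T"
  shows "\<one>\<^bsub>A\<^sub>T\<^esub> = R (inv\<^bsub>\<Theta>\<^esub> s) \<otimes>\<^bsub>A\<^sub>T\<^esub> inv\<^bsub>A\<^sub>T\<^esub> g \<otimes>\<^bsub>A\<^sub>T\<^esub> R s \<otimes>\<^bsub>A\<^sub>T\<^esub> g \<longleftrightarrow>
    (\<forall>t\<in>carrier T. R s (g t) = g (R s t))"
proof -
  have gB: "g \<in> Bij (carrier T)" and RB: "R s \<in> Bij (carrier T)"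
    using Aut_T_Bij[OF g] bij_R[OF s] by auto
  have one: "\<one>\<^bsub>A\<^sub>T\<^esub> = \<one>\<^bsub>Bij_T\<^esub>" by (simp add: Aut_T_simps BijGroup_def)
  have "\<one>\<^bsub>A\<^sub>T\<^esub> = R (inv\<^bsub>\<Theta>\<^esub> s) \<otimes>\<^bsub>A\<^sub>T\<^esub> inv\<^bsub>A\<^sub>T\<^esub> g \<otimes>\<^bsub>A\<^sub>T\<^esub> R s \<otimes>\<^bsub>A\<^sub>T\<^esub> g \<longleftrightarrow>
      R s \<otimes>\<^bsub>Bij_T\<^esub> g = g \<otimes>\<^bsub>Bij_T\<^esub> R s"
    unfolding inv_Aut_T[OF g] R_inv[OF s] Aut_T_simps(2) one
    by (rule BT.commutator_eq_one_iff) (simp_all add: Bij_T_simps gB RB)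
  also have "\<dots> \<longleftrightarrow> compose (carrier T) (R s) g = compose (carrier T) g (R s)"
    by (simp only: Bij_T_simps(2) gB RB)
  also have "\<dots> \<longleftrightarrow> (\<forall>t\<in>carrier T. R s (g t) = g (R s t))"
  proof
    assume eq: "compose (carrier T) (R s) g = compose (carrier T) g (R s)"
    show "\<forall>t\<in>carrier T. R s (g t) = g (R s t)"
    proof
      fix t assume "t \<in> carrier T"
      with fun_cong[OF eq, of t] show "R s (g t) = g (R s t)" by (simp only: compose_eq)
    qed
  next
    assume "\<forall>t\<in>carrier T. R s (g t) = g (R s t)"
    then show "compose (carrier T) (R s) g = compose (carrier T) g (R s)"
      unfolding compose_def by (intro restrict_ext) blast
  qed
  finally show ?thesis .
qed

text \<open>Everything is read off at the unit element: its translates by exponentials fill the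
  torus, and inversion fixes it.\<close>

lemma commuting_imp_trans:
  assumes g: "g \<in> Bij (carrier T)"
    and comm: "\<And>s t. s \<in> carrier \<Theta> \<Longrightarrow> t \<in> carrier T \<Longrightarrow> R s (g t) = g (R s t)"
  obtains n where "n \<in> carrier L" "g = trans n"
proof -
  define c where "c = g \<one>\<^bsub>T\<^esub>"
  have c: "c \<in> carrier T" using Bij_imp_funcset[OF g] by (auto simp: c_def)
  have "inv\<^bsub>T\<^esub> c = c"
    using comm[of "(\<one>\<^bsub>H\<^esub>, -1)" "\<one>\<^bsub>T\<^esub>"] c by (simp add: R_apply c_def)
  then have "c \<otimes>\<^bsub>T\<^esub> c = \<one>\<^bsub>T\<^esub>" using c by (metis T.r_inv)
  with c obtain n where n: "n \<in> carrier L" "c = two_torsion n"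
    by (rule two_torsion_exhaust)
  have "g = trans n"
  proof (rule extensionalityI[of _ "carrier T"])
    fix t assume "t \<in> carrier T"
    then obtain x where x: "x \<in> carrier H" "t = exp_T L x" by (rule exp_T_surj)
    have "g t = t \<otimes>\<^bsub>T\<^esub> c"
      using comm[of "(x, 1)" "\<one>\<^bsub>T\<^esub>"] c x by (simp add: R_apply c_def)
    then show "g t = trans n t" using x c n by (simp add: trans_apply T.m_comm)
  qed (use g in \<open>auto simp: Bij_def trans_def\<close>)
  with n(1) show thesis by (rule that)
qed

text \<open>Characters are eigenfunctions of translations: conjugation multiplies by the value of
  J(m,-) at the translating point, and the inverse of \<open>(m, z)\<close> cancels the
  rest.\<close>

lemma rbas1_conjugate:
  assumes m: "m \<in> carrier L" and z: "z \<noteq> 0" and n: "n \<in> carrier L"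
  shows "rbas1 L J (inv\<^bsub>L \<times>\<times> Cmult\<^esub> (m, z)) \<otimes>\<^bsub>U\<^esub>
    compose (carrier T) (rbas1 L J (m, z)) (trans n) = (\<lambda>t\<in>carrier T. (-1) powi J m n)"
proof -
  have inv: "inv\<^bsub>L \<times>\<times> Cmult\<^esub> (m, z) = (inv m, inverse z)"
    using inv_DirProd[OF is_group Cmult.is_group m] z by simp
  have one: "character L (J (inv m)) t * character L (J m) t = 1" if t: "t \<in> carrier T" for t
  proof -
    have "character L (J \<one>) t = character L (J (inv m)) t * character L (J m) t"
      by (rule character_add) (use m t J_mult_left[of _ "inv m" m] in \<open>auto simp: J_right\<close>)
    moreover have "character L (J \<one>) t = character L (J \<one>) t * character L (J \<one>) t"
      by (rule character_add) (use m t in \<open>auto simp: J_right J_one\<close>)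
    ultimately show ?thesis
      using character_nonzero[OF J_right[of \<one>] t] by simp
  qed
  have "character L (J m) (two_torsion n) = (-1) powi J m n"
    using m n by (simp add: character_pure[OF J_right])
  then show ?thesis
    unfolding inv U_simps(2) using m n z one
    by (intro restrict_ext)
       (simp add: compose_eq trans_apply rbas1_def character_mult[OF J_right] mult_ac)
qed

text \<open>The commutation condition is solved first; once \<open>g\<close> is known to be some
  \<open>trans n\<close>, the lattice condition can be evaluated to a sign.\<close>

lemma centraliser0_iff:
  "(g, \<xi>) \<in> carrier C\<^sub>0 \<longleftrightarrow> (\<exists>n\<in>carrier L. g = trans n \<and> compatible n \<xi>)"
proof -
  let ?P1 = "\<lambda>g. \<forall>s\<in>carrier \<Theta>. \<one>\<^bsub>A\<^sub>T\<^esub> =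
    R (inv\<^bsub>\<Theta>\<^esub> s) \<otimes>\<^bsub>A\<^sub>T\<^esub> inv\<^bsub>A\<^sub>T\<^esub> g \<otimes>\<^bsub>A\<^sub>T\<^esub> R s \<otimes>\<^bsub>A\<^sub>T\<^esub> g"
  let ?P2 = "\<lambda>g. \<forall>a\<in>carrier (L \<times>\<times> Cmult). \<xi> (bnd (Theta L J) a) =
    rbas1 L J (inv\<^bsub>L \<times>\<times> Cmult\<^esub> a) \<otimes>\<^bsub>U\<^esub> compose (carrier T) (rbas1 L J a) g"
  let ?P3 = "\<forall>s\<in>carrier \<Theta>. \<forall>t\<in>carrier \<Theta>. \<xi> (s \<otimes>\<^bsub>\<Theta>\<^esub> t) =
    compose (carrier T) (\<xi> s) (R t) \<otimes>\<^bsub>U\<^esub> \<xi> t"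
  have car: "(g, \<xi>) \<in> carrier C\<^sub>0 \<longleftrightarrow> g \<in> carrier A\<^sub>T \<and> \<xi> \<in> carrier \<Theta> \<rightarrow>\<^sub>E carrier U \<and>
    analytic_chi L B \<xi> \<and> ?P1 g \<and> ?P2 g \<and> ?P3" for g
    unfolding centraliser0_def by (simp only: Theta_Fun_T_simps partial_object.simps mem_Collect_eq case_prod_conv)
  have P1: "?P1 g \<longleftrightarrow> (\<forall>s\<in>carrier \<Theta>. \<forall>t\<in>carrier T. R s (g t) = g (R s t))"
    if "g \<in> carrier A\<^sub>T" for g
    using commutator_R_iff[OF _ that] by blast
  have const_iff: "f = (\<lambda>t\<in>carrier T. h t) \<longleftrightarrow> (\<forall>t\<in>carrier T. f t = h t)" if "f \<in> carrier U" for f h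
    using that by (auto simp: U_simps fun_eq_iff PiE_iff extensional_def)
  have P2: "?P2 (trans n) \<longleftrightarrow>
      (\<forall>m\<in>carrier L. \<forall>t\<in>carrier T. \<xi> (pure_tensor L Cadd m 1, 1) t = (-1) powi J m n)"
    if \<xi>: "\<xi> \<in> carrier \<Theta> \<rightarrow>\<^sub>E carrier U" and n: "n \<in> carrier L" for n
  proof -
    have "\<xi> (bnd (Theta L J) (m, z)) =
        rbas1 L J (inv\<^bsub>L \<times>\<times> Cmult\<^esub> (m, z)) \<otimes>\<^bsub>U\<^esub> compose (carrier T) (rbas1 L J (m, z)) (trans n)
      \<longleftrightarrow> (\<forall>t\<in>carrier T. \<xi> (pure_tensor L Cadd m 1, 1) t = (-1) powi J m n)"
      if "m \<in> carrier L" "z \<noteq> 0" for m z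
      unfolding rbas1_conjugate[OF that n] Theta_Fun_T_simps
      using \<xi> that by (intro const_iff) auto
    \<comment> \<open>The reduced condition for \<open>(m, z)\<close> does not involve
      \<open>z\<close>. The scalar 1 shows that every lattice element occurs in some pair, so the
      condition can be stated for \<open>m\<close> alone.\<close>
    moreover have "(1 :: complex) \<noteq> 0" by simp
    ultimately show ?thesis by (auto simp del: Theta_Fun_T_simps simp: Ball_def)
  qed
  have P3: "?P3 \<longleftrightarrow> (\<forall>s\<in>carrier \<Theta>. \<forall>s'\<in>carrier \<Theta>. \<forall>t\<in>carrier T.
       \<xi> (s \<otimes>\<^bsub>\<Theta>\<^esub> s') t = \<xi> s (R s' t) * \<xi> s' t)"
    if "\<xi> \<in> carrier \<Theta> \<rightarrow>\<^sub>E carrier U"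
  proof (intro ball_cong refl)
    fix s s' assume "s \<in> carrier \<Theta>" "s' \<in> carrier \<Theta>"
    then have "\<xi> (s \<otimes>\<^bsub>\<Theta>\<^esub> s') \<in> carrier U"
      using that by (intro PiE_mem[OF that] \<Theta>.m_closed)
    from const_iff[OF this]
    show "\<xi> (s \<otimes>\<^bsub>\<Theta>\<^esub> s') = compose (carrier T) (\<xi> s) (R s') \<otimes>\<^bsub>U\<^esub> \<xi> s' \<longleftrightarrow>
        (\<forall>t\<in>carrier T. \<xi> (s \<otimes>\<^bsub>\<Theta>\<^esub> s') t = \<xi> s (R s' t) * \<xi> s' t)"
      unfolding U_simps(2) by (simp add: compose_eq)
  qed
  have "g \<in> carrier A\<^sub>T \<and> ?P1 g \<longleftrightarrow> (\<exists>n\<in>carrier L. g = trans n)"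
  proof
    assume "g \<in> carrier A\<^sub>T \<and> ?P1 g"
    then have "g \<in> carrier A\<^sub>T" "\<forall>s\<in>carrier \<Theta>. \<forall>t\<in>carrier T. R s (g t) = g (R s t)"
      using P1[of g] by blast+
    then show "\<exists>n\<in>carrier L. g = trans n"
      using commuting_imp_trans[of g] Aut_T_Bij[of g] by metis
  next
    assume "\<exists>n\<in>carrier L. g = trans n"
    then obtain n where n: "n \<in> carrier L" "g = trans n" by blast
    then have "\<forall>s\<in>carrier \<Theta>. \<forall>t\<in>carrier T. R s (g t) = g (R s t)"
      by (auto simp: trans_apply R_commute simp del: Theta_simps)
    then show "g \<in> carrier A\<^sub>T \<and> ?P1 g"
      using P1[of g] trans_closed[OF n(1)] n(2) by blast
  qed
  then show ?thesis
    unfolding car compatible_def using P2 P3 by blast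
qed

section \<open>The group of pairs\<close>

lemma centraliser0_mult:
  "(trans n, \<xi>) \<otimes>\<^bsub>C\<^sub>0\<^esub> (trans n', \<sigma>) = (trans n \<otimes>\<^bsub>A\<^sub>T\<^esub> trans n',
    \<lambda>s\<in>carrier \<Theta>. \<lambda>t\<in>carrier T. \<sigma> s t * \<xi> s (two_torsion n' \<otimes>\<^bsub>T\<^esub> t))"
  by (auto simp: centraliser0_def U_simps(2) compose_eq trans_apply simp del: Theta_simps
      intro!: restrict_ext)

lemma centraliser0_one: "\<one>\<^bsub>C\<^sub>0\<^esub> = (trans \<one>, \<lambda>s\<in>carrier \<Theta>. \<lambda>t\<in>carrier T. 1)"
  by (simp add: centraliser0_def U_simps(3) trans_one)

lemma compatible_mult:
  assumes "compatible n \<xi>" "compatible n' \<sigma>" "n \<in> carrier L" "n' \<in> carrier L"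
  shows "compatible (n \<otimes> n')
    (\<lambda>s\<in>carrier \<Theta>. \<lambda>t\<in>carrier T. \<sigma> s t * \<xi> s (two_torsion n' \<otimes>\<^bsub>T\<^esub> t))"
proof (rule compatible_restrictI)
  show "\<sigma> s t * \<xi> s (two_torsion n' \<otimes>\<^bsub>T\<^esub> t) \<noteq> 0" if "s \<in> carrier \<Theta>" "t \<in> carrier T" for s t
    using compatibleD(5)[OF assms(1), of s "two_torsion n' \<otimes>\<^bsub>T\<^esub> t"]
      compatibleD(5)[OF assms(2) that] that assms(4) by simp
  show "holomorphic_fun_hT L B (\<lambda>x t. \<sigma> (x, \<epsilon>) t * \<xi> (x, \<epsilon>) (two_torsion n' \<otimes>\<^bsub>T\<^esub> t))"
    if "\<epsilon> \<in> {1, -1}" for \<epsilon>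
    using assms(4) that
    by (intro holomorphic_fun_hT_mult holomorphic_fun_hT_translate[of "\<lambda>x t. \<xi> (x, \<epsilon>) t"]
        compatibleD(2)[OF assms(1)] compatibleD(2)[OF assms(2)]) auto
  show "\<sigma> (pure_tensor L Cadd m 1, 1) t * \<xi> (pure_tensor L Cadd m 1, 1) (two_torsion n' \<otimes>\<^bsub>T\<^esub> t)
      = (-1) powi J m (n \<otimes> n')" if "m \<in> carrier L" "t \<in> carrier T" for m t
    using that assms(3,4) compatibleD(3)[OF assms(1)] compatibleD(3)[OF assms(2)]
    by (simp add: J_mult_right power_int_add mult.commute)
  show "\<sigma> (s \<otimes>\<^bsub>\<Theta>\<^esub> s') t * \<xi> (s \<otimes>\<^bsub>\<Theta>\<^esub> s') (two_torsion n' \<otimes>\<^bsub>T\<^esub> t) =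
      (\<sigma> s (R s' t) * \<xi> s (two_torsion n' \<otimes>\<^bsub>T\<^esub> R s' t)) * (\<sigma> s' t * \<xi> s' (two_torsion n' \<otimes>\<^bsub>T\<^esub> t))"
    if "s \<in> carrier \<Theta>" "s' \<in> carrier \<Theta>" "t \<in> carrier T" for s s' t
    using compatibleD(4)[OF assms(1) that(1,2), of "two_torsion n' \<otimes>\<^bsub>T\<^esub> t"]
      compatibleD(4)[OF assms(2) that] R_commute[OF assms(4) that(2,3)] that assms(4)
    by (simp del: Theta_simps)
qed

text \<open>The second component of the inverse of \<open>(trans n, \<xi>)\<close>. The same
  \<open>n\<close> serves because the translation is an involution and signs are their own
  inverses.\<close>

lemma compatible_inverse:
  assumes "compatible n \<xi>" "n \<in> carrier L"
  shows "compatible n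
    (\<lambda>s\<in>carrier \<Theta>. \<lambda>t\<in>carrier T. inverse (\<xi> s (two_torsion n \<otimes>\<^bsub>T\<^esub> t)))"
proof (rule compatible_restrictI)
  note nz = compatibleD(5)[OF assms(1)]
  show "inverse (\<xi> s (two_torsion n \<otimes>\<^bsub>T\<^esub> t)) \<noteq> 0" if "s \<in> carrier \<Theta>" "t \<in> carrier T" for s t
    using nz[of s "two_torsion n \<otimes>\<^bsub>T\<^esub> t"] that assms(2) by simp
  show "holomorphic_fun_hT L B (\<lambda>x t. inverse (\<xi> (x, \<epsilon>) (two_torsion n \<otimes>\<^bsub>T\<^esub> t)))"
    if "\<epsilon> \<in> {1, -1}" for \<epsilon>
    using assms(2) that nz
    by (intro holomorphic_fun_hT_inverse holomorphic_fun_hT_translate[of "\<lambda>x t. \<xi> (x, \<epsilon>) t"]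
        compatibleD(2)[OF assms(1)]) auto
  show "inverse (\<xi> (pure_tensor L Cadd m 1, 1) (two_torsion n \<otimes>\<^bsub>T\<^esub> t)) = (-1) powi J m n"
    if "m \<in> carrier L" "t \<in> carrier T" for m t
    using that assms(2) compatibleD(3)[OF assms(1)]
    by (simp add: power_int_minus[symmetric] power_int_minus_one_minus)
  show "inverse (\<xi> (s \<otimes>\<^bsub>\<Theta>\<^esub> s') (two_torsion n \<otimes>\<^bsub>T\<^esub> t)) =
      inverse (\<xi> s (two_torsion n \<otimes>\<^bsub>T\<^esub> R s' t)) * inverse (\<xi> s' (two_torsion n \<otimes>\<^bsub>T\<^esub> t))"
    if "s \<in> carrier \<Theta>" "s' \<in> carrier \<Theta>" "t \<in> carrier T" for s s' t
    using compatibleD(4)[OF assms(1) that(1,2), of "two_torsion n \<otimes>\<^bsub>T\<^esub> t"]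
      R_commute[OF assms(2) that(2,3)] that assms(2)
    by (simp del: Theta_simps)
qed

lemma compatible_one: "compatible \<one> (\<lambda>s\<in>carrier \<Theta>. \<lambda>t\<in>carrier T. 1)"
  by (rule compatible_restrictI) (auto simp: J_one intro: holomorphic_fun_hT_const)

lemma centraliser0_cases:
  assumes "p \<in> carrier C\<^sub>0"
  obtains n \<xi> where "p = (trans n, \<xi>)" "n \<in> carrier L" "compatible n \<xi>"
proof -
  obtain g \<xi> where p: "p = (g, \<xi>)" by (cases p)
  from assms[unfolded p centraliser0_iff] obtain n where "n \<in> carrier L" "g = trans n" "compatible n \<xi>"
    by (elim bexE conjE)
  with p show thesis by (intro that) simp_all
qed

lemma centraliser0_closed: "n \<in> carrier L \<Longrightarrow> compatible n \<xi> \<Longrightarrow> (trans n, \<xi>) \<in> carrier C\<^sub>0"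
  unfolding centraliser0_iff by (intro bexI[of _ n] conjI refl)

lemma group_centraliser0: "group C\<^sub>0"
proof (rule groupI)
  show "\<one>\<^bsub>C\<^sub>0\<^esub> \<in> carrier C\<^sub>0"
    unfolding centraliser0_one by (intro centraliser0_closed compatible_one) simp
next
  fix p q assume "p \<in> carrier C\<^sub>0" "q \<in> carrier C\<^sub>0"
  then obtain n \<xi> n' \<sigma> where p: "p = (trans n, \<xi>)" "n \<in> carrier L" "compatible n \<xi>"
    and q: "q = (trans n', \<sigma>)" "n' \<in> carrier L" "compatible n' \<sigma>"
    by (metis centraliser0_cases)
  show "p \<otimes>\<^bsub>C\<^sub>0\<^esub> q \<in> carrier C\<^sub>0"
    unfolding p(1) q(1) centraliser0_mult trans_mult[OF p(2) q(2)]
    by (intro centraliser0_closed compatible_mult) (simp_all add: p q)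
next
  fix p q r assume "p \<in> carrier C\<^sub>0" "q \<in> carrier C\<^sub>0" "r \<in> carrier C\<^sub>0"
  then obtain n \<xi> n' \<sigma> n'' \<rho> where p: "p = (trans n, \<xi>)" "n \<in> carrier L" "compatible n \<xi>"
    and q: "q = (trans n', \<sigma>)" "n' \<in> carrier L" "compatible n' \<sigma>"
    and r: "r = (trans n'', \<rho>)" "n'' \<in> carrier L" "compatible n'' \<rho>"
    by (metis centraliser0_cases)
  show "p \<otimes>\<^bsub>C\<^sub>0\<^esub> q \<otimes>\<^bsub>C\<^sub>0\<^esub> r = p \<otimes>\<^bsub>C\<^sub>0\<^esub> (q \<otimes>\<^bsub>C\<^sub>0\<^esub> r)"
    using p(2) q(2) r(2)
    by (auto simp: p(1) q(1) r(1) centraliser0_mult trans_mult m_assoc two_torsion_mult T.m_assoc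
        mult_ac simp del: Theta_simps intro!: restrict_ext)
next
  fix p assume p: "p \<in> carrier C\<^sub>0"
  obtain n \<xi> where n: "p = (trans n, \<xi>)" "n \<in> carrier L" "compatible n \<xi>"
    using p by (rule centraliser0_cases)
  show "\<one>\<^bsub>C\<^sub>0\<^esub> \<otimes>\<^bsub>C\<^sub>0\<^esub> p = p"
  proof -
    have "(\<lambda>s\<in>carrier \<Theta>. \<lambda>t\<in>carrier T. \<xi> s t * (\<lambda>s\<in>carrier \<Theta>. \<lambda>t\<in>carrier T. 1) s
        (two_torsion n \<otimes>\<^bsub>T\<^esub> t)) = \<xi>"
      using compatible_mult[OF compatible_one n(3) one_closed n(2)] n(3)
      by (rule compatible_eqI) (use n(2) in \<open>simp del: Theta_simps\<close>)
    then show ?thesis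
      unfolding n(1) centraliser0_one centraliser0_mult using n(2) by (simp add: trans_mult)
  qed
  show "\<exists>q\<in>carrier C\<^sub>0. q \<otimes>\<^bsub>C\<^sub>0\<^esub> p = \<one>\<^bsub>C\<^sub>0\<^esub>"
  proof (rule bexI)
    let ?\<xi>' = "\<lambda>s\<in>carrier \<Theta>. \<lambda>t\<in>carrier T. inverse (\<xi> s (two_torsion n \<otimes>\<^bsub>T\<^esub> t))"
    show "(trans n, ?\<xi>') \<in> carrier C\<^sub>0"
      by (intro centraliser0_closed compatible_inverse n)
    have "trans (n \<otimes> n) = trans \<one>"
      using n(2) two_torsion_eq_one_iff[of "n \<otimes> n"] trans_eq_one_iff[of "n \<otimes> n"]
      by (auto simp: trans_one)
    moreover have "\<xi> s t * inverse (\<xi> s (two_torsion n \<otimes>\<^bsub>T\<^esub> (two_torsion n \<otimes>\<^bsub>T\<^esub> t))) = 1"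
      if "s \<in> carrier \<Theta>" "t \<in> carrier T" for s t
      using that n(2) compatibleD(5)[OF n(3) that]
      by (simp add: T.m_assoc[symmetric] two_torsion_square)
    ultimately show "(trans n, ?\<xi>') \<otimes>\<^bsub>C\<^sub>0\<^esub> p = \<one>\<^bsub>C\<^sub>0\<^esub>"
      unfolding n(1) centraliser0_one centraliser0_mult trans_mult[OF n(2,2)]
      using n(2) by (auto intro!: restrict_ext simp del: Theta_simps)
  qed
qed

sublocale C\<^sub>0: group C\<^sub>0 by (rule group_centraliser0)

text \<open>Second component of the boundary map of the centraliser; in cohomological terms, the
  principal cocycle attached to a unit.\<close>

definition coboundary :: "('l ctensor \<Rightarrow> complex) \<Rightarrow> 'l ctensor \<times> int \<Rightarrow> 'l ctensor \<Rightarrow> complex" where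
  "coboundary f = (\<lambda>s\<in>carrier \<Theta>. \<lambda>t\<in>carrier T. inverse (f (R s t)) * f t)"

lemma coboundary_apply:
  "s \<in> carrier \<Theta> \<Longrightarrow> t \<in> carrier T \<Longrightarrow> coboundary f s t = inverse (f (R s t)) * f t"
  by (simp add: coboundary_def)

text \<open>Lattice elements act trivially on the torus, which gives the sign belonging to the
  neutral element, and the cocycle identity telescopes.\<close>

lemma compatible_coboundary:
  assumes "f \<in> carrier U"
  shows "compatible \<one> (coboundary f)"
  unfolding coboundary_def
proof (rule compatible_restrictI)
  note nz = U_nonzero[OF assms]
  show "inverse (f (R s t)) * f t \<noteq> 0" if "s \<in> carrier \<Theta>" "t \<in> carrier T" for s t
    using nz[OF that(2)] nz[OF R_closed[OF that]] by simp
  show "holomorphic_fun_hT L B (\<lambda>x t. inverse (f (R (x, \<epsilon>) t)) * f t)" if e: "\<epsilon> \<in> {1, -1}" for \<epsilon>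
  proof (intro holomorphic_fun_hT_mult holomorphic_fun_hT_inverse holomorphic_fun_hT_snd)
    show "holomorphic_fun_hT L B (\<lambda>x t. f (R (x, \<epsilon>) t))"
    proof (rule holomorphic_fun_hT_cong)
      show "holomorphic_fun_hT L B (\<lambda>x t. f (exp_T L x \<otimes>\<^bsub>T\<^esub> t [^]\<^bsub>T\<^esub> \<epsilon>))"
        using assms e by (intro holomorphic_fun_hT_action) (simp_all add: U_simps)
    qed (simp add: R_apply)
    show "f (R (x, \<epsilon>) t) \<noteq> 0" if "x \<in> carrier H" "t \<in> carrier T" for x t
      using that e by (intro nz R_closed) auto
  qed (use assms in \<open>simp add: U_simps\<close>)
  show "inverse (f (R (pure_tensor L Cadd m 1, 1) t)) * f t = (-1) powi J m \<one>"
    if "m \<in> carrier L" "t \<in> carrier T" for m t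
    using that nz by (simp add: R_lattice J_one)
  show "inverse (f (R (s \<otimes>\<^bsub>\<Theta>\<^esub> s') t)) * f t =
      (inverse (f (R s (R s' t))) * f (R s' t)) * (inverse (f (R s' t)) * f t)"
    if "s \<in> carrier \<Theta>" "s' \<in> carrier \<Theta>" "t \<in> carrier T" for s s' t
    using that nz[OF R_closed[OF that(2,3)]] by (simp add: R_mult del: Theta_simps)
qed

section \<open>The centraliser as a crossed module\<close>

abbreviation "C \<equiv> C_rbas L B J"

lemma C_simps:
  "Top C = U" "Base C = C\<^sub>0" "act C f (g, \<xi>) = compose (carrier T) f g"
  by (simp_all add: C_rbas_def centraliser_def)

lemma bnd_C: "f \<in> carrier U \<Longrightarrow> bnd C f = (trans \<one>, coboundary f)"
  unfolding C_rbas_def centraliser_def coboundary_def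
  by (auto simp: trans_one inv_U U_R U_simps(2) compose_eq simp del: Theta_simps intro!: restrict_ext)

lemma crossed_module_C: "crossed_module C"
proof -
  have bnd: "bnd C f \<in> carrier C\<^sub>0" if "f \<in> carrier U" for f
    unfolding bnd_C[OF that] by (intro centraliser0_closed compatible_coboundary that) simp
  have act: "compose (carrier T) f (trans n) \<in> carrier U" if "f \<in> carrier U" "n \<in> carrier L" for f n
    by (rule U_trans[OF that])
  \<comment> \<open>Equivariance multiplied by the acting pair, so that no inverse of a pair has to
    be computed. It rests on \<open>R_commute\<close>.\<close>
  have equi: "(trans n, \<xi>) \<otimes>\<^bsub>C\<^sub>0\<^esub> bnd C (compose (carrier T) f (trans n)) =
      bnd C f \<otimes>\<^bsub>C\<^sub>0\<^esub> (trans n, \<xi>)" if f: "f \<in> carrier U" and n: "n \<in> carrier L" for f n \<xi>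
    unfolding bnd_C[OF f] bnd_C[OF act[OF f n]] centraliser0_mult
    using f n R_commute[OF n]
    by (auto simp: trans_mult coboundary_apply compose_eq trans_apply two_torsion_one mult_ac
        simp del: Theta_simps intro!: restrict_ext)
  show ?thesis
    unfolding crossed_module_def C_simps
  proof (intro conjI ballI)
    show "group U" "group C\<^sub>0" by (rule U.is_group C\<^sub>0.is_group)+
    show "bnd C \<in> hom U C\<^sub>0"
    proof (rule homI)
      fix f g assume f: "f \<in> carrier U" and g: "g \<in> carrier U"
      show "bnd C (f \<otimes>\<^bsub>U\<^esub> g) = bnd C f \<otimes>\<^bsub>C\<^sub>0\<^esub> bnd C g"
        unfolding bnd_C[OF f] bnd_C[OF g] bnd_C[OF U.m_closed[OF f g]] centraliser0_mult
        unfolding coboundary_def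
        by (auto simp: trans_mult two_torsion_one U_simps(2) mult_ac
            simp del: Theta_simps intro!: restrict_ext)
    qed (rule bnd)
    fix p assume "p \<in> carrier C\<^sub>0"
    then obtain n \<xi> where p: "p = (trans n, \<xi>)" "n \<in> carrier L" "compatible n \<xi>"
      by (rule centraliser0_cases)
    show "(\<lambda>a. act C a p) \<in> hom U U"
      unfolding p(1) C_simps using p(2) act
      by (intro homI) (auto simp: U_simps(2) compose_def trans_apply intro!: restrict_ext)
  next
    fix f assume f: "f \<in> carrier U"
    show "act C f \<one>\<^bsub>C\<^sub>0\<^esub> = f"
      unfolding centraliser0_one C_simps using f
      by (intro U_eqI[OF act]) (auto simp: compose_eq trans_apply two_torsion_one)
  next
    fix f p q assume f: "f \<in> carrier U" and "p \<in> carrier C\<^sub>0" "q \<in> carrier C\<^sub>0"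
    then obtain n \<xi> n' \<sigma> where p: "p = (trans n, \<xi>)" "n \<in> carrier L" "compatible n \<xi>"
      and q: "q = (trans n', \<sigma>)" "n' \<in> carrier L" "compatible n' \<sigma>"
      by (metis centraliser0_cases)
    show "act C f (p \<otimes>\<^bsub>C\<^sub>0\<^esub> q) = act C (act C f p) q"
      unfolding p(1) q(1) centraliser0_mult C_simps trans_mult[OF p(2) q(2)]
      using p(2) q(2)
      by (auto simp: compose_def trans_apply two_torsion_mult T.m_assoc intro!: restrict_ext)
  next
    fix f p assume f: "f \<in> carrier U" and p: "p \<in> carrier C\<^sub>0"
    obtain n \<xi> where n: "p = (trans n, \<xi>)" "n \<in> carrier L" "compatible n \<xi>"
      using p by (rule centraliser0_cases)
    have "p \<otimes>\<^bsub>C\<^sub>0\<^esub> bnd C (act C f p) = bnd C f \<otimes>\<^bsub>C\<^sub>0\<^esub> p"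
      using equi[OF f n(2)] unfolding n(1) C_simps .
    moreover have "bnd C (act C f p) \<in> carrier C\<^sub>0"
      unfolding n(1) C_simps by (rule bnd[OF act[OF f n(2)]])
    ultimately show "bnd C (act C f p) = inv\<^bsub>C\<^sub>0\<^esub> p \<otimes>\<^bsub>C\<^sub>0\<^esub> bnd C f \<otimes>\<^bsub>C\<^sub>0\<^esub> p"
      using bnd[OF f] p C\<^sub>0.inv_solve_left[of "bnd C (act C f p)" p "bnd C f \<otimes>\<^bsub>C\<^sub>0\<^esub> p"]
      by (simp add: C\<^sub>0.m_assoc)
  next
    fix f g assume f: "f \<in> carrier U" and g: "g \<in> carrier U"
    \<comment> \<open>A boundary has trivial translation part and so acts trivially; conjugation is
      trivial as well because the units commute.\<close>
    have "act C g (bnd C f) = g"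
      unfolding bnd_C[OF f] C_simps using g
      by (intro U_eqI[OF act]) (auto simp: compose_eq trans_apply two_torsion_one)
    also have "g = inv\<^bsub>U\<^esub> f \<otimes>\<^bsub>U\<^esub> g \<otimes>\<^bsub>U\<^esub> f"
      using f g by (simp add: U.m_comm[of "inv\<^bsub>U\<^esub> f" g] U.m_assoc)
    finally show "act C g (bnd C f) = inv\<^bsub>U\<^esub> f \<otimes>\<^bsub>U\<^esub> g \<otimes>\<^bsub>U\<^esub> f" .
  qed
qed


section \<open>The equivalence\<close>

abbreviation "E \<equiv> E_xmod L J"
abbreviation "E\<^sub>0 \<equiv> central_ext L J"

lemma E_simps:
  "Top E = L \<times>\<times> Cmult" "Base E = E\<^sub>0" "bnd E (m, z) = (m [^] (2::int), 0)"
  "act E (m, z) (n, \<iota>) = (m, (-1) powi J n m * z)"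
  by (simp_all add: E_xmod_def)

lemma E0_simps [simp]:
  "carrier E\<^sub>0 = carrier L \<times> {0, 1}"
  "(n, \<iota>) \<otimes>\<^bsub>E\<^sub>0\<^esub> (n', \<iota>') = (n \<otimes> n', (\<iota> + \<iota>' + J n' n) mod 2)"
  "\<one>\<^bsub>E\<^sub>0\<^esub> = (\<one>, 0)"
  by (auto simp: central_ext_def)

lemma square: "m \<in> carrier L \<Longrightarrow> m [^] (2::int) = m \<otimes> m"
  using int_pow_mult[of m 1 1] by simp

lemma mod_2_cases: "(k :: int) mod 2 = 0 \<or> k mod 2 = 1"
  by presburger

text \<open>Shaped after the two sides of associativity in \<open>central_ext\<close>, once the
  values of \<open>J\<close> on products are expanded by bilinearity.\<close>

lemma mod_2_assoc:
  "((a + b + c) mod 2 + d + (e + f)) mod 2 = (a + (b + d + f) mod 2 + (c + e)) mod 2" for a :: int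
proof -
  have "((a + b + c) mod 2 + d + (e + f)) mod 2 = (a + b + c + (d + (e + f))) mod 2"
    by (simp only: add.assoc mod_add_left_eq)
  also have "\<dots> = (b + d + f + (a + (c + e))) mod 2"
    by (simp only: ac_simps)
  also have "\<dots> = ((b + d + f) mod 2 + (a + (c + e))) mod 2"
    by (simp only: mod_add_left_eq)
  also have "\<dots> = (a + (b + d + f) mod 2 + (c + e)) mod 2"
    by (simp only: ac_simps)
  finally show ?thesis .
qed

lemma group_E0: "group E\<^sub>0"
proof (rule groupI)
  fix p q assume "p \<in> carrier E\<^sub>0" "q \<in> carrier E\<^sub>0"
  then show "p \<otimes>\<^bsub>E\<^sub>0\<^esub> q \<in> carrier E\<^sub>0"
    using mod_2_cases by (cases p; cases q) auto
next
  fix p q r assume "p \<in> carrier E\<^sub>0" "q \<in> carrier E\<^sub>0" "r \<in> carrier E\<^sub>0"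
  then obtain n \<iota> n' \<iota>' n'' \<iota>'' where "p = (n, \<iota>)" "q = (n', \<iota>')" "r = (n'', \<iota>'')"
    "n \<in> carrier L" "n' \<in> carrier L" "n'' \<in> carrier L" by auto
  then show "p \<otimes>\<^bsub>E\<^sub>0\<^esub> q \<otimes>\<^bsub>E\<^sub>0\<^esub> r = p \<otimes>\<^bsub>E\<^sub>0\<^esub> (q \<otimes>\<^bsub>E\<^sub>0\<^esub> r)"
    by (simp add: m_assoc J_mult_left J_mult_right mod_2_assoc)
next
  fix p assume p: "p \<in> carrier E\<^sub>0"
  then obtain n \<iota> where n: "p = (n, \<iota>)" "n \<in> carrier L" "\<iota> = 0 \<or> \<iota> = 1" by auto
  then show "\<one>\<^bsub>E\<^sub>0\<^esub> \<otimes>\<^bsub>E\<^sub>0\<^esub> p = p" by (auto simp: J_one)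
  \<comment> \<open>The inverse needs the correction \<open>J n n\<close> because the extension
    cocycle at the pair of \<open>inv n\<close> and \<open>n\<close> is \<open>J n (inv n)\<close>,
    the negative of \<open>J n n\<close>.\<close>
  have "((J n n - \<iota>) mod 2 + \<iota> + J n (inv n)) mod 2 = 0"
    using n(2) by (simp add: J_inv_right add.assoc mod_add_left_eq del: add_uminus_conv_diff)
  then show "\<exists>q\<in>carrier E\<^sub>0. q \<otimes>\<^bsub>E\<^sub>0\<^esub> p = \<one>\<^bsub>E\<^sub>0\<^esub>"
    using n mod_2_cases[of "J n n - \<iota>"]
    by (intro bexI[of _ "(inv n, (J n n - \<iota>) mod 2)"]) auto
qed auto

lemma crossed_module_E: "crossed_module E"
proof -
  interpret E0: group E\<^sub>0 by (rule group_E0)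
  interpret P: group "L \<times>\<times> Cmult" by (rule DirProd_group[OF is_group Cmult.is_group])
  have sq_closed: "m [^] (2::int) \<in> carrier L" if "m \<in> carrier L" for m using that by simp
  \<comment> \<open>Values of \<open>J\<close> on doubled elements are even, so the image of the
    boundary map is central and acts trivially. With a commutative top group and an action fixing
    the lattice component, both crossed module identities follow.\<close>
  have even_left: "J (m [^] (2::int)) n mod 2 = 0" "J n (m [^] (2::int)) mod 2 = 0"
    if "m \<in> carrier L" "n \<in> carrier L" for m n
    using that by (simp_all add: square J_mult_left J_mult_right)
  have one_powi: "(-1 :: complex) powi J (m [^] (2::int)) n = 1" if "m \<in> carrier L" "n \<in> carrier L" for m n
    using minus_one_powi_mod[of "J (m [^] (2::int)) n"] even_left(1)[OF that] by simp
  show ?thesis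
    unfolding crossed_module_def E_simps
  proof (intro conjI ballI)
    show "group (L \<times>\<times> Cmult)" "group E\<^sub>0" by (rule P.is_group E0.is_group)+
    show "bnd E \<in> hom (L \<times>\<times> Cmult) E\<^sub>0"
    proof (rule homI)
      fix a b assume "a \<in> carrier (L \<times>\<times> Cmult)" "b \<in> carrier (L \<times>\<times> Cmult)"
      then obtain m z n w where "a = (m, z)" "b = (n, w)" "m \<in> carrier L" "n \<in> carrier L"
        by auto
      then show "bnd E (a \<otimes>\<^bsub>L \<times>\<times> Cmult\<^esub> b) = bnd E a \<otimes>\<^bsub>E\<^sub>0\<^esub> bnd E b"
        using even_left(1)[of n "m [^] (2::int)"] by (simp add: E_simps int_pow_distrib)
    qed (auto simp: E_simps)
  next
    fix p assume "p \<in> carrier E\<^sub>0"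
    then obtain n \<iota> where n: "p = (n, \<iota>)" "n \<in> carrier L" by auto
    show "(\<lambda>a. act E a p) \<in> hom (L \<times>\<times> Cmult) (L \<times>\<times> Cmult)"
      unfolding n(1) using n(2)
      by (intro homI) (auto simp: E_simps J_mult_right power_int_add)
  next
    fix a assume "a \<in> carrier (L \<times>\<times> Cmult)"
    then show "act E a \<one>\<^bsub>E\<^sub>0\<^esub> = a" by (auto simp: E_simps J_one)
  next
    fix a p q assume "a \<in> carrier (L \<times>\<times> Cmult)" "p \<in> carrier E\<^sub>0" "q \<in> carrier E\<^sub>0"
    then show "act E a (p \<otimes>\<^bsub>E\<^sub>0\<^esub> q) = act E (act E a p) q"
      by (auto simp: E_simps J_mult_left power_int_add)
  next
    fix a p assume a: "a \<in> carrier (L \<times>\<times> Cmult)" and p: "p \<in> carrier E\<^sub>0"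
    obtain m z where m: "a = (m, z)" "m \<in> carrier L" using a by auto
    obtain n \<iota> where n: "p = (n, \<iota>)" "n \<in> carrier L" "\<iota> = 0 \<or> \<iota> = 1" using p by auto
    have bnd: "bnd E a \<in> carrier E\<^sub>0" "bnd E (act E a p) = bnd E a"
      using m n by (simp_all add: E_simps)
    have "p \<otimes>\<^bsub>E\<^sub>0\<^esub> bnd E a = bnd E a \<otimes>\<^bsub>E\<^sub>0\<^esub> p"
      using m n even_left[OF m(2) n(2)]
      by (auto simp: E_simps m_comm mod_add_right_eq[of _ "J _ _", symmetric])
    then show "bnd E (act E a p) = inv\<^bsub>E\<^sub>0\<^esub> p \<otimes>\<^bsub>E\<^sub>0\<^esub> bnd E a \<otimes>\<^bsub>E\<^sub>0\<^esub> p"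
      using p bnd E0.inv_solve_left[of "bnd E a" p "bnd E a \<otimes>\<^bsub>E\<^sub>0\<^esub> p"]
      by (simp add: E0.m_assoc del: E0_simps)
  next
    fix a b assume a: "a \<in> carrier (L \<times>\<times> Cmult)" and b: "b \<in> carrier (L \<times>\<times> Cmult)"
    then have "act E b (bnd E a) = b" using one_powi by (auto simp: E_simps)
    moreover have "inv\<^bsub>L \<times>\<times> Cmult\<^esub> a \<otimes>\<^bsub>L \<times>\<times> Cmult\<^esub> b \<otimes>\<^bsub>L \<times>\<times> Cmult\<^esub> a = b"
    proof -
      have "b \<otimes>\<^bsub>L \<times>\<times> Cmult\<^esub> a = a \<otimes>\<^bsub>L \<times>\<times> Cmult\<^esub> b"
        using a b by (auto simp: m_comm mult_ac)
      then show ?thesis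
        using a b P.inv_solve_left[of b a "b \<otimes>\<^bsub>L \<times>\<times> Cmult\<^esub> a"]
        by (simp add: P.m_assoc del: carrier_DirProd)
    qed
    ultimately show "act E b (bnd E a) = inv\<^bsub>L \<times>\<times> Cmult\<^esub> a \<otimes>\<^bsub>L \<times>\<times> Cmult\<^esub> b \<otimes>\<^bsub>L \<times>\<times> Cmult\<^esub> a"
      by simp
  qed
qed

section \<open>Standard cocycles and the homomorphism from \<open>E\<close>\<close>

definition basic_cocycle :: "'l \<Rightarrow> int \<Rightarrow> 'l ctensor \<times> int \<Rightarrow> 'l ctensor \<Rightarrow> complex" where
  "basic_cocycle n \<iota> = (\<lambda>s\<in>carrier \<Theta>. \<lambda>t\<in>carrier T.
     eJ n (fst s) * (if snd s = 1 then 1 else (-1) powi \<iota> * inverse (cJ n t)))"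

lemma basic_cocycle_apply:
  "s \<in> carrier \<Theta> \<Longrightarrow> t \<in> carrier T \<Longrightarrow> basic_cocycle n \<iota> s t =
     eJ n (fst s) * (if snd s = 1 then 1 else (-1) powi \<iota> * inverse (cJ n t))"
  by (simp add: basic_cocycle_def)

lemma compatible_basic_cocycle:
  assumes n: "n \<in> carrier L"
  shows "compatible n (basic_cocycle n \<iota>)"
  unfolding basic_cocycle_def
proof (rule compatible_restrictI)
  let ?\<phi> = "\<lambda>s t. eJ n (fst s) * (if snd s = 1 then 1 else (-1) powi \<iota> * inverse (cJ n t))"
  show "?\<phi> s t \<noteq> 0" if "t \<in> carrier T" for s t
    using cJ_nonzero[OF n that] by simp
  have e: "holomorphic_fun_hT L B (\<lambda>x t. eJ n x)"
    unfolding eJ_def by (rule holomorphic_fun_hT_exp[OF J_left[OF n]])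
  have c: "holomorphic_fun_hT L B (\<lambda>x t. inverse (cJ n t))"
    unfolding cJ_def using character_nonzero[OF J_left[OF n]]
    by (intro holomorphic_fun_hT_inverse holomorphic_fun_hT_snd holomorphic_fun_T_character J_left n)
  show "holomorphic_fun_hT L B (\<lambda>x t. ?\<phi> (x, \<epsilon>) t)" if "\<epsilon> \<in> {1, -1}" for \<epsilon>
  proof (cases "\<epsilon> = 1")
    case False
    then show ?thesis
      using holomorphic_fun_hT_mult[OF e holomorphic_fun_hT_mult[OF holomorphic_fun_hT_const c]]
      by simp
  qed (simp add: e)
  show "?\<phi> (pure_tensor L Cadd m 1, 1) t = (-1) powi J m n" if "m \<in> carrier L" for m t
    using that n by (simp add: eJ_lattice)
  show "?\<phi> (s \<otimes>\<^bsub>\<Theta>\<^esub> s') t = ?\<phi> s (R s' t) * ?\<phi> s' t"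
    if st: "s \<in> carrier \<Theta>" "s' \<in> carrier \<Theta>" "t \<in> carrier T" for s s' t
  proof -
    obtain x \<epsilon> where s: "s = (x, \<epsilon>)" "x \<in> carrier H" "\<epsilon> = 1 \<or> \<epsilon> = -1" using st(1) by auto
    obtain y \<delta> where s': "s' = (y, \<delta>)" "y \<in> carrier H" "\<delta> = 1 \<or> \<delta> = -1" using st(2) by auto
    \<comment> \<open>The cases with \<open>\<epsilon>\<close> equal to -1 carry the content: moving
      the argument by the exponential of \<open>y\<close> contributes the inverse square of
      \<open>eJ n y\<close> through the character, turning the factor \<open>eJ n y\<close> into the
      inverse demanded by the twisted product.\<close>
    show ?thesis
      using s(3) s'(3) s(2) s'(2) st(3) n cJ_nonzero[OF n st(3)]
      by (auto simp: s(1) s'(1) R_apply eJ_mult eJ_inv cJ_mult cJ_exp cJ_inv field_simps)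
  qed
qed

text \<open>The inverse compensates for the one in \<open>coboundary\<close>: the coboundary of the
  inverse of \<open>cJ m\<close> at \<open>(x, 1)\<close> is \<open>cJ m (exp_T L x)\<close>, the
  square of \<open>eJ m x\<close>, hence the standard cocycle of the doubled element.\<close>

definition F\<^sub>1 :: "'l \<times> complex \<Rightarrow> 'l ctensor \<Rightarrow> complex" where
  "F\<^sub>1 = (\<lambda>(m, z). \<lambda>t\<in>carrier T. z * inverse (cJ m t))"

definition F\<^sub>0 :: "'l \<times> int \<Rightarrow> ('l ctensor \<Rightarrow> 'l ctensor) \<times> ('l ctensor \<times> int \<Rightarrow> 'l ctensor \<Rightarrow> complex)" where
  "F\<^sub>0 = (\<lambda>(n, \<iota>). (trans n, basic_cocycle n \<iota>))"

lemma F1_closed: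
  assumes "m \<in> carrier L" "z \<noteq> 0"
  shows "F\<^sub>1 (m, z) \<in> carrier U"
  unfolding F\<^sub>1_def case_prod_conv
proof (rule U_I)
  show "holomorphic_fun_T L B (\<lambda>t. z * inverse (cJ m t))"
    unfolding cJ_def using character_nonzero[OF J_left[OF assms(1)]]
    by (intro holomorphic_fun_T_mult holomorphic_fun_T_const holomorphic_fun_T_inverse
        holomorphic_fun_T_character J_left assms)
qed (use assms cJ_nonzero in auto)

lemma F1_apply: "t \<in> carrier T \<Longrightarrow> F\<^sub>1 (m, z) t = z * inverse (cJ m t)"
  by (simp add: F\<^sub>1_def)

text \<open>On \<open>(x, -1)\<close> the values at the reflected point and at \<open>t\<close>
  combine to the inverse square of \<open>cJ m t\<close> without a sign, which is why the boundary
  map of \<open>E\<close> has second component 0.\<close>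

lemma coboundary_F1:
  assumes m: "m \<in> carrier L" and z: "z \<noteq> 0"
  shows "coboundary (F\<^sub>1 (m, z)) = basic_cocycle (m \<otimes> m) 0"
proof (rule compatible_eqI)
  show "compatible \<one> (coboundary (F\<^sub>1 (m, z)))"
    by (rule compatible_coboundary[OF F1_closed[OF m z]])
  show "compatible (m \<otimes> m) (basic_cocycle (m \<otimes> m) 0)"
    using m by (intro compatible_basic_cocycle) simp
  fix s t assume st: "s \<in> carrier \<Theta>" "t \<in> carrier T"
  obtain x \<epsilon> where s: "s = (x, \<epsilon>)" "x \<in> carrier H" "\<epsilon> = 1 \<or> \<epsilon> = -1" using st(1) by auto
  show "coboundary (F\<^sub>1 (m, z)) s t = basic_cocycle (m \<otimes> m) 0 s t"
    using st s(2,3) m z cJ_nonzero[OF m st(2)]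
    by (auto simp: s(1) coboundary_apply basic_cocycle_apply F1_apply R_apply cJ_mult cJ_exp cJ_inv
        cJ_add eJ_add field_simps)
qed

lemma hom_F0: "F\<^sub>0 \<in> hom E\<^sub>0 C\<^sub>0"
proof (rule homI)
  fix p assume "p \<in> carrier E\<^sub>0"
  then show "F\<^sub>0 p \<in> carrier C\<^sub>0"
    by (cases p) (auto simp: F\<^sub>0_def intro!: centraliser0_closed compatible_basic_cocycle)
next
  fix p q assume "p \<in> carrier E\<^sub>0" "q \<in> carrier E\<^sub>0"
  then obtain n \<iota> n' \<iota>' where p: "p = (n, \<iota>)" "n \<in> carrier L" and q: "q = (n', \<iota>')" "n' \<in> carrier L"
    by auto
  let ?\<xi> = "\<lambda>s\<in>carrier \<Theta>. \<lambda>t\<in>carrier T.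
    basic_cocycle n' \<iota>' s t * basic_cocycle n \<iota> s (two_torsion n' \<otimes>\<^bsub>T\<^esub> t)"
  have "basic_cocycle (n \<otimes> n') ((\<iota> + \<iota>' + J n' n) mod 2) = ?\<xi>"
  proof (rule compatible_eqI)
    show "compatible (n \<otimes> n') (basic_cocycle (n \<otimes> n') ((\<iota> + \<iota>' + J n' n) mod 2))"
      using p q by (intro compatible_basic_cocycle) simp
    show "compatible (n \<otimes> n') ?\<xi>"
      by (intro compatible_mult compatible_basic_cocycle p q)
    fix s t assume st: "s \<in> carrier \<Theta>" "t \<in> carrier T"
    have "fst s \<in> carrier H" using st(1) by auto
    then show "basic_cocycle (n \<otimes> n') ((\<iota> + \<iota>' + J n' n) mod 2) s t = ?\<xi> s t"
      using st p(2) q(2) cJ_nonzero[OF _ st(2)]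
      by (simp add: basic_cocycle_apply eJ_add cJ_add cJ_mult cJ_two_torsion minus_one_powi_mod
          power_int_add power_int_minus[symmetric] power_int_minus_one_minus mult_ac del: Theta_simps)
  qed
  then show "F\<^sub>0 (p \<otimes>\<^bsub>E\<^sub>0\<^esub> q) = F\<^sub>0 p \<otimes>\<^bsub>C\<^sub>0\<^esub> F\<^sub>0 q"
    using p q by (simp add: F\<^sub>0_def centraliser0_mult trans_mult)
qed

lemma hom_F1: "F\<^sub>1 \<in> hom (L \<times>\<times> Cmult) U"
proof (rule homI)
  fix a b assume "a \<in> carrier (L \<times>\<times> Cmult)" "b \<in> carrier (L \<times>\<times> Cmult)"
  then obtain m z n w where ab: "a = (m, z)" "b = (n, w)" "m \<in> carrier L" "n \<in> carrier L"
    by auto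
  then show "F\<^sub>1 (a \<otimes>\<^bsub>L \<times>\<times> Cmult\<^esub> b) = F\<^sub>1 a \<otimes>\<^bsub>U\<^esub> F\<^sub>1 b"
    by (auto simp: F\<^sub>1_def U_simps(2) cJ_add intro!: restrict_ext)
qed (auto intro: F1_closed)

lemma xmod_hom_F: "xmod_hom E C F\<^sub>1 F\<^sub>0"
  unfolding xmod_hom_def C_simps E_simps
proof (intro conjI ballI)
  fix a assume "a \<in> carrier (L \<times>\<times> Cmult)"
  then obtain m z where a: "a = (m, z)" "m \<in> carrier L" "z \<noteq> 0" by auto
  have "trans (m \<otimes> m) = trans \<one>"
    using a(2) two_torsion_eq_one_iff[of "m \<otimes> m"] trans_eq_one_iff[of "m \<otimes> m"]
    by (auto simp: trans_one)
  then show "bnd C (F\<^sub>1 a) = F\<^sub>0 (bnd E a)"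
    using a by (simp add: bnd_C[OF F1_closed] coboundary_F1 E_simps square F\<^sub>0_def)
  fix p assume "p \<in> carrier E\<^sub>0"
  then obtain n \<iota> where p: "p = (n, \<iota>)" "n \<in> carrier L" by auto
  show "F\<^sub>1 (act E a p) = act C (F\<^sub>1 a) (F\<^sub>0 p)"
    using a p(2)
    by (auto simp: p(1) a(1) E_simps F\<^sub>0_def C_simps F\<^sub>1_def compose_def trans_apply cJ_mult
        cJ_two_torsion power_int_minus[symmetric] power_int_minus_one_minus mult_ac
        intro!: restrict_ext)
qed (rule crossed_module_E crossed_module_C hom_F1 hom_F0)+

text \<open>The torus is a single orbit of its translations, so constancy follows from homogeneity
  alone.\<close>

lemma translation_invariant_const:
  assumes "\<And>x t. x \<in> carrier H \<Longrightarrow> t \<in> carrier T \<Longrightarrow> f (R (x, 1) t) = f t" "t \<in> carrier T"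
  shows "f t = f \<one>\<^bsub>T\<^esub>"
proof -
  obtain x where x: "x \<in> carrier H" "t = exp_T L x" using assms(2) by (rule exp_T_surj)
  then show ?thesis using assms(1)[of x "\<one>\<^bsub>T\<^esub>"] by (simp add: R_apply)
qed

text \<open>Both kernels are copies of the nonzero scalars: doubling on the lattice is injective,
  and a unit with trivial coboundary is invariant under all translations. The inverse of
  \<open>F\<^sub>1\<close> reads off the value at the unit of the torus.\<close>

lemma F1_iso: "F\<^sub>1 \<in> iso (pi1 E) (pi1 C)"
proof -
  have sq: "m \<in> carrier L \<and> m \<otimes> m = \<one> \<longleftrightarrow> m = \<one>" for m
    using square_eq_one[of m] by auto
  have kE: "kernel (L \<times>\<times> Cmult) E\<^sub>0 (bnd E) = {\<one>} \<times> (UNIV - {0})"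
  proof (rule Set.set_eqI)
    fix a :: "'l \<times> complex"
    show "a \<in> kernel (L \<times>\<times> Cmult) E\<^sub>0 (bnd E) \<longleftrightarrow> a \<in> {\<one>} \<times> (UNIV - {0})"
      using sq[of "fst a"] by (cases a) (auto simp: kernel_def E_simps square)
  qed
  have kC: "kernel U C\<^sub>0 (bnd C) = {f \<in> carrier U. \<forall>t\<in>carrier T. f t = f \<one>\<^bsub>T\<^esub>}"
  proof (intro equalityI subsetI CollectI conjI)
    fix f assume "f \<in> kernel U C\<^sub>0 (bnd C)"
    then have f: "f \<in> carrier U" "bnd C f = \<one>\<^bsub>C\<^sub>0\<^esub>" by (simp_all add: kernel_def)
    show "f \<in> carrier U" by (rule f)
    from f have cob: "coboundary f = (\<lambda>s\<in>carrier \<Theta>. \<lambda>t\<in>carrier T. 1)"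
      by (simp add: bnd_C centraliser0_one)
    show "\<forall>t\<in>carrier T. f t = f \<one>\<^bsub>T\<^esub>"
    proof (intro ballI translation_invariant_const)
      fix x t assume x: "x \<in> carrier H" and t: "t \<in> carrier T"
      have "inverse (f (R (x, 1) t)) * f t = 1"
        using coboundary_apply[of "(x, 1)" t f] x t by (simp add: cob)
      then show "f (R (x, 1) t) = f t"
        using U_nonzero[OF f(1) R_closed[of "(x, 1)" t]] x t by (simp add: field_simps)
    qed
  next
    fix f assume "f \<in> {f \<in> carrier U. \<forall>t\<in>carrier T. f t = f \<one>\<^bsub>T\<^esub>}"
    then have f: "f \<in> carrier U" "\<And>t. t \<in> carrier T \<Longrightarrow> f t = f \<one>\<^bsub>T\<^esub>" by blast+
    have "inverse (f (R s t)) * f t = 1" if "s \<in> carrier \<Theta>" "t \<in> carrier T" for s t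
      using f(2)[OF R_closed[OF that]] f(2)[OF that(2)] U_nonzero[OF f(1), of "\<one>\<^bsub>T\<^esub>"] by simp
    then have "coboundary f = (\<lambda>s\<in>carrier \<Theta>. \<lambda>t\<in>carrier T. 1)"
      unfolding coboundary_def by (auto intro!: restrict_ext)
    with f show "f \<in> kernel U C\<^sub>0 (bnd C)" by (simp add: kernel_def bnd_C centraliser0_one)
  qed
  have F1_one: "F\<^sub>1 (\<one>, z) = (\<lambda>t\<in>carrier T. z)" for z
    by (auto simp: F\<^sub>1_def cJ_one intro!: restrict_ext)
  have "bij_betw F\<^sub>1 ({\<one>} \<times> (UNIV - {0})) {f \<in> carrier U. \<forall>t\<in>carrier T. f t = f \<one>\<^bsub>T\<^esub>}"
  proof (rule bij_betwI[where g="\<lambda>f. (\<one>, f \<one>\<^bsub>T\<^esub>)"])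
    show "F\<^sub>1 \<in> {\<one>} \<times> (UNIV - {0}) \<rightarrow> {f \<in> carrier U. \<forall>t\<in>carrier T. f t = f \<one>\<^bsub>T\<^esub>}"
      using F1_closed[OF one_closed] by (auto simp: F1_one)
    show "F\<^sub>1 (\<one>, f \<one>\<^bsub>T\<^esub>) = f" if "f \<in> {f \<in> carrier U. \<forall>t\<in>carrier T. f t = f \<one>\<^bsub>T\<^esub>}" for f
    proof (rule U_eqI)
      show f: "f \<in> carrier U" using that by blast
      show "F\<^sub>1 (\<one>, f \<one>\<^bsub>T\<^esub>) \<in> carrier U"
        by (rule F1_closed[OF one_closed U_nonzero[OF f T.one_closed]])
      fix t assume t: "t \<in> carrier T"
      then have "F\<^sub>1 (\<one>, f \<one>\<^bsub>T\<^esub>) t = f \<one>\<^bsub>T\<^esub>" by (simp add: F1_one)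
      also have "\<dots> = f t"
        using CollectD[OF that, THEN conjunct2, THEN bspec, OF t] by (rule sym)
      finally show "F\<^sub>1 (\<one>, f \<one>\<^bsub>T\<^esub>) t = f t" .
    qed
    show "(\<lambda>f. (\<one>, f \<one>\<^bsub>T\<^esub>)) \<in> {f \<in> carrier U. \<forall>t\<in>carrier T. f t = f \<one>\<^bsub>T\<^esub>} \<rightarrow> {\<one>} \<times> (UNIV - {0})"
      using U_nonzero[OF _ T.one_closed] by blast
  qed (auto simp: F1_one)
  then have bij: "bij_betw F\<^sub>1 (carrier (pi1 E)) (carrier (pi1 C))"
    unfolding pi1_def C_simps E_simps kE kC by simp
  have "F\<^sub>1 \<in> hom (pi1 E) (pi1 C)"
  proof (rule homI)
    show "F\<^sub>1 a \<in> carrier (pi1 C)" if "a \<in> carrier (pi1 E)" for a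
      using bij that by (rule bij_betwE[THEN bspec])
    show "F\<^sub>1 (a \<otimes>\<^bsub>pi1 E\<^esub> b) = F\<^sub>1 a \<otimes>\<^bsub>pi1 C\<^esub> F\<^sub>1 b"
      if "a \<in> carrier (pi1 E)" "b \<in> carrier (pi1 E)" for a b
      using that hom_mult[OF hom_F1, of a b] by (simp add: pi1_def C_simps E_simps kernel_def)
  qed
  with bij show ?thesis by (simp add: iso_def)
qed

text \<open>A trivial translation makes \<open>n\<close> a doubled element
  \<open>m \<otimes> m\<close>, so the coboundaries of \<open>f\<close> and of
  \<open>F\<^sub>1 (m, 1)\<close> differ at most by the sign attached to inversion. Inversion fixes
  the unit of the torus, where both coboundaries are therefore 1, and the sign is exposed as
  trivial.\<close>

lemma F0_reflects_image:
  assumes "p \<in> carrier E\<^sub>0" "F\<^sub>0 p \<in> bnd C ` carrier U"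
  shows "p \<in> bnd E ` carrier (L \<times>\<times> Cmult)"
proof -
  obtain n \<iota> where p: "p = (n, \<iota>)" "n \<in> carrier L" "\<iota> = 0 \<or> \<iota> = 1" using assms(1) by auto
  obtain f where f: "f \<in> carrier U" "F\<^sub>0 p = bnd C f" using assms(2) by blast
  then have tr: "trans n = \<one>\<^bsub>A\<^sub>T\<^esub>" and coc: "basic_cocycle n \<iota> = coboundary f"
    by (simp_all add: bnd_C p(1) F\<^sub>0_def trans_one)
  obtain m where m: "m \<in> carrier L" "n = m \<otimes> m"
    using tr trans_eq_one_iff[OF p(2)] two_torsion_eq_one_iff[OF p(2)] by blast
  define u where "u = F\<^sub>1 (m, 1)"
  have u: "u \<in> carrier U" unfolding u_def by (rule F1_closed[OF m(1)]) simp
  have coc': "basic_cocycle n 0 = coboundary u"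
    unfolding u_def m(2) using m(1) by (simp add: coboundary_F1)
  note nz = U_nonzero[OF f(1)] U_nonzero[OF u]
  have eq: "(if snd s = 1 then 1 else (-1) powi \<iota>) * (inverse (u (R s t)) * u t) = inverse (f (R s t)) * f t"
    if "s \<in> carrier \<Theta>" "t \<in> carrier T" for s t
    using fun_cong[OF fun_cong[OF coc, of s], of t] fun_cong[OF fun_cong[OF coc', of s], of t] that
    by (simp add: coboundary_apply basic_cocycle_apply del: Theta_simps split: if_splits)
       (metis mult.left_commute)
  have const: "f t / u t = f \<one>\<^bsub>T\<^esub> / u \<one>\<^bsub>T\<^esub>" if "t \<in> carrier T" for t
  proof (rule translation_invariant_const[OF _ that])
    fix x t assume xt: "x \<in> carrier H" "t \<in> carrier T"
    then have r: "R (x, 1) t \<in> carrier T" by simp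
    show "f (R (x, 1) t) / u (R (x, 1) t) = f t / u t"
      using eq[of "(x, 1)" t] xt nz(1)[OF r] nz(2)[OF r] nz(1)[OF xt(2)] nz(2)[OF xt(2)]
      by (simp add: field_simps)
  qed
  have "(-1 :: complex) powi \<iota> = 1"
  proof -
    have s: "(\<one>\<^bsub>H\<^esub>, -1) \<in> carrier \<Theta>" by simp
    have "R (\<one>\<^bsub>H\<^esub>, -1) \<one>\<^bsub>T\<^esub> = \<one>\<^bsub>T\<^esub>" by (simp add: R_apply)
    then show ?thesis using eq[OF s, of "\<one>\<^bsub>T\<^esub>"] nz(1)[of "\<one>\<^bsub>T\<^esub>"] nz(2)[of "\<one>\<^bsub>T\<^esub>"] by simp
  qed
  then have "\<iota> = 0" using p(3) by auto
  then have "p = bnd E (m, 1)" using m by (simp add: p(1) E_simps square)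
  then show ?thesis using m(1) by auto
qed

lemma descend_cocycle:
  assumes n: "n \<in> carrier L" and \<xi>: "compatible n \<xi>"
  obtains f where "f \<in> carrier U"
    "\<And>x t. x \<in> carrier H \<Longrightarrow> t \<in> carrier T \<Longrightarrow> \<xi> (x, 1) t = eJ n x * coboundary f (x, 1) t"
proof -
  \<comment> \<open>The desired equation at the unit, normalised so that \<open>f\<close> is 1
    there, gives this quotient as the value of \<open>f\<close> at the exponential of
    \<open>x\<close>.\<close>
  define g where "g x = eJ n x * inverse (\<xi> (x, 1) \<one>\<^bsub>T\<^esub>)" for x
  have nz: "\<xi> (x, 1) t \<noteq> 0" if "x \<in> carrier H" "t \<in> carrier T" for x t
    using compatibleD(5)[OF \<xi>, of "(x, 1)" t] that by simp
  have add: "\<xi> (x \<otimes>\<^bsub>H\<^esub> y, 1) t = \<xi> (x, 1) (exp_T L y \<otimes>\<^bsub>T\<^esub> t) * \<xi> (y, 1) t"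
    if "x \<in> carrier H" "y \<in> carrier H" "t \<in> carrier T" for x y t
    using compatibleD(4)[OF \<xi>, of "(x, 1)" "(y, 1)" t] that by (simp add: R_apply)
  \<comment> \<open>Moving \<open>y\<close> by a lattice element multiplies numerator and
    denominator by the same sign.\<close>
  have periodic: "g x = g y" if xy: "x \<in> carrier H" "y \<in> carrier H" "exp_T L x = exp_T L y" for x y
  proof -
    obtain m where m: "m \<in> carrier L" "x = y \<otimes>\<^bsub>H\<^esub> pure_tensor L Cadd m 1"
      using xy by (rule exp_T_eq)
    have "\<xi> (x, 1) \<one>\<^bsub>T\<^esub> = \<xi> (y, 1) \<one>\<^bsub>T\<^esub> * (-1) powi J m n"
      using add[of y "pure_tensor L Cadd m 1" "\<one>\<^bsub>T\<^esub>"] xy(2) m(1) compatibleD(3)[OF \<xi> m(1)]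
      by (simp add: m(2) exp_T_lattice)
    moreover have "eJ n x = eJ n y * (-1) powi J m n"
      using xy(2) m(1) n by (simp add: m(2) eJ_mult eJ_lattice)
    ultimately show ?thesis by (simp add: g_def)
  qed
  \<comment> \<open>By \<open>periodic\<close> any logarithm of \<open>t\<close> gives the same
    value, so the choice is harmless.\<close>
  define f where "f = (\<lambda>t\<in>carrier T. g (SOME x. x \<in> carrier H \<and> exp_T L x = t))"
  have f_exp: "f (exp_T L x) = g x" if x: "x \<in> carrier H" for x
  proof -
    define y where "y = (SOME y. y \<in> carrier H \<and> exp_T L y = exp_T L x)"
    have y: "y \<in> carrier H \<and> exp_T L y = exp_T L x"
      unfolding y_def by (rule someI[of _ x]) (simp add: x)
    have "f (exp_T L x) = g y" using x by (simp add: f_def y_def)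
    also have "\<dots> = g x" using y x by (intro periodic) simp_all
    finally show ?thesis .
  qed
  have f: "f \<in> carrier U"
  proof -
    have "f t \<noteq> 0" if t: "t \<in> carrier T" for t
    proof -
      obtain x where x: "x \<in> carrier H" "t = exp_T L x" using t by (rule exp_T_surj)
      show ?thesis unfolding x(2) f_exp[OF x(1)] g_def using nz[OF x(1)] by simp
    qed
    moreover have "holomorphic_fun_T L B f"
    proof (rule holomorphic_fun_T_descend)
      have e: "holomorphic_fun_hT L B (\<lambda>x t. eJ n x)"
        unfolding eJ_def by (rule holomorphic_fun_hT_exp[OF J_left[OF n]])
      show "holomorphic_fun_hT L B (\<lambda>x t. eJ n x * inverse (\<xi> (x, 1) t))"
        by (intro holomorphic_fun_hT_mult e holomorphic_fun_hT_inverse compatibleD(2)[OF \<xi>] nz) simp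
    qed (simp add: f_exp g_def)
    ultimately have "restrict f (carrier T) \<in> carrier U" by (rule U_I)
    moreover have "restrict f (carrier T) = f" by (simp add: f_def)
    ultimately show ?thesis by simp
  qed
  have "\<xi> (x, 1) t = eJ n x * coboundary f (x, 1) t" if x: "x \<in> carrier H" and t: "t \<in> carrier T" for x t
  proof -
    \<comment> \<open>At the exponential of \<open>y\<close> the claim is the cocycle identity for
      \<open>x\<close> and \<open>y\<close> read at the unit.\<close>
    obtain y where y: "y \<in> carrier H" "t = exp_T L y" using t by (rule exp_T_surj)
    have "coboundary f (x, 1) t = inverse (f (R (x, 1) t)) * f t"
      using x t by (intro coboundary_apply) auto
    also have "R (x, 1) t = exp_T L (x \<otimes>\<^bsub>H\<^esub> y)" using x y by (simp add: R_apply)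
    also have "f \<dots> = g (x \<otimes>\<^bsub>H\<^esub> y)" using x y(1) by (intro f_exp) simp
    also have "f t = g y" unfolding y(2) by (rule f_exp[OF y(1)])
    finally have "coboundary f (x, 1) t = inverse (g (x \<otimes>\<^bsub>H\<^esub> y)) * g y" .
    then show ?thesis
      using add[OF x y(1) T.one_closed] nz[OF y(1) T.one_closed] nz[OF x t] x y n
      by (simp add: g_def eJ_mult field_simps)
  qed
  with f show thesis by (rule that)
qed

lemma F0_essentially_surjective:
  assumes "p \<in> carrier C\<^sub>0"
  shows "\<exists>q\<in>carrier E\<^sub>0. \<exists>f\<in>carrier U. p = F\<^sub>0 q \<otimes>\<^bsub>C\<^sub>0\<^esub> bnd C f"
proof -
  obtain n \<xi> where p: "p = (trans n, \<xi>)" and n: "n \<in> carrier L" and \<xi>: "compatible n \<xi>"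
    using assms by (rule centraliser0_cases)
  obtain f where f: "f \<in> carrier U" and
    f_eq: "\<And>x t. x \<in> carrier H \<Longrightarrow> t \<in> carrier T \<Longrightarrow> \<xi> (x, 1) t = eJ n x * coboundary f (x, 1) t"
    using n \<xi> by (rule descend_cocycle) blast
  note bas = compatible_basic_cocycle[OF n, of 0] and cob = compatible_coboundary[OF f]
  \<comment> \<open>A quotient of cocycles is a cocycle because the units commute. The sign 0 in the
    standard cocycle is provisional and is corrected by \<open>\<iota>\<close> below.\<close>
  define \<psi> where "\<psi> s t = \<xi> s t / (basic_cocycle n 0 s t * coboundary f s t)" for s t
  have \<psi>: "\<xi> s t = \<psi> s t * (basic_cocycle n 0 s t * coboundary f s t)"
    if "s \<in> carrier \<Theta>" "t \<in> carrier T" for s t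
    using compatibleD(5)[OF bas that] compatibleD(5)[OF cob that] by (simp add: \<psi>_def)
  have \<psi>_mult: "\<psi> (s \<otimes>\<^bsub>\<Theta>\<^esub> s') t = \<psi> s (R s' t) * \<psi> s' t"
    if "s \<in> carrier \<Theta>" "s' \<in> carrier \<Theta>" "t \<in> carrier T" for s s' t
    unfolding \<psi>_def compatibleD(4)[OF \<xi> that] compatibleD(4)[OF bas that] compatibleD(4)[OF cob that]
    by simp
  have \<psi>_one: "\<psi> (x, 1) t = 1" if "x \<in> carrier H" "t \<in> carrier T" for x t
  proof -
    have s: "(x, 1) \<in> carrier \<Theta>" using that by simp
    show ?thesis
      using that f_eq[OF that] compatibleD(5)[OF cob s that(2)]
      by (simp add: \<psi>_def basic_cocycle_apply)
  qed
  let ?\<tau> = "(\<one>\<^bsub>H\<^esub>, -1 :: int)"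
  have \<tau>: "?\<tau> \<in> carrier \<Theta>" by simp
  define c where "c = \<psi> ?\<tau> \<one>\<^bsub>T\<^esub>"
  have const: "\<psi> ?\<tau> t = c" if "t \<in> carrier T" for t
    unfolding c_def
  proof (rule translation_invariant_const[OF _ that])
    fix x t assume x: "x \<in> carrier H" and t: "t \<in> carrier T"
    have "\<psi> ?\<tau> (R (x, 1) t) = \<psi> (?\<tau> \<otimes>\<^bsub>\<Theta>\<^esub> (x, 1)) t"
      using \<psi>_mult[OF \<tau>, of "(x, 1)" t] \<psi>_one[OF x t] x t by simp
    \<comment> \<open>Moving a translation past inversion inverts it. Since \<open>\<psi>\<close> is
      1 on translations, its value at \<open>?\<tau>\<close> is invariant under them.\<close>
    also have "?\<tau> \<otimes>\<^bsub>\<Theta>\<^esub> (x, 1) = (inv\<^bsub>H\<^esub> x, 1) \<otimes>\<^bsub>\<Theta>\<^esub> ?\<tau>"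
      using x by simp
    also have "\<psi> \<dots> t = \<psi> ?\<tau> t"
      using \<psi>_mult[of "(inv\<^bsub>H\<^esub> x, 1)" ?\<tau> t] \<psi>_one[of "inv\<^bsub>H\<^esub> x" "R ?\<tau> t"] x t R_closed[OF \<tau> t]
      by simp
    finally show "\<psi> ?\<tau> (R (x, 1) t) = \<psi> ?\<tau> t" .
  qed
  \<comment> \<open>Inversion has square one and \<open>\<psi>\<close> is constant on it, so the
    cocycle identity at the unit reduces to this.\<close>
  have "c * c = 1"
    using \<psi>_mult[OF \<tau> \<tau> T.one_closed] \<psi>_one[of "\<one>\<^bsub>H\<^esub>" "\<one>\<^bsub>T\<^esub>"]
      const[OF R_closed[OF \<tau> T.one_closed]] const[OF T.one_closed] by simp
  then have c: "c = 1 \<or> c = -1" by (simp add: square_eq_1_iff)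
  define \<iota> :: int where "\<iota> = (if c = 1 then 0 else 1)"
  have c_\<iota>: "c = (-1) powi \<iota>" using c by (auto simp: \<iota>_def)
  have eq: "\<xi> s t = coboundary f s t * basic_cocycle n \<iota> s t"
    if st: "s \<in> carrier \<Theta>" "t \<in> carrier T" for s t
  proof -
    obtain x \<epsilon> where s: "s = (x, \<epsilon>)" "x \<in> carrier H" "\<epsilon> = 1 \<or> \<epsilon> = -1" using st(1) by auto
    \<comment> \<open>The element \<open>(x, -1)\<close> is the translation \<open>(x, 1)\<close>
      times \<open>?\<tau>\<close>.\<close>
    have "\<psi> (x, -1) t = c"
      using \<psi>_mult[of "(x, 1)" ?\<tau> t] \<psi>_one[of x "R ?\<tau> t"] const[OF st(2)] s(2) st(2)
        R_closed[OF \<tau> st(2)] by simp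
    then show ?thesis
      using s(3) \<psi>[OF st] \<psi>_one[OF s(2) st(2)] st s(2)
      by (auto simp: s(1) basic_cocycle_apply c_\<iota>)
  qed
  \<comment> \<open>The neutral translation is written out to match the product formula for pairs,
    whose right factor is here a boundary.\<close>
  have "\<xi> = (\<lambda>s\<in>carrier \<Theta>. \<lambda>t\<in>carrier T.
      coboundary f s t * basic_cocycle n \<iota> s (two_torsion \<one> \<otimes>\<^bsub>T\<^esub> t))"
    using \<xi> compatible_mult[OF compatible_basic_cocycle[OF n, of \<iota>] cob n one_closed]
    by (rule compatible_eqI) (simp add: eq two_torsion_one del: Theta_simps)
  then have "p = F\<^sub>0 (n, \<iota>) \<otimes>\<^bsub>C\<^sub>0\<^esub> bnd C f"
    using n by (simp add: p F\<^sub>0_def bnd_C[OF f] centraliser0_mult trans_mult)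
  moreover have "(n, \<iota>) \<in> carrier E\<^sub>0" using n by (simp add: \<iota>_def)
  ultimately show ?thesis using f by blast
qed

lemma xmod_equivalence_F: "xmod_equivalence E C F\<^sub>1 F\<^sub>0"
  unfolding xmod_equivalence_def
proof (intro conjI xmod_hom_F F1_iso pi0_map_iso[OF xmod_hom_F])
  show "\<exists>q\<in>carrier (Base E). \<exists>f\<in>carrier (Top C). p = F\<^sub>0 q \<otimes>\<^bsub>Base C\<^esub> bnd C f"
    if "p \<in> carrier (Base C)" for p
    using F0_essentially_surjective that unfolding C_simps E_simps .
  show "p \<in> bnd E ` carrier (Top E)" if "p \<in> carrier (Base E)" "F\<^sub>0 p \<in> bnd C ` carrier (Top C)" for p
    using F0_reflects_image that unfolding C_simps E_simps .
qed

end

theorem theorem4p3: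
  fixes L :: "'l monoid" and B :: "'l set" and I J :: "'l \<Rightarrow> 'l \<Rightarrow> int"
  assumes "comm_group L" and "int_basis L B"
    and "int_bilinear L I"
    and "\<And>m n. m \<in> carrier L \<Longrightarrow> n \<in> carrier L \<Longrightarrow> I m n = I n m"
    and "\<And>m. m \<in> carrier L \<Longrightarrow> even (I m m)"
    and "int_bilinear L J"
    and "\<And>m n. m \<in> carrier L \<Longrightarrow> n \<in> carrier L \<Longrightarrow> I m n = J m n + J n m"
  shows "\<exists>F1 F0. xmod_equivalence (E_xmod L J) (C_rbas L B J) F1 F0"
proof -
  interpret basic_representation L B J
    using assms(1,2,6)
    by (simp add: basic_representation_def basic_representation_axioms_def lattice_torus_def
        based_lattice_def based_lattice_axioms_def)
  show ?thesis using xmod_equivalence_F by blast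
qed

end
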